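(* Let $n\ge1$, let $d\ge1$, and let $T_1,\dots,T_d$ be nonempty types with $T_i=A_1^{m_1^{(i)}}*A_2^{m_2^{(i)}}*\cdots*A_n^{m_n^{(i)}}$, so that $\operatorname{rk}T_i=\sum_{j}j\,m_j^{(i)}$. Then $$N_{A_n}(T_1,\dots,T_d)=(n+1)^{d-1}\binom{n+1}{\operatorname{rk}T_1+\dots+\operatorname{rk}T_d+1}\prod_{i=1}^d\frac{1}{n-\operatorname{rk}T_i+1}\binom{n-\operatorname{rk}T_i+1}{m_1^{(i)},m_2^{(i)},\dots,m_n^{(i)}},$$ where $\binom{M}{m_1,\dots,m_n}=\frac{M!}{m_1!\cdots m_n!\,(M-m_1-\dots-m_n)!}$.
   Context: For a finite root system $\Phi$ with reflection group $W$, identity $\varepsilon$, absolute length $\ell_T$ (minimal number of reflections in a factorisation), absolute order $u\le_T w$ iff $\ell_T(w)=\ell_T(u)+\ell_T(u^{-1}w)$, and fixed Coxeter element $c$: every $w\le_T c$ is a Coxeter element of a parabolic subgroup of $W$, and the type of $w$ is the (Cartan–Killing) type of that parabolic subgroup; $A_1^{k_1}*A_2^{k_2}*\cdots$ denotes the type of a direct sum of $k_j$ copies of $A_j$. The decomposition number $N_\Phi(T_1,\dots,T_d)$ is the number of tuples $(c_1,\dots,c_d)$ of elements of $W$, all different from $\varepsilon$, with $c_1\cdots c_d\le_T c$, $\ell_T(c_1)+\dots+\ell_T(c_d)=\ell_T(c_1\cdots c_d)$, and $c_i$ of type $T_i$ for each $i$. Here $\Phi=A_n$. *)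

theory Defs
  imports "HOL-Analysis.Analysis" "HOL-Library.Multiset"
begin

definition reflection :: "'a::real_inner \<Rightarrow> 'a \<Rightarrow> 'a" where
  "reflection \<alpha> x = x - (2 * (x \<bullet> \<alpha>) / (\<alpha> \<bullet> \<alpha>)) *\<^sub>R \<alpha>"

definition comp_list :: "('a \<Rightarrow> 'a) list \<Rightarrow> 'a \<Rightarrow> 'a" where
  "comp_list ws = foldr (\<circ>) ws id"

(* Reflections are involutions, so the products of reflections already form the
   generated group. *)
definition reflection_group :: "'a::real_inner set \<Rightarrow> ('a \<Rightarrow> 'a) set" where
  "reflection_group R = {comp_list (map reflection \<alpha>s) | \<alpha>s. set \<alpha>s \<subseteq> R}"

definition abs_length :: "'a::real_inner set \<Rightarrow> ('a \<Rightarrow> 'a) \<Rightarrow> nat" where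
  "abs_length \<Phi> w =
     (LEAST k. \<exists>\<alpha>s. length \<alpha>s = k \<and> set \<alpha>s \<subseteq> \<Phi> \<and> w = comp_list (map reflection \<alpha>s))"

definition abs_le :: "'a::real_inner set \<Rightarrow> ('a \<Rightarrow> 'a) \<Rightarrow> ('a \<Rightarrow> 'a) \<Rightarrow> bool" where
  "abs_le \<Phi> u w \<longleftrightarrow> abs_length \<Phi> w = abs_length \<Phi> u + abs_length \<Phi> (inv u \<circ> w)"

definition simple_system :: "'a::real_inner set \<Rightarrow> 'a set \<Rightarrow> bool" where
  "simple_system \<Phi> \<Delta> \<longleftrightarrow> \<Delta> \<subseteq> \<Phi> \<and> finite \<Delta> \<and> independent \<Delta> \<and>
     (\<forall>\<beta>\<in>\<Phi>. \<exists>k. \<beta> = (\<Sum>\<alpha>\<in>\<Delta>. k \<alpha> *\<^sub>R \<alpha>) \<and>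
        ((\<forall>\<alpha>\<in>\<Delta>. 0 \<le> k \<alpha>) \<or> (\<forall>\<alpha>\<in>\<Delta>. k \<alpha> \<le> 0)))"

definition coxeter_element :: "'a::real_inner set \<Rightarrow> ('a \<Rightarrow> 'a) \<Rightarrow> bool" where
  "coxeter_element \<Phi> w \<longleftrightarrow>
     (\<exists>\<alpha>s. distinct \<alpha>s \<and> simple_system \<Phi> (set \<alpha>s) \<and> w = comp_list (map reflection \<alpha>s))"

(* All simple systems are allowed here, so conjugates of standard parabolic subgroups are
   included: conjugating by w replaces a simple system \<Delta> by its image under w. *)
definition parabolic_subgroup :: "'a::real_inner set \<Rightarrow> ('a \<Rightarrow> 'a) set \<Rightarrow> bool" where
  "parabolic_subgroup \<Phi> P \<longleftrightarrow>
     (\<exists>\<Delta> J. simple_system \<Phi> \<Delta> \<and> J \<subseteq> \<Delta> \<and> P = reflection_group J)"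

definition roots_of :: "'a::real_inner set \<Rightarrow> ('a \<Rightarrow> 'a) set \<Rightarrow> 'a set" where
  "roots_of \<Phi> P = {\<alpha> \<in> \<Phi>. reflection \<alpha> \<in> P}"

(* The Cartan matrix of some simple system is that of the Dynkin diagram A_j, a path with
   j vertices. *)
definition irreducible_type_A :: "nat \<Rightarrow> 'a::real_inner set \<Rightarrow> bool" where
  "irreducible_type_A j \<Psi> \<longleftrightarrow> 1 \<le> j \<and>
     (\<exists>\<alpha>s. length \<alpha>s = j \<and> distinct \<alpha>s \<and> simple_system \<Psi> (set \<alpha>s) \<and>
        (\<forall>p<j. \<forall>q<j. 2 * (\<alpha>s ! p \<bullet> \<alpha>s ! q) / (\<alpha>s ! q \<bullet> \<alpha>s ! q) =
           (if p = q then 2 else if p = Suc q \<or> q = Suc p then -1 else 0)))"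

(* The type A_1^k_1 * A_2^k_2 * ... is encoded as the multiset containing each j exactly
   k_j times, i.e. the multiset of the ranks of the irreducible components. *)
type_synonym A_type = "nat multiset"

abbreviation rk :: "A_type \<Rightarrow> nat" where
  "rk T \<equiv> \<Sum>\<^sub># T"

definition root_system_has_type :: "'a::real_inner set \<Rightarrow> A_type \<Rightarrow> bool" where
  "root_system_has_type \<Psi> T \<longleftrightarrow>
     (\<exists>\<C> r. finite \<C> \<and> \<Psi> = \<Union>\<C> \<and>
        (\<forall>C\<in>\<C>. \<forall>D\<in>\<C>. C \<noteq> D \<longrightarrow> (\<forall>\<alpha>\<in>C. \<forall>\<beta>\<in>D. \<alpha> \<bullet> \<beta> = 0)) \<and>
        (\<forall>C\<in>\<C>. irreducible_type_A (r C) C) \<and>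
        T = image_mset r (mset_set \<C>))"

definition element_has_type :: "'a::real_inner set \<Rightarrow> ('a \<Rightarrow> 'a) \<Rightarrow> A_type \<Rightarrow> bool" where
  "element_has_type \<Phi> w T \<longleftrightarrow>
     (\<exists>P. parabolic_subgroup \<Phi> P \<and> coxeter_element (roots_of \<Phi> P) w \<and>
          root_system_has_type (roots_of \<Phi> P) T)"

definition decomposition_number ::
    "'a::real_inner set \<Rightarrow> ('a \<Rightarrow> 'a) \<Rightarrow> A_type list \<Rightarrow> nat" where
  "decomposition_number \<Phi> c Ts =
     card {cs. length cs = length Ts \<and> set cs \<subseteq> reflection_group \<Phi> - {id} \<and>
               abs_le \<Phi> (comp_list cs) c \<and>
               sum_list (map (abs_length \<Phi>) cs) = abs_length \<Phi> (comp_list cs) \<and>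
               (\<forall>i<length Ts. element_has_type \<Phi> (cs ! i) (Ts ! i))}"

(* With CARD('i) = n + 1 this is the root system A_n. *)
definition roots_A :: "(real ^ 'i) set" where
  "roots_A = {axis a 1 - axis b 1 | a b. a \<noteq> b}"

(* The lower entries are m 1, ..., m n; the coefficient vanishes if they add up to more
   than M (reciprocals of factorials of negative integers being 0). *)
definition multinomial :: "nat \<Rightarrow> nat \<Rightarrow> (nat \<Rightarrow> nat) \<Rightarrow> real" where
  "multinomial M n m =
     (if (\<Sum>j=1..n. m j) \<le> M
      then fact M / ((\<Prod>j=1..n. fact (m j)) * fact (M - (\<Sum>j=1..n. m j)))
      else 0)"

end

theory Submission
  imports Defs "HOL-Combinatorics.Cycles" "HOL-Combinatorics.Orbits"
    "HOL-Combinatorics.Multiset_Permutations"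
begin

text \<open>
  Identify the reflection group with the permutations of the \<open>N = n + 1\<close> coordinates: absolute
  length is \<open>N\<close> minus the number of cycles, Coxeter elements are \<open>N\<close>-cycles, and types are cycle
  types. Appending \<open>(c\<^sub>1 \<cdots> c\<^sub>d)\<^sup>-\<^sup>1c\<close> as a last factor of arbitrary type, one has to count
  factorisations of \<open>c\<close> whose ranks add up to \<open>N - 1\<close>. Under this rank condition a product is an
  \<open>N\<close>-cycle iff the cycles of all factors together connect the \<open>N\<close> points, that is, iff they form
  a hypertree; this depends only on the partitions of the points into cycles.

  Fix two blocks \<open>A\<close> and \<open>B\<close> of a hypertree. All elements of \<open>A\<close> but one, namely the one leading
  to \<open>B\<close>, can be moved from \<open>A\<close> to \<open>B\<close>. Double counting the moves shows that the number of
  hypertrees with labelled blocks of given sizes, multiplied by the product of all \<open>(size - 1)!\<close>,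
  does not change when sizes are shifted from one block to another. Concentrating first each
  factor in a single nontrivial block, and then everything in one block, leaves an evident count.
  Since \<open>(size - 1)!\<close> is the number of cyclic orders of a block, the number of factorisations with
  labelled cycles does not depend on the cycle lengths, and the type of a factor enters only
  through the number of arrangements of its cycle lengths, a multinomial coefficient.
\<close>

section \<open>Linear relations between coordinate differences\<close>

text \<open>Connectivity is treated as linear algebra: \<open>a\<close> and \<open>b\<close> are
  connected by a family of blocks iff \<open>rt a b\<close> lies in the span of the differences
  inside the blocks. Acyclicity needs no separate treatment: if the block sizes minus one add up to
  N - 1, the dimension is only just sufficient and no relation can be spared. The same spans
  describe cycles of permutations and products of reflections.

  The constants arise as follows. Factor i has \<open>l i\<close> = N - rank cycles. Numbering them
  costs (\<open>l i\<close>)!, while the concentrated hypertrees contribute (\<open>l i\<close> -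
  1)!, so 1 / \<open>l i\<close> remains. The additional last factor has s + 1 cycles, s being the
  sum of the given ranks. Its free type admits binomial(N - 1, s) compositions of N into s + 1
  parts; with 1 / (s + 1) and one of the d factors N this becomes binomial(N, s + 1).

  The type of an element is defined by an existential over parabolic subgroups and orthogonal
  decompositions of their roots, so its uniqueness has to be proved as well as its
  existence.\<close>

definition rt :: "'i::finite \<Rightarrow> 'i \<Rightarrow> real ^ 'i" where
  "rt a b = axis a 1 - axis b 1"

text \<open>The zero vectors \<open>rt a a\<close> are kept, so that singleton blocks need no
  special case; \<open>root_block\<close> below is the version without them.\<close>

definition diffset :: "'i::finite set \<Rightarrow> (real ^ 'i) set" where
  "diffset B = {rt a b | a b. a \<in> B \<and> b \<in> B}"

lemma diffsetI: "a \<in> B \<Longrightarrow> b \<in> B \<Longrightarrow> rt a b \<in> diffset B"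
  unfolding diffset_def by blast

lemma diffset_mono: "A \<subseteq> B \<Longrightarrow> diffset A \<subseteq> diffset B"
  unfolding diffset_def by blast

lemma rt_self [simp]: "rt a a = 0"
  by (simp add: rt_def)

lemma rt_nth: "rt a b $ x = of_bool (x = a) - of_bool (x = b)"
  by (auto simp: rt_def axis_def)

lemma rt_eq_iff: "rt a b = rt c d \<longleftrightarrow> a = b \<and> c = d \<or> a = c \<and> b = d"
proof
  assume *: "rt a b = rt c d"
  have "of_bool (x = a) - of_bool (x = b) = (of_bool (x = c) - of_bool (x = d) :: real)" for x
    using arg_cong[OF *, of "\<lambda>v. v $ x"] by (simp add: rt_nth)
  from this[of a] this[of b] this[of c] this[of d]
  show "a = b \<and> c = d \<or> a = c \<and> b = d" by (auto split: if_splits simp: of_bool_def)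
qed auto

lemma rt_eq_0_iff: "rt a b = 0 \<longleftrightarrow> a = b"
  using rt_eq_iff[of a b a a] by auto

lemma diffset_singleton [simp]: "diffset {x} = {0}"
  unfolding diffset_def by auto

lemma inner_rt: "v \<bullet> rt a b = v $ a - v $ b"
  by (simp add: rt_def inner_diff_right inner_axis)

lemma rt_span_refl [simp]: "rt a a \<in> span S"
  by (simp add: span_zero)

lemma rt_span_sym: "rt a b \<in> span S \<Longrightarrow> rt b a \<in> span S"
  using span_neg[of "rt a b" S] by (simp add: rt_def)

lemma rt_span_trans: "rt a b \<in> span S \<Longrightarrow> rt b c \<in> span S \<Longrightarrow> rt a c \<in> span S"
  using span_add[of "rt a b" S "rt b c"] by (simp add: rt_def)

text \<open>The indicator vector of \<open>C\<close> is orthogonal to every generator, hence to the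
  whole span. This is the standard way below to keep a difference out of a span: exhibit a set of
  points that no generator leaves.\<close>

lemma rt_span_class:
  assumes S: "\<And>v. v \<in> S \<Longrightarrow> \<exists>a b. v = rt a b \<and> (a \<in> C \<longleftrightarrow> b \<in> C)"
    and xy: "rt x y \<in> span S"
  shows "x \<in> C \<longleftrightarrow> y \<in> C"
proof -
  let ?u = "(\<chi> a. of_bool (a \<in> C)) :: real ^ 'a"
  have "?u \<bullet> v = 0" if "v \<in> span S" for v
    using that
  proof (induction rule: span_induct_alt)
    case (step c x y)
    with S[of x] show ?case by (auto simp: inner_add_right inner_rt)
  qed auto
  from this[OF xy] show ?thesis by (cases "x \<in> C"; cases "y \<in> C") (simp_all add: inner_rt)
qed

lemma diffset_subset_span:
  assumes "\<And>y. y \<in> B \<Longrightarrow> rt y z \<in> span S"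
  shows "diffset B \<subseteq> span S"
  using assms unfolding diffset_def by (blast intro: rt_span_trans rt_span_sym)

lemma dim_Un_le:
  fixes S T :: "'a::euclidean_space set"
  shows "dim (S \<union> T) \<le> dim S + dim T"
proof -
  obtain B where B: "B \<subseteq> S" "independent B" "S \<subseteq> span B" "card B = dim S"
    using basis_exists[of S] by metis
  obtain C where C: "C \<subseteq> T" "independent C" "T \<subseteq> span C" "card C = dim T"
    using basis_exists[of T] by metis
  have "S \<union> T \<subseteq> span (B \<union> C)"
    using B(3) C(3) span_mono[of B "B \<union> C"] span_mono[of C "B \<union> C"] by blast
  moreover have "finite (B \<union> C)" using B C finiteI_independent by blast
  ultimately have "dim (S \<union> T) \<le> card (B \<union> C)" by (rule dim_le_card)
  also have "\<dots> \<le> dim S + dim T" using card_Un_le[of B C] B C by simp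
  finally show ?thesis .
qed

lemma dim_UN_le:
  fixes S :: "'j \<Rightarrow> 'a::euclidean_space set"
  assumes "finite J"
  shows "dim (\<Union>j\<in>J. S j) \<le> (\<Sum>j\<in>J. dim (S j))"
  using assms
proof induction
  case (insert x F)
  then show ?case using dim_Un_le[of "S x" "\<Union>j\<in>F. S j"] by simp
qed simp

lemma dim_diffset_le:
  fixes B :: "'i::finite set"
  assumes "B \<noteq> {}"
  shows "dim (diffset B) \<le> card B - 1"
proof -
  from assms obtain b where b: "b \<in> B" by blast
  let ?C = "(\<lambda>a. rt a b) ` (B - {b})"
  have in_C: "rt a b \<in> span ?C" if "a \<in> B" for a
    using that by (cases "a = b") (auto intro: span_base span_zero)
  have "diffset B \<subseteq> span ?C"
    using in_C by (rule diffset_subset_span)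
  then have "dim (diffset B) \<le> card ?C" by (intro dim_le_card) auto
  also have "\<dots> \<le> card B - 1"
    using card_image_le[of "B - {b}" "\<lambda>a. rt a b"] b by simp
  finally show ?thesis .
qed

text \<open>One axis vector added to \<open>S\<close> generates all the others, so at most one
  dimension was missing. This is the linear form of the fact that a connected graph on k points has
  at least k - 1 edges.\<close>

lemma dim_connected_ge:
  fixes S :: "(real ^ 'i::finite) set"
  assumes "\<And>a b. rt a b \<in> span S"
  shows "CARD('i) - 1 \<le> dim S"
proof -
  obtain a :: 'i where True by blast
  have "axis b 1 \<in> span (insert (axis a 1) S)" for b
  proof -
    have "rt b a \<in> span (insert (axis a 1) S)"
      using assms[of b a] span_mono[of S "insert (axis a 1) S"] by blast
    then have "rt b a + axis a 1 \<in> span (insert (axis a 1) S)"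
      by (rule span_add) (simp add: span_base)
    then show ?thesis by (simp add: rt_def)
  qed
  then have "Basis \<subseteq> span (insert (axis a 1) S)"
    by (auto simp: Basis_vec_def)
  then have "dim (Basis :: (real ^ 'i) set) \<le> dim (insert (axis a (1::real)) S)"
    by (metis dim_span dim_subset)
  then have "CARD('i) \<le> dim (insert (axis a (1::real)) S)" by (simp add: dim_span flip: dim_span[of Basis])
  then show ?thesis by (auto simp: dim_insert split: if_splits)
qed

text \<open>\<open>rt a b\<close> lies in this span iff a path through the blocks joins
  \<open>a\<close> and \<open>b\<close>; the hypergraph with the edges \<open>e j\<close> is
  connected.\<close>

definition linked :: "'j set \<Rightarrow> ('j \<Rightarrow> 'i::finite set) \<Rightarrow> bool" where
  "linked J e \<longleftrightarrow> (\<forall>a b. rt a b \<in> span (\<Union>j\<in>J. diffset (e j)))"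

section \<open>Moving a point from one block to another\<close>

definition transfer :: "'j \<Rightarrow> 'j \<Rightarrow> 'i \<Rightarrow> ('j \<Rightarrow> 'i set) \<Rightarrow> 'j \<Rightarrow> 'i set" where
  "transfer A B x e = e(A := e A - {x}, B := insert x (e B))"

text \<open>The size condition makes every relation indispensable. Without \<open>A\<close>, the
  other blocks split the points into classes, and different points of \<open>e A\<close> lie in
  different classes; exactly one of them, \<open>x0\<close>, lies in the class of
  \<open>e B\<close>. Moving \<open>x0\<close> only repeats a connection that exists already,
  whereas any other \<open>x\<close> stays connected to the rest of \<open>A\<close> through
  \<open>B\<close> and \<open>x0\<close>.\<close>

lemma linked_transfer:
  fixes e :: "'j \<Rightarrow> 'i::finite set"
  assumes "finite J" and AB: "A \<in> J" "B \<in> J" "A \<noteq> B"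
    and ne: "\<And>j. j \<in> J \<Longrightarrow> e j \<noteq> {}"
    and sizes: "(\<Sum>j\<in>J. card (e j) - 1) = CARD('i) - 1"
    and linked: "linked J e" and cardA: "2 \<le> card (e A)"
  obtains x0 where "x0 \<in> e A" "\<not> linked J (transfer A B x0 e)"
    "\<And>x. x \<in> e A \<Longrightarrow> x \<noteq> x0 \<Longrightarrow> x \<notin> e B \<and> linked J (transfer A B x e)"
proof -
  define S where "S = (\<Union>j\<in>J-{A}. diffset (e j))"
  have J: "J = insert A (J - {A})" using AB by blast
  have all: "(\<Union>j\<in>J. diffset (e j)) = S \<union> diffset (e A)"
    using AB unfolding S_def by blast
  have dimS: "dim S \<le> (\<Sum>j\<in>J-{A}. card (e j) - 1)"
    unfolding S_def using dim_UN_le[of "J - {A}" "\<lambda>j. diffset (e j)"] \<open>finite J\<close> ne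
    by (intro order.trans[OF dim_UN_le] sum_mono dim_diffset_le) auto
  have "(\<Sum>j\<in>J. card (e j) - 1) = (card (e A) - 1) + (\<Sum>j\<in>J-{A}. card (e j) - 1)"
    using \<open>finite J\<close> AB by (simp add: sum.remove)
  with sizes dimS cardA have dimS': "dim S + card (e A) \<le> CARD('i)" by linarith
  \<comment> \<open>\<open>dim S\<close> is at most \<open>CARD('i) - card (e A)\<close>, and the
    shrunken block contributes at most \<open>card (e A) - 2\<close>; the total is one below the
    bound of \<open>dim_connected_ge\<close>.\<close>
  have drop: "\<not> (\<forall>a b. rt a b \<in> span (S \<union> diffset (e A - {x})))" if x: "x \<in> e A" for x
  proof
    assume "\<forall>a b. rt a b \<in> span (S \<union> diffset (e A - {x}))"
    then have "CARD('i) - 1 \<le> dim (S \<union> diffset (e A - {x}))" by (intro dim_connected_ge) auto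
    also have "\<dots> \<le> dim S + dim (diffset (e A - {x}))" by (rule dim_Un_le)
    also have "dim (diffset (e A - {x})) \<le> card (e A - {x}) - 1"
    proof (rule dim_diffset_le)
      show "e A - {x} \<noteq> {}" using x cardA by (metis Diff_eq_empty_iff card_mono card.empty card_insert_disjoint
            empty_iff finite finite.emptyI le_trans not_less_eq_eq numeral_2_eq_2 order_refl)
    qed
    finally show False using dimS' cardA x by simp
  qed
  obtain b where b: "b \<in> e B" using ne AB by blast
  \<comment> \<open>Otherwise the class of \<open>b\<close> over \<open>S\<close> does not meet
    \<open>e A\<close>, so that no generator leaves it, not even one from \<open>A\<close>, against
    \<open>linked\<close>.\<close>
  have "\<exists>x0\<in>e A. rt x0 b \<in> span S"
  proof (rule ccontr)
    assume no: "\<not> ?thesis"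
    let ?C = "{x. rt x b \<in> span S}"
    obtain x where x: "x \<in> e A" using ne AB by blast
    have "x \<in> ?C \<longleftrightarrow> b \<in> ?C"
    proof (rule rt_span_class)
      show "rt x b \<in> span (S \<union> diffset (e A))" using linked all by (simp add: linked_def)
      fix v assume "v \<in> S \<union> diffset (e A)"
      then show "\<exists>a b'. v = rt a b' \<and> (a \<in> ?C \<longleftrightarrow> b' \<in> ?C)"
      proof
        assume v: "v \<in> S"
        then obtain a c where "v = rt a c" unfolding S_def diffset_def by blast
        with v have "rt a c \<in> span S" by (simp add: span_base)
        with \<open>v = rt a c\<close> show ?thesis
          by (intro exI[of _ a] exI[of _ c]) (auto intro: rt_span_trans rt_span_sym)
      next
        assume "v \<in> diffset (e A)"
        with no show ?thesis unfolding diffset_def by blast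
      qed
    qed
    with no x show False by (auto simp: span_zero)
  qed
  then obtain x0 where x0: "x0 \<in> e A" "rt x0 b \<in> span S" by blast
  have inB: "rt y b \<in> span S" if "y \<in> e B" for y
    using that b AB unfolding S_def by (intro span_base) (auto intro: diffsetI)
  \<comment> \<open>A second such \<open>x\<close> would be tied to \<open>x0\<close> without the
    help of \<open>A\<close>, so \<open>A\<close> could spare it, contrary to
    \<open>drop\<close>.\<close>
  have uniq: "rt x b \<notin> span S" if x: "x \<in> e A" "x \<noteq> x0" for x
  proof
    assume "rt x b \<in> span S"
    with x0 have xx: "rt x x0 \<in> span S" by (blast intro: rt_span_trans rt_span_sym)
    have sub: "span S \<subseteq> span (S \<union> diffset (e A - {x}))" by (intro span_mono) auto
    have to_x0: "rt y x0 \<in> span (S \<union> diffset (e A - {x}))" if "y \<in> e A" for y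
      using that x x0 xx sub by (cases "y = x") (auto intro: span_base diffsetI)
    have "diffset (e A) \<subseteq> span (S \<union> diffset (e A - {x}))"
      using to_x0 by (rule diffset_subset_span)
    then have "S \<union> diffset (e A) \<subseteq> span (S \<union> diffset (e A - {x}))"
      using sub span_superset by blast
    then have "span (S \<union> diffset (e A)) \<subseteq> span (S \<union> diffset (e A - {x}))"
      by (metis span_mono span_span)
    with linked drop[OF x(1)] show False unfolding linked_def all by blast
  qed
  have trans_all: "(\<Union>j\<in>J. diffset (transfer A B x e j)) =
      (\<Union>j\<in>J-{A,B}. diffset (e j)) \<union> diffset (insert x (e B)) \<union> diffset (e A - {x})" for x
    using AB unfolding transfer_def by (auto split: if_splits)
  show thesis
  proof
    show "x0 \<in> e A" by fact
    \<comment> \<open>Putting \<open>x0\<close> into \<open>B\<close> adds nothing to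
      \<open>span S\<close>, which reduces the claim to \<open>drop\<close>.\<close>
    have "rt y b \<in> span S" if "y \<in> insert x0 (e B)" for y
      using that x0 inB by auto
    then have "diffset (insert x0 (e B)) \<subseteq> span S"
      by (rule diffset_subset_span)
    then have "(\<Union>j\<in>J. diffset (transfer A B x0 e j)) \<subseteq> span (S \<union> diffset (e A - {x0}))"
      unfolding trans_all using span_mono[of S "S \<union> diffset (e A - {x0})"]
      by (auto simp: S_def intro: span_base)
    then have "span (\<Union>j\<in>J. diffset (transfer A B x0 e j)) \<subseteq> span (S \<union> diffset (e A - {x0}))"
      by (metis span_mono span_span)
    with drop[OF x0(1)] show "\<not> linked J (transfer A B x0 e)" unfolding linked_def by blast
    fix x assume x: "x \<in> e A" "x \<noteq> x0"
    let ?T = "\<Union>j\<in>J. diffset (transfer A B x e j)"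
    have "S \<subseteq> ?T" unfolding trans_all S_def
      using diffset_mono[of "e B" "insert x (e B)"] by auto
    then have ST: "span S \<subseteq> span ?T" by (rule span_mono)
    have "rt x b \<in> span ?T" unfolding trans_all by (intro span_base) (auto intro: diffsetI b)
    with x0 ST have xx: "rt x x0 \<in> span ?T" by (blast intro: rt_span_trans rt_span_sym)
    have to_x0: "rt y x0 \<in> span ?T" if "y \<in> e A" for y
    proof (cases "y = x")
      case False
      then show ?thesis using that x x0 unfolding trans_all by (intro span_base) (auto intro: diffsetI)
    qed (use xx in simp)
    have "diffset (e A) \<subseteq> span ?T"
      using to_x0 by (rule diffset_subset_span)
    with \<open>S \<subseteq> ?T\<close> have "S \<union> diffset (e A) \<subseteq> span ?T" using span_superset by blast
    then have "span (S \<union> diffset (e A)) \<subseteq> span ?T" by (metis span_mono span_span)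
    with linked have "linked J (transfer A B x e)" unfolding linked_def all by blast
    moreover have "x \<notin> e B" using uniq[OF x] inB by blast
    ultimately show "x \<notin> e B \<and> linked J (transfer A B x e)" by blast
  qed
qed

section \<open>Hypertrees with prescribed block sizes\<close>

text \<open>\<open>K\<close> is a side condition that the moves must respect: trivial for arbitrary
  blocks, later disjointness within a factor. Acyclicity is implicit: it follows from
  \<open>linked\<close> once the sizes minus one add up to \<open>CARD('i) - 1\<close>.\<close>

definition trees ::
    "'j set \<Rightarrow> (('j \<Rightarrow> 'i set) \<Rightarrow> bool) \<Rightarrow> ('j \<Rightarrow> nat) \<Rightarrow> ('j \<Rightarrow> 'i::finite set) set" where
  "trees J K s = {e \<in> J \<rightarrow>\<^sub>E UNIV. K e \<and> (\<forall>j\<in>J. card (e j) = s j) \<and> linked J e}"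

lemma finite_trees: "finite J \<Longrightarrow> finite (trees J K s)"
  unfolding trees_def by (rule finite_subset[OF _ finite_PiE[of J "\<lambda>_. UNIV"]]) auto

text \<open>The number of ways to choose a cyclic order on each nonempty block.\<close>

definition weight :: "'j set \<Rightarrow> ('j \<Rightarrow> nat) \<Rightarrow> nat" where
  "weight J s = (\<Prod>j\<in>J. fact (s j - 1))"

definition shift :: "'j \<Rightarrow> 'j \<Rightarrow> ('j \<Rightarrow> nat) \<Rightarrow> 'j \<Rightarrow> nat" where
  "shift A B s = s(A := s A - 1, B := s B + 1)"

lemma shift_shift: "A \<noteq> B \<Longrightarrow> 1 \<le> s A \<Longrightarrow> shift B A (shift A B s) = s"
  by (auto simp: shift_def fun_eq_iff)

lemma transfer_transfer:
  "A \<noteq> B \<Longrightarrow> x \<in> e A \<Longrightarrow> x \<notin> e B \<Longrightarrow> transfer B A x (transfer A B x e) = e"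
  by (auto simp: transfer_def fun_eq_iff)

definition moves where
  "moves J K A B s =
     {(e, x). e \<in> trees J K s \<and> x \<in> e A \<and> x \<notin> e B \<and> linked J (transfer A B x e)}"

text \<open>Whatever the hypertree, exactly one point of \<open>A\<close> cannot be moved, the
  \<open>x0\<close> of \<open>linked_transfer\<close>.\<close>

lemma card_moves:
  fixes s :: "'j \<Rightarrow> nat"
  assumes "finite J" and AB: "A \<in> J" "B \<in> J" "A \<noteq> B"
    and s: "\<And>j. j \<in> J \<Longrightarrow> 1 \<le> s j"
    and sizes: "(\<Sum>j\<in>J. s j - 1) = CARD('i::finite) - 1" and "2 \<le> s A"
  shows "card (moves J K A B s :: (('j \<Rightarrow> 'i set) \<times> 'i) set) =
     (s A - 1) * card (trees J K s :: ('j \<Rightarrow> 'i set) set)"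
proof -
  let ?F = "\<lambda>e. {x. x \<in> e A \<and> x \<notin> e B \<and> linked J (transfer A B x e)}"
  have "card (?F e) = s A - 1" if "e \<in> trees J K s" for e :: "'j \<Rightarrow> 'i set"
  proof -
    from that have e: "\<And>j. j \<in> J \<Longrightarrow> card (e j) = s j" "linked J e"
      by (auto simp: trees_def)
    have ne: "e j \<noteq> {}" if "j \<in> J" for j using e(1)[OF that] s[OF that] by auto
    have "(\<Sum>j\<in>J. card (e j) - 1) = CARD('i) - 1" using e(1) sizes by simp
    moreover have "2 \<le> card (e A)" using e AB assms by simp
    ultimately obtain x0 where x0: "x0 \<in> e A" "\<not> linked J (transfer A B x0 e)"
      "\<And>x. x \<in> e A \<Longrightarrow> x \<noteq> x0 \<Longrightarrow> x \<notin> e B \<and> linked J (transfer A B x e)"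
      using linked_transfer[OF \<open>finite J\<close> AB ne _ e(2)] by metis
    have "?F e = e A - {x0}" using x0 by auto
    then show ?thesis using x0(1) e(1) AB by simp
  qed
  moreover have "moves J K A B s = Sigma (trees J K s) ?F"
    unfolding moves_def by auto
  ultimately show ?thesis using finite_trees[OF \<open>finite J\<close>, where 'b='i]
    by (simp add: card_SigmaI)
qed

text \<open>The reverse move is admissible because it leads back to \<open>e\<close>, which is
  linked; hence moves from \<open>A\<close> to \<open>B\<close> and moves back correspond one to
  one.\<close>

lemma transfer_in_moves:
  fixes e :: "'j \<Rightarrow> 'i::finite set"
  assumes AB: "A \<in> J" "B \<in> J" "A \<noteq> B" and "1 \<le> s A" and "(e, x) \<in> moves J K A B s"
    and K: "\<And>(e :: 'j \<Rightarrow> 'i set) x. K e \<Longrightarrow> x \<in> e A \<Longrightarrow> x \<notin> e B \<Longrightarrow> K (transfer A B x e)"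
  shows "(transfer A B x e, x) \<in> moves J K B A (shift A B s)"
proof -
  from assms have e: "e \<in> trees J K s" "x \<in> e A" "x \<notin> e B" "linked J (transfer A B x e)"
    by (auto simp: moves_def)
  have "transfer A B x e \<in> trees J K (shift A B s)"
    using e AB K[of e x] unfolding trees_def
    by (auto simp: PiE_def extensional_def shift_def transfer_def)
  moreover have "linked J (transfer B A x (transfer A B x e))"
    using e AB by (simp add: transfer_transfer trees_def)
  ultimately show ?thesis using AB by (auto simp: moves_def transfer_def)
qed

lemma card_moves_eq:
  assumes AB: "A \<in> J" "B \<in> J" "A \<noteq> B" and sA: "1 \<le> s A"
    and K: "\<And>(e :: 'j \<Rightarrow> 'i::finite set) x. K e \<Longrightarrow> x \<in> e A \<Longrightarrow> x \<notin> e B \<Longrightarrow> K (transfer A B x e)"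
      "\<And>(e :: 'j \<Rightarrow> 'i set) x. K e \<Longrightarrow> x \<in> e B \<Longrightarrow> x \<notin> e A \<Longrightarrow> K (transfer B A x e)"
  shows "card (moves J K A B s :: (('j \<Rightarrow> 'i set) \<times> 'i) set) = card (moves J K B A (shift A B s))"
proof (rule bij_betw_same_card, rule bij_betw_byWitness[where f = "\<lambda>(e, x). (transfer A B x e, x)"
      and f' = "\<lambda>(e, x). (transfer B A x e, x)"])
  let ?f = "\<lambda>(e, x). (transfer A B x e, x)"
  let ?g = "\<lambda>(e, x). (transfer B A x e, x)"
  show "\<forall>a\<in>moves J K A B s. ?g (?f a) = a"
    using AB by (auto simp: moves_def transfer_transfer)
  show "\<forall>a\<in>moves J K B A (shift A B s). ?f (?g a) = a"
    using AB by (auto simp: moves_def transfer_transfer)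
  show "?f ` moves J K A B s \<subseteq> moves J K B A (shift A B s)"
    using transfer_in_moves[where K = K and s = s, OF AB sA _ K(1)] by auto
  have "(transfer B A x e, x) \<in> moves J K A B (shift B A (shift A B s))"
    if "(e, x) \<in> moves J K B A (shift A B s)" for e :: "'j \<Rightarrow> 'i set" and x
    using transfer_in_moves[where K = K, OF AB(2,1) AB(3)[symmetric] _ that K(2)] by (simp add: shift_def)
  then show "?g ` moves J K B A (shift A B s) \<subseteq> moves J K A B s"
    using AB sA by (auto simp: shift_shift)
qed

lemma sum_shift:
  assumes "finite L" "A \<in> L" "B \<in> L" "A \<noteq> B" "1 \<le> s A"
  shows "sum (shift A B s) L = sum s L"
proof -
  have L: "L = insert A (insert B (L - {A, B}))" using assms by blast
  have "sum (shift A B s) (L - {A, B}) = sum s (L - {A, B})"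
    by (rule sum.cong) (auto simp: shift_def)
  then show ?thesis
    using assms by (subst (1 2) L) (simp add: shift_def)
qed

text \<open>Counting the moves at both ends gives (s A - 1) t = (s B) t', where t and t' are the
  numbers of hypertrees before and after: afterwards \<open>B\<close> has s B + 1 points, and again
  all but one can be moved. The factor s A - 1 is what (s A - 1)! loses under the shift, and s B is
  what (s B - 1)! gains.\<close>

lemma trees_shift_weight:
  fixes s :: "'j \<Rightarrow> nat" and K :: "('j \<Rightarrow> 'i::finite set) \<Rightarrow> bool"
  assumes "finite J" and AB: "A \<in> J" "B \<in> J" "A \<noteq> B"
    and s: "\<And>j. j \<in> J \<Longrightarrow> 1 \<le> s j"
    and sizes: "(\<Sum>j\<in>J. s j) + 1 = CARD('i) + card J" and sA: "2 \<le> s A"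
    and K: "\<And>e x. K e \<Longrightarrow> x \<in> e A \<Longrightarrow> x \<notin> e B \<Longrightarrow> K (transfer A B x e)"
      "\<And>e x. K e \<Longrightarrow> x \<in> e B \<Longrightarrow> x \<notin> e A \<Longrightarrow> K (transfer B A x e)"
  shows "card (trees J K s) * weight J s = card (trees J K (shift A B s)) * weight J (shift A B s)"
proof -
  let ?s = "shift A B s"
  have s': "1 \<le> ?s j" if "j \<in> J" for j using s[OF that] sA by (auto simp: shift_def)
  \<comment> \<open>The size condition is assumed in a form without subtraction, visibly preserved
    by \<open>shift\<close>; \<open>card_moves\<close> wants the truncated differences.\<close>
  have pred_sum: "(\<Sum>j\<in>J. t j - 1) = CARD('i) - 1"
    if "\<And>j. j \<in> J \<Longrightarrow> 1 \<le> t j" "(\<Sum>j\<in>J. t j) + 1 = CARD('i) + card J" for t :: "'j \<Rightarrow> nat"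
  proof -
    have "(\<Sum>j\<in>J. t j) = (\<Sum>j\<in>J. (t j - 1) + 1)" using that(1) by (intro sum.cong refl) (metis le_add_diff_inverse2)
    then have "(\<Sum>j\<in>J. t j) = (\<Sum>j\<in>J. t j - 1) + card J" by (simp only: sum.distrib) simp
    with that(2) show ?thesis by linarith
  qed
  have "(s A - 1) * card (trees J K s) = card (moves J K A B s)"
    using card_moves[where K = K and s = s, OF \<open>finite J\<close> AB s _ sA] pred_sum[of s] s sizes by simp
  also have "\<dots> = card (moves J K B A ?s)"
    using sA by (intro card_moves_eq AB K) auto
  also have "\<dots> = (?s B - 1) * card (trees J K ?s)"
    using pred_sum[of ?s] s' sizes AB sA s[OF AB(2)] \<open>finite J\<close>
    by (intro card_moves) (auto simp: sum_shift, simp add: shift_def)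
  also have "?s B - 1 = s B" using AB by (simp add: shift_def)
  finally have *: "(s A - 1) * card (trees J K s) = s B * card (trees J K ?s)" .
  have J: "J = insert A (insert B (J - {A, B}))" using AB by blast
  have R: "(\<Prod>j\<in>J-{A,B}. fact (?s j - 1)) = (\<Prod>j\<in>J-{A,B}. fact (s j - 1) :: nat)"
    by (rule prod.cong) (auto simp: shift_def)
  define P where "P = (\<Prod>j\<in>J-{A,B}. fact (s j - 1) :: nat)"
  have w: "weight J s = fact (s A - 1) * fact (s B - 1) * P"
    unfolding weight_def P_def using AB \<open>finite J\<close> by (subst J) (simp add: mult.assoc)
  have w': "weight J ?s = fact (s A - 2) * fact (s B) * P"
    unfolding weight_def using AB \<open>finite J\<close>
    by (subst J, subst prod.insert, simp, simp, subst prod.insert, simp, simp)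
       (simp add: R shift_def P_def mult.assoc numeral_2_eq_2)
  have fA: "fact (s A - 1) = (s A - 1) * (fact (s A - 2) :: nat)"
    using sA fact_reduce[of "s A - 1", where 'a = nat] by (simp add: numeral_2_eq_2)
  have fB: "fact (s B) = s B * (fact (s B - 1) :: nat)"
    using s[OF AB(2)] fact_reduce[of "s B", where 'a = nat] by simp
  have "card (trees J K s) * weight J s = ((s A - 1) * card (trees J K s)) * (fact (s A - 2) * fact (s B - 1) * P)"
    unfolding w fA by (simp add: ac_simps)
  also have "\<dots> = card (trees J K ?s) * weight J ?s"
    unfolding w' fB * by (simp add: ac_simps)
  finally show ?thesis .
qed

lemma trees_concentrate:
  fixes s :: "'j \<Rightarrow> nat" and K :: "('j \<Rightarrow> 'i::finite set) \<Rightarrow> bool"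
  assumes "finite J" and L: "L \<subseteq> J" "b \<in> L"
    and s: "\<And>j. j \<in> J \<Longrightarrow> 1 \<le> s j"
    and sizes: "(\<Sum>j\<in>J. s j) + 1 = CARD('i) + card J"
    and K: "\<And>A B e x. A \<in> L \<Longrightarrow> B \<in> L \<Longrightarrow> A \<noteq> B \<Longrightarrow> K e \<Longrightarrow> x \<in> e A \<Longrightarrow> x \<notin> e B
              \<Longrightarrow> K (transfer A B x e)"
    and t: "t = (\<lambda>j. if j \<in> L then if j = b then sum s L - (card L - 1) else 1 else s j)"
  shows "card (trees J K s) * weight J s = card (trees J K t) * weight J t"
  using s sizes t
proof (induction "\<Sum>j\<in>L-{b}. s j - 1" arbitrary: s rule: less_induct)
  case less
  have finL: "finite L" using L \<open>finite J\<close> finite_subset by blast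
  show ?case
  proof (cases "\<exists>A\<in>L-{b}. 2 \<le> s A")
    case True
    then obtain A where A: "A \<in> L" "A \<noteq> b" "2 \<le> s A" by blast
    let ?s = "shift A b s"
    have "(\<Sum>j\<in>L-{b}. ?s j - 1) < (\<Sum>j\<in>L-{b}. s j - 1)"
      by (rule sum_strict_mono_ex1) (use finL A in \<open>auto simp: shift_def\<close>)
    moreover have "1 \<le> ?s j" if "j \<in> J" for j
      using less.prems(1)[OF that] A by (auto simp: shift_def)
    moreover have "(\<Sum>j\<in>J. ?s j) + 1 = CARD('i) + card J"
      using less.prems(2) A L \<open>finite J\<close> by (subst sum_shift) auto
    moreover have "t = (\<lambda>j. if j \<in> L then if j = b then sum ?s L - (card L - 1) else 1 else ?s j)"
      unfolding less.prems(3) using A L finL by (subst sum_shift) (auto simp: shift_def fun_eq_iff)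
    ultimately have "card (trees J K ?s) * weight J ?s = card (trees J K t) * weight J t"
      by (rule less.hyps)
    moreover have "card (trees J K s) * weight J s = card (trees J K ?s) * weight J ?s"
      using A L less.prems \<open>finite J\<close> by (intro trees_shift_weight) (auto intro: K)
    ultimately show ?thesis by simp
  next
    case False
    have one: "s j = 1" if "j \<in> L - {b}" for j
      using False less.prems(1)[of j] that L by force
    have "sum s L = s b + (\<Sum>j\<in>L-{b}. s j)" using finL L by (simp add: sum.remove)
    also have "(\<Sum>j\<in>L-{b}. s j) = card L - 1" using one L finL by simp
    finally have "t = s" unfolding less.prems(3) using one by (auto simp: fun_eq_iff)
    then show ?thesis by simp
  qed
qed

text \<open>With everything concentrated in \<open>b\<close>, the size condition makes
  \<open>b\<close> the whole point set, and every other block is an arbitrary singleton, with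
  \<open>CARD('i)\<close> choices each.\<close>

lemma card_trees_unrestricted:
  fixes s :: "'j \<Rightarrow> nat"
  assumes "finite J" "J \<noteq> {}"
    and s: "\<And>j. j \<in> J \<Longrightarrow> 1 \<le> s j"
    and sizes: "(\<Sum>j\<in>J. s j) + 1 = CARD('i) + card J"
  shows "card (trees J (\<lambda>_. True) s :: ('j \<Rightarrow> 'i::finite set) set) * weight J s =
           CARD('i) ^ (card J - 1) * fact (CARD('i) - 1)"
proof -
  from assms obtain b where b: "b \<in> J" by blast
  let ?K = "\<lambda>_ :: 'j \<Rightarrow> 'i set. True"
  define t where "t = (\<lambda>j. if j \<in> J then if j = b then sum s J - (card J - 1) else 1 else s j)"
  have cJ: "card J > 0" using assms by (simp add: card_gt_0_iff)
  have tb: "t b = CARD('i)" using b sizes cJ by (simp add: t_def)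
  have to: "t j = 1" if "j \<in> J" "j \<noteq> b" for j using that by (simp add: t_def)
  have *: "card (trees J ?K s) * weight J s = card (trees J ?K t) * weight J t"
    by (rule trees_concentrate[OF \<open>finite J\<close> order_refl b s sizes _ t_def]) auto
  let ?C = "\<lambda>j. if j = b then {UNIV :: 'i set} else range (\<lambda>x. {x})"
  have "trees J ?K t = PiE J ?C"
  proof (intro equalityI subsetI)
    fix e :: "'j \<Rightarrow> 'i set" assume e: "e \<in> trees J ?K t"
    have "e j \<in> ?C j" if "j \<in> J" for j
    proof (cases "j = b")
      case True
      with e tb b have "card (e b) = CARD('i)" by (auto simp: trees_def)
      then have "e b = UNIV" by (metis card_eq_UNIV_imp_eq_UNIV finite)
      then show ?thesis using True by simp
    next
      case False
      with e to[OF that] that have "card (e j) = 1" by (auto simp: trees_def)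
      then obtain x where "e j = {x}" by (auto simp: card_1_singleton_iff)
      with False show ?thesis by auto
    qed
    with e show "e \<in> PiE J ?C" by (simp add: trees_def PiE_def Pi_def)
  next
    fix e :: "'j \<Rightarrow> 'i set" assume e: "e \<in> PiE J ?C"
    have eb: "e b = UNIV" using PiE_mem[OF e b] by simp
    have eo: "card (e j) = 1" if "j \<in> J" "j \<noteq> b" for j using PiE_mem[OF e that(1)] that by auto
    have "linked J e" unfolding linked_def
      by (intro allI span_base UN_I[OF b]) (auto simp: eb intro: diffsetI)
    moreover have "card (e j) = t j" if "j \<in> J" for j
      using that eb eo tb to by (cases "j = b") auto
    ultimately show "e \<in> trees J ?K t" using e by (auto simp: trees_def PiE_def)
  qed
  then have "card (trees J ?K t) = (\<Prod>j\<in>J. card (?C j))"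
    using \<open>finite J\<close> by (simp add: card_PiE)
  also have "\<dots> = card (?C b) * (\<Prod>j\<in>J-{b}. card (?C j))"
    using \<open>finite J\<close> b by (rule prod.remove)
  also have "(\<Prod>j\<in>J-{b}. card (?C j)) = (\<Prod>j\<in>J-{b}. CARD('i))"
    by (rule prod.cong) (auto simp: card_image)
  finally have "card (trees J ?K t) = CARD('i) ^ (card J - 1)" using b by simp
  moreover have "weight J t = fact (CARD('i) - 1)"
  proof -
    have "weight J t = fact (t b - 1) * (\<Prod>j\<in>J-{b}. fact (t j - 1))"
      unfolding weight_def using \<open>finite J\<close> b by (rule prod.remove)
    also have "(\<Prod>j\<in>J-{b}. fact (t j - 1) :: nat) = 1" using to by (intro prod.neutral) auto
    finally show ?thesis by (simp add: tb)
  qed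
  ultimately show ?thesis using * by simp
qed

section \<open>Hypertrees with disjoint blocks within each factor\<close>

definition cells :: "nat \<Rightarrow> (nat \<Rightarrow> nat) \<Rightarrow> (nat \<times> nat) set" where
  "cells d l = (SIGMA i:{..<d}. {..<l i})"

text \<open>\<open>e (i, p)\<close> stands for the p-th cycle of the i-th factor, and the cycles of
  one permutation are disjoint. That they cover all points will follow from their sizes.\<close>

definition coloured :: "nat \<Rightarrow> (nat \<Rightarrow> nat) \<Rightarrow> (nat \<times> nat \<Rightarrow> 'i set) \<Rightarrow> bool" where
  "coloured d l e \<longleftrightarrow>
     (\<forall>i<d. \<forall>p<l i. \<forall>q<l i. p \<noteq> q \<longrightarrow> e (i, p) \<inter> e (i, q) = {})"

lemma finite_cells [simp]: "finite (cells d l)"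
  by (simp add: cells_def)

text \<open>Both blocks belong to one row \<open>k\<close>: a move between rows could put
  \<open>x\<close> into a second block of the target row. This is why the concentration proceeds row
  by row.\<close>

lemma coloured_transfer:
  assumes "k < d" "A \<in> {k} \<times> {..<l k}" "B \<in> {k} \<times> {..<l k}" "A \<noteq> B"
    and "coloured d l e" "x \<in> e A"
  shows "coloured d l (transfer A B x e)"
proof -
  obtain a b where ab: "A = (k, a)" "B = (k, b)" "a < l k" "b < l k" "a \<noteq> b" using assms by auto
  have x: "x \<notin> e (k, q)" if "q < l k" "q \<noteq> a" for q
    using assms ab that unfolding coloured_def by blast
  have disj: "e (i, p) \<inter> e (i, q) = {}" if "i < d" "p < l i" "q < l i" "p \<noteq> q" for i p q
    using assms(5) that unfolding coloured_def by blast
  show ?thesis unfolding coloured_def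
  proof (intro allI impI)
    fix i p q assume h: "i < d" "p < l i" "q < l i" "p \<noteq> q"
    show "transfer A B x e (i, p) \<inter> transfer A B x e (i, q) = {}"
      using disj[OF h] x[of p] x[of q] h ab unfolding transfer_def by auto
  qed
qed

lemma card_inj_fill:
  assumes "finite A" "finite C" "card C = card A"
  shows "card {f \<in> A \<rightarrow>\<^sub>E C. inj_on f A} = fact (card A)"
  using card_inj_on_subset_funcset[OF assms(1,2) order_refl] assms
  by (simp add: fact_prod_rev)

text \<open>The sizes after the rows below \<open>k\<close> have been concentrated in their first
  blocks. A row sums to \<open>N\<close>, and its other \<open>l i - 1\<close> blocks keep size 1,
  which leaves \<open>N - (l i - 1)\<close>.\<close>

definition hook_sizes :: "nat \<Rightarrow> (nat \<Rightarrow> nat) \<Rightarrow> nat \<Rightarrow> (nat \<times> nat \<Rightarrow> nat) \<Rightarrow> nat \<times> nat \<Rightarrow> nat" where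
  "hook_sizes N l k s = (\<lambda>(i, p). if i < k \<and> p < l i then if p = 0 then N - (l i - 1) else 1 else s (i, p))"

text \<open>Induction on the number of concentrated rows, each step being
  \<open>trees_concentrate\<close> with \<open>L\<close> a single row.\<close>

lemma trees_coloured_hook:
  fixes s :: "nat \<times> nat \<Rightarrow> nat"
  defines "N \<equiv> CARD('i::finite)"
  assumes l: "\<And>i. i < d \<Longrightarrow> 1 \<le> l i" and lN: "\<And>i. i < d \<Longrightarrow> l i \<le> N"
    and s: "\<And>i p. i < d \<Longrightarrow> p < l i \<Longrightarrow> 1 \<le> s (i, p)"
    and sum_s: "\<And>i. i < d \<Longrightarrow> (\<Sum>p<l i. s (i, p)) = N"
    and rank: "(\<Sum>i<d. N - l i) = N - 1" and "k \<le> d"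
  shows "card (trees (cells d l) (coloured d l) s :: (nat \<times> nat \<Rightarrow> 'i set) set) * weight (cells d l) s =
    card (trees (cells d l) (coloured d l) (hook_sizes N l k s) :: (nat \<times> nat \<Rightarrow> 'i set) set) *
      weight (cells d l) (hook_sizes N l k s)"
  using \<open>k \<le> d\<close>
proof (induction k)
  case 0
  have "hook_sizes N l 0 s = s" by (auto simp: hook_sizes_def)
  then show ?case by simp
next
  case (Suc k)
  let ?s = "hook_sizes N l k s"
  have k: "k < d" using Suc by simp
  have pos: "1 \<le> ?s j" if jc: "j \<in> cells d l" for j
  proof -
    obtain i p where j: "j = (i, p)" "i < d" "p < l i" using jc by (auto simp: cells_def)
    show ?thesis using s[of i p] lN[of i] l[of i] j by (auto simp: hook_sizes_def)
  qed
  have row: "(\<Sum>p<l i. ?s (i, p)) = N" if i: "i < d" for i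
  proof (cases "i < k")
    case True
    have "{..<l i} = insert 0 {1..<l i}" using l[OF i] by auto
    then have "(\<Sum>p<l i. ?s (i, p)) = ?s (i, 0) + (\<Sum>p\<in>{1..<l i}. ?s (i, p))" by simp
    also have "(\<Sum>p\<in>{1..<l i}. ?s (i, p)) = (\<Sum>p\<in>{1..<l i}. 1)"
      using True by (intro sum.cong) (auto simp: hook_sizes_def)
    finally show ?thesis using True l[OF i] lN[OF i] by (simp add: hook_sizes_def)
  next
    case False
    then have "(\<Sum>p<l i. ?s (i, p)) = (\<Sum>p<l i. s (i, p))"
      by (intro sum.cong) (auto simp: hook_sizes_def)
    then show ?thesis using sum_s[OF i] by simp
  qed
  \<comment> \<open>Since every row still sums to \<open>N\<close>, the rank condition turns into
    the size condition for hypertrees.\<close>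
  have "(\<Sum>j\<in>cells d l. ?s j) = (\<Sum>i<d. \<Sum>p<l i. ?s (i, p))"
    unfolding cells_def by (simp add: sum.Sigma)
  also have "\<dots> = (\<Sum>i<d. N)" using row by (intro sum.cong) auto
  also have "\<dots> = (\<Sum>i<d. (N - l i) + l i)" using lN by (intro sum.cong) auto
  also have "\<dots> = (N - 1) + card (cells d l)" unfolding sum.distrib rank by (simp add: cells_def)
  finally have sizes: "(\<Sum>j\<in>cells d l. ?s j) + 1 = CARD('i) + card (cells d l)"
    unfolding N_def by simp
  let ?L = "{k} \<times> {..<l k}"
  have sumL: "sum ?s ?L = N"
  proof -
    have "?L = (\<lambda>p. (k, p)) ` {..<l k}" by auto
    then have "sum ?s ?L = (\<Sum>p<l k. ?s (k, p))" by (simp add: sum.reindex inj_on_def)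
    then show ?thesis using row[OF k] by simp
  qed
  have "hook_sizes N l (Suc k) s =
      (\<lambda>j. if j \<in> ?L then if j = (k, 0) then sum ?s ?L - (card ?L - 1) else 1 else ?s j)"
    unfolding sumL by (auto simp: hook_sizes_def fun_eq_iff less_Suc_eq)
  then have "card (trees (cells d l) (coloured d l) ?s :: (nat \<times> nat \<Rightarrow> 'i set) set) * weight (cells d l) ?s =
    card (trees (cells d l) (coloured d l) (hook_sizes N l (Suc k) s) :: (nat \<times> nat \<Rightarrow> 'i set) set) *
      weight (cells d l) (hook_sizes N l (Suc k) s)"
    using k l[OF k] pos sizes
    by (intro trees_concentrate[where L = ?L and b = "(k, 0)"] coloured_transfer[OF k])
       (auto simp: cells_def)
  with Suc show ?case by simp
qed

text \<open>In each row the large block \<open>h i\<close> leaves exactly \<open>l i - 1\<close>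
  points, and these fill the \<open>l i - 1\<close> singleton cells in any order. Singletons
  contribute no relation, and large blocks of different rows may overlap, so the \<open>h i\<close>
  form an unrestricted hypertree.\<close>

lemma card_trees_hook:
  fixes s :: "nat \<times> nat \<Rightarrow> nat"
  assumes l: "\<And>i. i < d \<Longrightarrow> 1 \<le> l i" and lN: "\<And>i. i < d \<Longrightarrow> l i \<le> CARD('i::finite)"
  shows "card (trees (cells d l) (coloured d l) (hook_sizes CARD('i) l d s) :: (nat \<times> nat \<Rightarrow> 'i set) set) =
    card (trees {..<d} (\<lambda>_. True) (\<lambda>i. CARD('i) - (l i - 1)) :: (nat \<Rightarrow> 'i set) set) *
      (\<Prod>i<d. fact (l i - 1))"
proof -
  let ?H = "trees {..<d} (\<lambda>_. True) (\<lambda>i. CARD('i) - (l i - 1)) :: (nat \<Rightarrow> 'i set) set"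
  let ?I = "\<lambda>h i. {g \<in> {1..<l i} \<rightarrow>\<^sub>E - (h i :: 'i set). inj_on g {1..<l i}}"
  let ?P = "\<lambda>h. PiE {..<d} (?I h)"
  let ?T = "trees (cells d l) (coloured d l) (hook_sizes CARD('i) l d s) :: (nat \<times> nat \<Rightarrow> 'i set) set"
  have card_P: "card (?P h) = (\<Prod>i<d. fact (l i - 1))" if h: "h \<in> ?H" for h
  proof -
    have "card (?I h i) = fact (l i - 1)" if i: "i < d" for i
    proof -
      have "card (h i) = CARD('i) - (l i - 1)" using h i by (auto simp: trees_def)
      then have "card (- h i) = l i - 1" using l[OF i] lN[OF i] 
        by (simp add: Compl_eq_Diff_UNIV card_Diff_subset)
      then show ?thesis using card_inj_fill[of "{1..<l i}" "- h i"] by simp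
    qed
    then show ?thesis by (simp add: card_PiE)
  qed
  \<comment> \<open>Column 0 is reserved for the large blocks \<open>h\<close>; \<open>g\<close>
    fills the remaining cells with single points.\<close>
  let ?f = "\<lambda>(h, g). restrict (\<lambda>(i, p). if p = 0 then h i else {g i p}) (cells d l)"
  let ?f' = "\<lambda>e. (restrict (\<lambda>i. e (i, 0)) {..<d},
                 restrict (\<lambda>i. restrict (\<lambda>p. the_elem (e (i, p))) {1..<l i}) {..<d})"
  have linked_iff: "linked (cells d l) e \<longleftrightarrow> linked {..<d} h"
    if "\<And>i. i < d \<Longrightarrow> e (i, 0) = h i"
      and single: "\<And>i p. i < d \<Longrightarrow> 0 < p \<Longrightarrow> p < l i \<Longrightarrow> \<exists>x. e (i, p) = {x}"
    for e and h :: "nat \<Rightarrow> 'i set"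
  proof -
    let ?A = "\<Union>j\<in>cells d l. diffset (e j)" and ?B = "\<Union>i<d. diffset (h i)"
    have "diffset (h i) \<subseteq> ?A" if "i < d" for i
      using that \<open>\<And>i. i < d \<Longrightarrow> e (i, 0) = h i\<close>[OF that] l[OF that]
      by (intro UN_upper[of "(i, 0)", THEN order_trans[rotated]]) (auto simp: cells_def)
    then have "?B \<subseteq> ?A" by blast
    moreover have "?A \<subseteq> insert 0 ?B"
    proof
      fix v assume "v \<in> ?A"
      then obtain i p where ip: "i < d" "p < l i" "v \<in> diffset (e (i, p))" by (auto simp: cells_def)
      show "v \<in> insert 0 ?B"
      proof (cases "p = 0")
        case True
        then show ?thesis using ip that(1) by auto
      next
        case False
        then obtain x where "e (i, p) = {x}" using single ip by blast
        then show ?thesis using ip by simp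
      qed
    qed
    ultimately have "span ?A = span ?B"
      by (metis span_mono span_insert_0 subset_antisym)
    then show ?thesis by (simp add: linked_def)
  qed
  have "bij_betw ?f (Sigma ?H ?P) ?T"
  proof (rule bij_betw_byWitness[where f' = ?f'])
    show "\<forall>a\<in>Sigma ?H ?P. ?f' (?f a) = a"
    proof
      fix a assume "a \<in> Sigma ?H ?P"
      then obtain h g where h: "h \<in> ?H" and g: "g \<in> ?P h" and a: "a = (h, g)" by blast
      have "restrict (\<lambda>i. ?f (h, g) (i, 0)) {..<d} = h"
      proof (rule extensionalityI[of _ "{..<d}"])
        show "h \<in> extensional {..<d}" using h by (auto simp: trees_def PiE_def)
        fix i assume "i \<in> {..<d}"
        then show "restrict (\<lambda>i. ?f (h, g) (i, 0)) {..<d} i = h i" using l[of i] by (simp add: cells_def)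
      qed auto
      moreover have "restrict (\<lambda>i. restrict (\<lambda>p. the_elem (?f (h, g) (i, p))) {1..<l i}) {..<d} = g"
      proof (rule extensionalityI[of _ "{..<d}"])
        show "g \<in> extensional {..<d}" using g by (auto simp: PiE_def)
        fix i assume i: "i \<in> {..<d}"
        have "restrict (\<lambda>p. the_elem (?f (h, g) (i, p))) {1..<l i} = g i"
          using i PiE_mem[OF g i] by (intro extensionalityI[of _ "{1..<l i}"]) (auto simp: cells_def PiE_def)
        then show "restrict (\<lambda>i. restrict (\<lambda>p. the_elem (?f (h, g) (i, p))) {1..<l i}) {..<d} i = g i"
          using i by simp
      qed auto
      ultimately show "?f' (?f a) = a" unfolding a by simp
    qed
    have T: "e (i, p) = {the_elem (e (i, p))}" if "e \<in> ?T" "i < d" "0 < p" "p < l i" for e i p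
    proof -
      have "card (e (i, p)) = 1" using that by (auto simp: trees_def cells_def hook_sizes_def)
      then show ?thesis by (metis card_1_singletonE the_elem_eq)
    qed
    show "\<forall>e\<in>?T. ?f (?f' e) = e"
    proof
      fix e assume e: "e \<in> ?T"
      show "?f (?f' e) = e"
      proof (rule extensionalityI[of _ "cells d l"])
        show "e \<in> extensional (cells d l)" using e by (auto simp: trees_def PiE_def)
        fix j assume "j \<in> cells d l"
        then obtain i p where j: "j = (i, p)" "i < d" "p < l i" by (auto simp: cells_def)
        then show "?f (?f' e) j = e j" using T[OF e, of i p] by (auto simp: cells_def)
      qed auto
    qed
    show "?f ` Sigma ?H ?P \<subseteq> ?T"
    proof
      fix a assume "a \<in> ?f ` Sigma ?H ?P"
      then obtain h g where h: "h \<in> ?H" and g: "g \<in> ?P h" and a: "a = ?f (h, g)" by blast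
      let ?e = "?f (h, g)"
      have e0: "?e (i, 0) = h i" if "i < d" for i using that l[OF that] by (auto simp: cells_def)
      have e1: "?e (i, p) = {g i p}" if "i < d" "0 < p" "p < l i" for i p
        using that by (auto simp: cells_def)
      have gi: "g i \<in> {1..<l i} \<rightarrow>\<^sub>E - (h i)" "inj_on (g i) {1..<l i}" if "i < d" for i
        using PiE_mem[OF g, of i] that by auto
      have "coloured d l ?e"
        unfolding coloured_def
      proof (intro allI impI)
        fix i p q assume ipq: "i < d" "p < l i" "q < l i" "p \<noteq> q"
        have gm: "g i p \<notin> h i" if "0 < p" "p < l i" for p
          using PiE_mem[OF gi(1)[OF ipq(1)], of p] that by auto
        consider "p = 0" "0 < q" | "0 < p" "q = 0" | "0 < p" "0 < q" using ipq by linarith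
        then show "?e (i, p) \<inter> ?e (i, q) = {}"
        proof cases
          case 1
          then show ?thesis using e0 e1 ipq gm[of q] by simp
        next
          case 2
          then show ?thesis using e0 e1 ipq gm[of p] by simp
        next
          case 3
          then show ?thesis using e1 ipq inj_onD[OF gi(2)[OF ipq(1)], of p q] by auto
        qed
      qed
      moreover have "linked (cells d l) ?e"
        using linked_iff[of ?e h] e0 e1 h unfolding trees_def by blast
      moreover have "card (?e j) = hook_sizes CARD('i) l d s j" if "j \<in> cells d l" for j
      proof -
        obtain i p where j: "j = (i, p)" "i < d" "p < l i" using \<open>j \<in> cells d l\<close> by (auto simp: cells_def)
        show ?thesis
        proof (cases "p = 0")
          case True
          have "card (h i) = CARD('i) - (l i - 1)" using h j(2) unfolding trees_def by blast
          then show ?thesis using True j e0 by (simp add: hook_sizes_def)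
        next
          case False
          then show ?thesis using j e1[of i p] by (simp add: hook_sizes_def)
        qed
      qed
      ultimately show "a \<in> ?T" unfolding trees_def a by auto
    qed
    show "?f' ` ?T \<subseteq> Sigma ?H ?P"
    proof
      fix a assume "a \<in> ?f' ` ?T"
      then obtain e where e: "e \<in> ?T" and a: "a = ?f' e" by blast
      let ?h = "restrict (\<lambda>i. e (i, 0)) {..<d}"
      have col: "e (i, p) \<inter> e (i, q) = {}" if "i < d" "p < l i" "q < l i" "p \<noteq> q" for i p q
        using e that unfolding trees_def coloured_def by blast
      have "linked {..<d} ?h"
        using linked_iff[of e ?h] T[OF e] e unfolding trees_def by auto
      moreover have "card (?h i) = CARD('i) - (l i - 1)" if "i < d" for i
        using e that l[OF that] by (auto simp: trees_def cells_def hook_sizes_def)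
      ultimately have h: "?h \<in> ?H" unfolding trees_def by auto
      have "restrict (\<lambda>p. the_elem (e (i, p))) {1..<l i} \<in> ?I ?h i" if i: "i < d" for i
      proof -
        have "the_elem (e (i, p)) \<notin> e (i, 0)" if p: "p \<in> {1..<l i}" for p
          using col[OF i, of p 0] T[OF e i, of p] p l[OF i] by fastforce
        moreover have "p = q" if "p \<in> {1..<l i}" "q \<in> {1..<l i}" "the_elem (e (i, p)) = the_elem (e (i, q))" for p q
        proof (rule ccontr)
          assume "p \<noteq> q"
          then show False using col[OF i, of p q] T[OF e i, of p] T[OF e i, of q] that
            by (metis atLeastLessThan_iff inf.idem insert_not_empty less_one not_le linorder_not_less One_nat_def Suc_le_eq)
        qed
        ultimately show ?thesis using i by (auto simp: inj_on_def)
      qed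
      with h show "a \<in> Sigma ?H ?P" unfolding a by (auto intro!: restrict_PiE_iff[THEN iffD2])
    qed
  qed
  then have "card ?T = card (Sigma ?H ?P)" by (simp add: bij_betw_same_card)
  also have "\<dots> = (\<Sum>h\<in>?H. card (?P h))"
  proof (rule card_SigmaI)
    have "finite (?I h i)" for h i
      by (rule finite_subset[of _ "{1..<l i} \<rightarrow>\<^sub>E - h i"]) (auto intro: finite_PiE)
    then show "\<forall>h\<in>?H. finite (?P h)" by (auto intro!: finite_PiE)
  qed (simp add: finite_trees)
  also have "\<dots> = card ?H * (\<Prod>i<d. fact (l i - 1))" using card_P by simp
  finally show ?thesis .
qed

text \<open>The concentration within rows is followed by the one among the large blocks. The weights
  match because singletons contribute 0! = 1.\<close>

lemma card_trees_coloured: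
  fixes s :: "nat \<times> nat \<Rightarrow> nat"
  defines "N \<equiv> CARD('i::finite)"
  assumes "1 \<le> d" and l: "\<And>i. i < d \<Longrightarrow> 1 \<le> l i"
    and s: "\<And>i p. i < d \<Longrightarrow> p < l i \<Longrightarrow> 1 \<le> s (i, p)"
    and sum_s: "\<And>i. i < d \<Longrightarrow> (\<Sum>p<l i. s (i, p)) = N"
    and rank: "(\<Sum>i<d. N - l i) = N - 1"
  shows "card (trees (cells d l) (coloured d l) s :: (nat \<times> nat \<Rightarrow> 'i set) set) * weight (cells d l) s =
    N ^ (d - 1) * fact (N - 1) * (\<Prod>i<d. fact (l i - 1))"
proof -
  have lN: "l i \<le> N" if i: "i < d" for i
  proof -
    have "(\<Sum>p<l i. 1) \<le> (\<Sum>p<l i. s (i, p))" using s[OF i] by (intro sum_mono) auto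
    then show ?thesis using sum_s[OF i] by simp
  qed
  let ?h = "hook_sizes N l d s"
  let ?t = "\<lambda>i. N - (l i - 1)"
  let ?H = "trees {..<d} (\<lambda>_. True) ?t :: (nat \<Rightarrow> 'i set) set"
  have "weight (cells d l) ?h = (\<Prod>i<d. \<Prod>p<l i. fact (?h (i, p) - 1))"
    unfolding weight_def cells_def by (simp add: prod.Sigma)
  also have "\<dots> = (\<Prod>i<d. fact (?t i - 1))"
  proof (rule prod.cong[OF refl])
    fix i assume i: "i \<in> {..<d}"
    have "{..<l i} = insert 0 {1..<l i}" using l[of i] i by auto
    then have "(\<Prod>p<l i. fact (?h (i, p) - 1) :: nat) =
        fact (?h (i, 0) - 1) * (\<Prod>p\<in>{1..<l i}. fact (?h (i, p) - 1))" by simp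
    also have "(\<Prod>p\<in>{1..<l i}. fact (?h (i, p) - 1) :: nat) = 1"
      using i by (intro prod.neutral) (auto simp: hook_sizes_def)
    finally show "(\<Prod>p<l i. fact (?h (i, p) - 1) :: nat) = fact (?t i - 1)"
      using i l[of i] by (simp add: hook_sizes_def)
  qed
  finally have w: "weight (cells d l) ?h = weight {..<d} ?t" by (simp add: weight_def)
  have "(\<Sum>i<d. ?t i) = (\<Sum>i<d. (N - l i) + 1)"
    using l lN by (intro sum.cong) force+
  also have "\<dots> = N - 1 + d" unfolding sum.distrib rank by simp
  finally have "(\<Sum>i<d. ?t i) + 1 = CARD('i) + card {..<d}" unfolding N_def by simp
  moreover have "1 \<le> ?t i" if "i \<in> {..<d}" for i using lN[of i] l[of i] that by simp
  ultimately have "card ?H * weight {..<d} ?t = N ^ (d - 1) * fact (N - 1)"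
    using card_trees_unrestricted[of "{..<d}" ?t, where 'i = 'i] \<open>1 \<le> d\<close> unfolding N_def
    by (force simp: lessThan_empty_iff)
  moreover have "card (trees (cells d l) (coloured d l) ?h :: (nat \<times> nat \<Rightarrow> 'i set) set) =
      card ?H * (\<Prod>i<d. fact (l i - 1))"
    using l lN unfolding N_def by (rule card_trees_hook)
  ultimately show ?thesis
    using trees_coloured_hook[of d l s d, where 'i = 'i, folded N_def, OF l lN s sum_s rank order_refl] w
    by (simp add: mult.assoc mult.left_commute mult.commute)
qed

section \<open>Permutations acting by permuting coordinates\<close>

abbreviation swap :: "'a \<Rightarrow> 'a \<Rightarrow> 'a \<Rightarrow> 'a" where
  "swap \<equiv> Transposition.transpose"

text \<open>With the inverse, \<open>axis a 1\<close> goes to \<open>axis (\<pi> a) 1\<close>, and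
  composition is preserved in its order.\<close>

definition perm_act :: "('i::finite \<Rightarrow> 'i) \<Rightarrow> real ^ 'i \<Rightarrow> real ^ 'i" where
  "perm_act \<pi> v = (\<chi> a. v $ inv \<pi> a)"

text \<open>The images of the coordinate vectors under the identity minus
  \<open>perm_act \<pi>\<close>; their span is the moved space, whose dimension turns out to be the
  absolute length.\<close>

definition displ :: "('i::finite \<Rightarrow> 'i) \<Rightarrow> (real ^ 'i) set" where
  "displ \<pi> = range (\<lambda>x. rt x (\<pi> x))"

definition orbits :: "('i \<Rightarrow> 'i) \<Rightarrow> 'i set set" where
  "orbits \<pi> = range (orbit \<pi>)"

lemma bij_permutation: "bij (\<pi> :: 'i::finite \<Rightarrow> 'i) \<Longrightarrow> permutation \<pi>"
  unfolding permutation_permutes by (intro exI[of _ UNIV]) (auto intro: bij_imp_permutes)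

lemma self_in_orbit: "bij (\<pi> :: 'i::finite \<Rightarrow> 'i) \<Longrightarrow> x \<in> orbit \<pi> x"
  by (simp add: bij_permutation permutation_self_in_orbit)

lemma orbit_eq: "bij (\<pi> :: 'i::finite \<Rightarrow> 'i) \<Longrightarrow> y \<in> orbit \<pi> x \<Longrightarrow> orbit \<pi> y = orbit \<pi> x"
  by (meson bij_permutation cyclic_on_orbit' orbit_cyclic_eq3)

lemma image_in_orbit_iff:
  assumes "bij (\<pi> :: 'i::finite \<Rightarrow> 'i)"
  shows "\<pi> x \<in> orbit \<pi> a \<longleftrightarrow> x \<in> orbit \<pi> a"
  by (metis assms orbit.base orbit.step orbit_eq self_in_orbit)

lemma orbits_disjoint:
  assumes "bij (\<pi> :: 'i::finite \<Rightarrow> 'i)" "O1 \<in> orbits \<pi>" "O2 \<in> orbits \<pi>" "O1 \<noteq> O2"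
  shows "O1 \<inter> O2 = {}"
  using assms unfolding orbits_def by (metis disjoint_iff imageE orbit_eq)

lemma Union_orbits: "bij (\<pi> :: 'i::finite \<Rightarrow> 'i) \<Longrightarrow> \<Union>(orbits \<pi>) = UNIV"
  unfolding orbits_def using self_in_orbit by fastforce

lemma finite_orbits [simp]: "finite (orbits (\<pi> :: 'i::finite \<Rightarrow> 'i))"
  by (simp add: orbits_def)

lemma orbits_nonempty: "B \<in> orbits \<pi> \<Longrightarrow> B \<noteq> {}"
  unfolding orbits_def using orbit_nonempty by force

lemma orbits_eqI: "bij (\<pi> :: 'i::finite \<Rightarrow> 'i) \<Longrightarrow> B \<in> orbits \<pi> \<Longrightarrow> x \<in> B \<Longrightarrow> B = orbit \<pi> x"
  unfolding orbits_def by (metis imageE orbit_eq)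

lemma sum_card_orbits:
  assumes "bij (\<pi> :: 'i::finite \<Rightarrow> 'i)"
  shows "(\<Sum>B\<in>orbits \<pi>. card B) = CARD('i)"
proof -
  have "card (\<Union>(orbits \<pi>)) = (\<Sum>B\<in>orbits \<pi>. card B)"
    using orbits_disjoint[OF assms] by (intro card_Union_disjoint) (auto simp: pairwise_def disjnt_def)
  then show ?thesis using Union_orbits[OF assms] by simp
qed

text \<open>Following \<pi> connects a point to its whole cycle, and no displacement leaves a
  cycle.\<close>

lemma rt_span_displ:
  assumes "bij (\<pi> :: 'i::finite \<Rightarrow> 'i)"
  shows "rt a b \<in> span (displ \<pi>) \<longleftrightarrow> b \<in> orbit \<pi> a"
proof
  assume *: "rt a b \<in> span (displ \<pi>)"
  have "a \<in> orbit \<pi> a \<longleftrightarrow> b \<in> orbit \<pi> a"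
  proof (rule rt_span_class[OF _ *])
    fix v assume "v \<in> displ \<pi>"
    then obtain x where "v = rt x (\<pi> x)" by (auto simp: displ_def)
    then show "\<exists>x y. v = rt x y \<and> (x \<in> orbit \<pi> a \<longleftrightarrow> y \<in> orbit \<pi> a)"
      using image_in_orbit_iff[OF assms] by blast
  qed
  then show "b \<in> orbit \<pi> a" using self_in_orbit[OF assms] by simp
next
  have step: "rt x (\<pi> x) \<in> span (displ \<pi>)" for x
    by (auto simp: displ_def intro: span_base)
  assume "b \<in> orbit \<pi> a"
  then show "rt a b \<in> span (displ \<pi>)"
    by induction (auto intro: step rt_span_trans)
qed

lemma span_displ:
  assumes "bij (\<pi> :: 'i::finite \<Rightarrow> 'i)"
  shows "span (\<Union>B\<in>orbits \<pi>. diffset B) = span (displ \<pi>)"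
proof (rule antisym)
  have "diffset (orbit \<pi> x) \<subseteq> span (displ \<pi>)" for x
    by (rule diffset_subset_span[of _ x], rule rt_span_sym)
       (simp add: rt_span_displ[OF assms])
  then have "(\<Union>B\<in>orbits \<pi>. diffset B) \<subseteq> span (displ \<pi>)"
    unfolding orbits_def by blast
  then show "span (\<Union>B\<in>orbits \<pi>. diffset B) \<subseteq> span (displ \<pi>)"
    by (metis span_mono span_span)
  have "rt x (\<pi> x) \<in> diffset (orbit \<pi> x)" for x
    using assms by (auto intro!: diffsetI self_in_orbit orbit.base)
  then show "span (displ \<pi>) \<subseteq> span (\<Union>B\<in>orbits \<pi>. diffset B)"
    unfolding displ_def orbits_def by (intro span_mono) blast
qed

text \<open>A cycle of k points contributes at most k - 1. Conversely, the differences between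
  representatives of the cycles connect everything, at the price of at most
  \<open>card (orbits \<pi>) - 1\<close> further dimensions.\<close>

lemma dim_displ:
  assumes "bij (\<pi> :: 'i::finite \<Rightarrow> 'i)"
  shows "dim (displ \<pi>) + card (orbits \<pi>) = CARD('i)"
proof -
  have pos: "1 \<le> card B" if "B \<in> orbits \<pi>" for B
    using orbits_nonempty[OF that] by (simp add: Suc_le_eq card_gt_0_iff)
  have "(\<Sum>B\<in>orbits \<pi>. card B) = (\<Sum>B\<in>orbits \<pi>. (card B - 1) + 1)"
    using pos by (intro sum.cong refl) (metis le_add_diff_inverse2)
  then have sum: "(\<Sum>B\<in>orbits \<pi>. card B - 1) + card (orbits \<pi>) = CARD('i)"
    unfolding sum_card_orbits[OF assms] sum.distrib by simp
  have "dim (displ \<pi>) = dim (\<Union>B\<in>orbits \<pi>. diffset B)"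
    by (metis dim_span span_displ[OF assms])
  also have "\<dots> \<le> (\<Sum>B\<in>orbits \<pi>. dim (diffset B))" by (rule dim_UN_le) simp
  also have "\<dots> \<le> (\<Sum>B\<in>orbits \<pi>. card B - 1)"
    by (intro sum_mono dim_diffset_le orbits_nonempty)
  finally have le: "dim (displ \<pi>) + card (orbits \<pi>) \<le> CARD('i)" using sum by simp
  let ?r = "\<lambda>B. SOME x. x \<in> B"
  let ?S = "displ \<pi> \<union> diffset (?r ` orbits \<pi>)"
  have r: "?r B \<in> B" if "B \<in> orbits \<pi>" for B
    using orbits_nonempty[OF that] by (simp add: some_in_eq)
  have "rt a b \<in> span ?S" for a b
  proof -
    have "rt x (?r (orbit \<pi> x)) \<in> span (displ \<pi>)" for x
      using r[of "orbit \<pi> x"] by (simp add: rt_span_displ[OF assms] orbits_def)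
    then have *: "rt x (?r (orbit \<pi> x)) \<in> span ?S" for x
      using span_mono[of "displ \<pi>" ?S] by blast
    have "rt (?r (orbit \<pi> a)) (?r (orbit \<pi> b)) \<in> span ?S"
      by (intro span_base UnI2 diffsetI) (auto simp: orbits_def)
    then show ?thesis using * by (blast intro: rt_span_trans rt_span_sym)
  qed
  then have "CARD('i) - 1 \<le> dim ?S" by (rule dim_connected_ge)
  also have "\<dots> \<le> dim (displ \<pi>) + dim (diffset (?r ` orbits \<pi>))" by (rule dim_Un_le)
  also have "dim (diffset (?r ` orbits \<pi>)) \<le> card (?r ` orbits \<pi>) - 1"
    by (rule dim_diffset_le) (auto simp: orbits_def)
  also have "\<dots> \<le> card (orbits \<pi>) - 1" using card_image_le[of "orbits \<pi>" ?r] by simp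
  finally have "CARD('i) - 1 \<le> dim (displ \<pi>) + (card (orbits \<pi>) - 1)" by simp
  moreover have "card (orbits \<pi>) > 0" by (simp add: card_gt_0_iff orbits_def)
  ultimately show ?thesis using le by linarith
qed

lemma perm_act_axis:
  assumes "bij \<pi>"
  shows "perm_act \<pi> (axis a 1) = axis (\<pi> a) 1"
proof -
  have "inv \<pi> x = a \<longleftrightarrow> x = \<pi> a" for x using bij_inv_eq_iff[OF assms, of a x] by (simp only: eq_commute)
  then show ?thesis by (simp add: perm_act_def axis_def vec_eq_iff)
qed

lemma perm_act_id [simp]: "perm_act id = id"
  by (auto simp: perm_act_def vec_eq_iff fun_eq_iff)

lemma perm_act_comp: "bij \<pi> \<Longrightarrow> bij \<tau> \<Longrightarrow> perm_act (\<pi> \<circ> \<tau>) = perm_act \<pi> \<circ> perm_act \<tau>"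
  by (simp add: perm_act_def vec_eq_iff fun_eq_iff o_inv_distrib)

lemma perm_act_inject: "bij \<pi> \<Longrightarrow> bij \<tau> \<Longrightarrow> perm_act \<pi> = perm_act \<tau> \<longleftrightarrow> \<pi> = \<tau>"
proof
  assume *: "bij \<pi>" "bij \<tau>" "perm_act \<pi> = perm_act \<tau>"
  have "axis (\<pi> a) (1::real) = axis (\<tau> a) 1" for a
    using perm_act_axis[of \<pi> a] perm_act_axis[of \<tau> a] * by simp
  then show "\<pi> = \<tau>" by (auto simp: fun_eq_iff axis_eq_axis)
qed simp

lemma inv_perm_act:
  assumes "bij \<pi>"
  shows "inv (perm_act \<pi>) = perm_act (inv \<pi>)"
proof (rule inv_unique_comp)
  have "bij (inv \<pi>)" using assms by (rule bij_imp_bij_inv)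
  moreover have "\<pi> \<circ> inv \<pi> = id" "inv \<pi> \<circ> \<pi> = id"
    using assms by (auto simp: bij_is_surj bij_is_inj surj_f_inv_f)
  ultimately show "perm_act \<pi> \<circ> perm_act (inv \<pi>) = id" "perm_act (inv \<pi>) \<circ> perm_act \<pi> = id"
    using assms perm_act_comp[of \<pi> "inv \<pi>"] perm_act_comp[of "inv \<pi>" \<pi>] by simp_all
qed

lemma reflection_rt:
  assumes "a \<noteq> b"
  shows "reflection (rt a b) = perm_act (swap a b)"
proof -
  have "inv (swap a b) = swap a b"
    by (intro inv_unique_comp) auto
  then have 1: "perm_act (swap a b) v $ x = v $ swap a b x" for v x
    by (simp add: perm_act_def)
  have "rt a b \<bullet> rt a b = 2" using assms by (simp add: inner_rt rt_nth)
  then have 2: "reflection (rt a b) v $ x = v $ x - (v $ a - v $ b) * (of_bool (x = a) - of_bool (x = b))" for v x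
    by (simp add: reflection_def inner_rt rt_nth)
  show ?thesis
    by (auto simp: fun_eq_iff vec_eq_iff 1 2 Transposition.transpose_def)
qed

lemma roots_A_eq: "roots_A = {rt a b | a b. a \<noteq> b}"
  by (simp add: roots_A_def rt_def)

lemma comp_list_Nil [simp]: "comp_list [] = id"
  and comp_list_Cons [simp]: "comp_list (f # fs) = f \<circ> comp_list fs"
  by (simp_all add: comp_list_def)

lemma comp_list_append: "comp_list (fs @ gs) = comp_list fs \<circ> comp_list gs"
  by (induction fs) (auto simp: fun_eq_iff)

lemma bij_comp_list: "(\<And>f. f \<in> set fs \<Longrightarrow> bij f) \<Longrightarrow> bij (comp_list fs)"
  by (induction fs) (auto intro: bij_comp)

lemma comp_list_perm_act:
  "(\<And>f. f \<in> set fs \<Longrightarrow> bij f) \<Longrightarrow> comp_list (map perm_act fs) = perm_act (comp_list fs)"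
  by (induction fs) (auto simp: perm_act_comp bij_comp_list)

section \<open>Products of reflections and absolute length\<close>

lemma comp_list_reflections_perm:
  assumes "set rs \<subseteq> roots_A"
  obtains \<pi> where "bij \<pi>" "comp_list (map reflection rs) = perm_act \<pi>"
proof -
  have "\<exists>\<pi>. bij \<pi> \<and> comp_list (map reflection rs) = perm_act \<pi>"
    using assms
  proof (induction rs)
    case (Cons \<alpha> rs)
    then obtain \<pi> where \<pi>: "bij \<pi>" "comp_list (map reflection rs) = perm_act \<pi>" by auto
    from Cons obtain a b where "\<alpha> = rt a b" "a \<noteq> b" by (auto simp: roots_A_eq)
    with \<pi> have "comp_list (map reflection (\<alpha> # rs)) = perm_act (swap a b \<circ> \<pi>)"
      by (simp add: reflection_rt perm_act_comp)
    moreover have "bij (swap a b \<circ> \<pi>)" using \<pi> by (intro bij_comp) auto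
    ultimately show ?case by blast
  qed (auto intro!: exI[of _ id])
  with that show thesis by blast
qed

lemma comp_list_reflections_diff:
  "v - comp_list (map reflection rs) v \<in> span (set rs)"
proof (induction rs)
  case (Cons \<alpha> rs)
  let ?u = "comp_list (map reflection rs) v"
  have "v - ?u \<in> span (set (\<alpha> # rs))"
    using Cons span_mono[of "set rs" "set (\<alpha> # rs)"] by auto
  moreover have "?u - reflection \<alpha> ?u \<in> span (set (\<alpha> # rs))"
    by (simp add: reflection_def span_base span_scale)
  ultimately have "(v - ?u) + (?u - reflection \<alpha> ?u) \<in> span (set (\<alpha> # rs))" by (rule span_add)
  then show ?case by simp
qed (simp add: span_zero)

text \<open>Carter's observation: for linearly independent roots, a vector fixed by the product is
  fixed by every factor, since its displacement under the first reflection lies in the span of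
  the remaining roots.\<close>

lemma fixed_by_independent_reflections:
  assumes "distinct rs" "independent (set rs)" "comp_list (map reflection rs) v = v" "\<alpha> \<in> set rs"
  shows "v \<bullet> \<alpha> = 0"
  using assms
proof (induction rs)
  case (Cons \<beta> us)
  let ?u = "comp_list (map reflection us) v"
  have \<beta>: "\<beta> \<notin> span (set us)" and ind: "independent (set us)"
    using Cons.prems by (simp_all add: independent_insert)
  have "\<beta> \<noteq> 0" using \<beta> span_zero by auto
  have "reflection \<beta> (reflection \<beta> x) = x" for x
    using \<open>\<beta> \<noteq> 0\<close> by (simp add: reflection_def inner_diff_left)
  then have "?u = reflection \<beta> v" using Cons.prems(3) by (metis comp_apply comp_list_Cons list.simps(9))
  then have "v - ?u = (2 * (v \<bullet> \<beta>) / (\<beta> \<bullet> \<beta>)) *\<^sub>R \<beta>" by (simp add: reflection_def)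
  with comp_list_reflections_diff[of v us]
  have "(2 * (v \<bullet> \<beta>) / (\<beta> \<bullet> \<beta>)) *\<^sub>R \<beta> \<in> span (set us)" by simp
  moreover have "c = 0" if "c *\<^sub>R \<beta> \<in> span (set us)" for c
    using \<beta> span_scale[OF that, of "inverse c"] by (cases "c = 0") auto
  ultimately have "2 * (v \<bullet> \<beta>) / (\<beta> \<bullet> \<beta>) = 0" by blast
  then have "v \<bullet> \<beta> = 0" using \<open>\<beta> \<noteq> 0\<close> by simp
  moreover from this have "?u = v" using \<open>v - ?u = _\<close> by simp
  ultimately show ?case using Cons ind by auto
qed simp

lemma displ_subset_span:
  assumes "bij \<pi>" "perm_act \<pi> = comp_list (map reflection rs)"
  shows "displ \<pi> \<subseteq> span (set rs)"
proof -
  have "rt x (\<pi> x) \<in> span (set rs)" for x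
    using comp_list_reflections_diff[of "axis x 1" rs] unfolding assms(2)[symmetric]
    by (simp add: perm_act_axis assms(1) rt_def)
  then show ?thesis by (auto simp: displ_def)
qed

text \<open>The indicator vector of a cycle is fixed by the product, hence by Carter's observation
  orthogonal to each root; so no root joins two different cycles.\<close>

lemma orbit_comp_list_reflections:
  assumes "bij (\<pi> :: 'i::finite \<Rightarrow> 'i)" "perm_act \<pi> = comp_list (map reflection rs)"
    and "distinct rs" "independent (set rs)"
  shows "b \<in> orbit \<pi> a \<longleftrightarrow> rt a b \<in> span (set rs)"
proof
  assume "b \<in> orbit \<pi> a"
  then have "rt a b \<in> span (displ \<pi>)" using rt_span_displ[OF assms(1)] by simp
  also have "\<dots> \<subseteq> span (set rs)"
    by (metis displ_subset_span[OF assms(1,2)] span_mono span_span)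
  finally show "rt a b \<in> span (set rs)" .
next
  assume ab: "rt a b \<in> span (set rs)"
  define v :: "real ^ 'i" where "v = (\<chi> x. of_bool (x \<in> orbit \<pi> a))"
  have "inv \<pi> x \<in> orbit \<pi> a \<longleftrightarrow> x \<in> orbit \<pi> a" for x
    using image_in_orbit_iff[OF assms(1), of "inv \<pi> x"] assms(1) by (simp add: bij_is_surj surj_f_inv_f)
  then have "perm_act \<pi> v = v" by (simp add: perm_act_def v_def vec_eq_iff)
  then have "v \<bullet> \<alpha> = 0" if "\<alpha> \<in> set rs" for \<alpha>
    using fixed_by_independent_reflections assms that by metis
  then have "orthogonal v (rt a b)"
    by (intro orthogonal_to_span[OF ab]) (simp add: orthogonal_def)
  then have "v \<bullet> rt a b = 0" by (simp add: orthogonal_def)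
  then show "b \<in> orbit \<pi> a" using self_in_orbit[OF assms(1), of a]
    by (simp add: inner_rt v_def split: if_splits)
qed

lemma dim_displ_le_length:
  assumes "bij (\<pi> :: 'i::finite \<Rightarrow> 'i)" "perm_act \<pi> = comp_list (map reflection rs)"
  shows "dim (displ \<pi>) \<le> length rs"
proof -
  have "dim (displ \<pi>) \<le> card (set rs)"
    by (rule dim_le_card[OF displ_subset_span[OF assms]]) simp
  then show ?thesis using card_length[of rs] by simp
qed

text \<open>Composing with the transposition of \<open>x\<close> and \<open>\<pi> x\<close> makes
  \<open>x\<close> a fixed point and stays inside the moved space, which therefore shrinks. Fewer
  reflections are impossible by \<open>dim_displ_le_length\<close>.\<close>

lemma perm_act_as_reflections:
  assumes "bij (\<pi> :: 'i::finite \<Rightarrow> 'i)"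
  obtains rs where "set rs \<subseteq> roots_A" "perm_act \<pi> = comp_list (map reflection rs)"
    "length rs = dim (displ \<pi>)"
proof -
  have "\<exists>rs. set rs \<subseteq> roots_A \<and> perm_act \<pi> = comp_list (map reflection rs) \<and>
      length rs \<le> dim (displ \<pi>)"
    using assms
  proof (induction "dim (displ \<pi>)" arbitrary: \<pi> rule: less_induct)
    case less
    show ?case
    proof (cases "\<pi> = id")
      case False
      then obtain x where x: "\<pi> x \<noteq> x" by (auto simp: fun_eq_iff)
      define \<tau> where "\<tau> = swap x (\<pi> x) \<circ> \<pi>"
      have bt: "bij \<tau>" unfolding \<tau>_def using less.prems by (simp add: bij_comp)
      have base: "rt y (\<pi> y) \<in> span (displ \<pi>)" for y
        by (auto simp: displ_def intro: span_base)
      have "rt y (\<tau> y) \<in> span (displ \<pi>)" for y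
      proof -
        \<comment> \<open>Only two values change: \<open>x\<close> is now fixed, and the preimage of
          \<open>x\<close> jumps two steps of \<pi> at once.\<close>
        have "\<tau> y = y \<or> \<tau> y = \<pi> y \<or> \<pi> y = x \<and> \<tau> y = \<pi> x"
          using bij_is_inj[OF less.prems, THEN injD, of y x]
          by (auto simp: \<tau>_def Transposition.transpose_def)
        then show ?thesis using base[of y] base[of x] by (auto intro: rt_span_trans span_zero)
      qed
      then have "displ \<tau> \<subseteq> span (displ \<pi>)" by (auto simp: displ_def)
      then have sub: "span (displ \<tau>) \<subseteq> span (displ \<pi>)"
        by (metis span_mono span_span)
      \<comment> \<open>The fixed point \<open>x\<close> of \<tau> is isolated: no displacement of
        \<tau> leaves or enters {x}.\<close>
      have "rt x (\<pi> x) \<notin> span (displ \<tau>)"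
      proof
        assume "rt x (\<pi> x) \<in> span (displ \<tau>)"
        then have "x \<in> {x} \<longleftrightarrow> \<pi> x \<in> {x}"
        proof (rule rt_span_class[rotated])
          have "\<tau> x = x" by (simp add: \<tau>_def)
          then have "\<tau> y = x \<longleftrightarrow> y = x" for y using bt by (metis bij_def injD)
          then show "\<exists>a b. v = rt a b \<and> (a \<in> {x} \<longleftrightarrow> b \<in> {x})" if "v \<in> displ \<tau>" for v
            using that unfolding displ_def by blast
        qed
        with x show False by simp
      qed
      with sub base[of x] have "span (displ \<tau>) \<subset> span (displ \<pi>)" by blast
      then have lt: "dim (displ \<tau>) < dim (displ \<pi>)" by (rule dim_psubset)
      then obtain rs where rs: "set rs \<subseteq> roots_A" "perm_act \<tau> = comp_list (map reflection rs)"
        "length rs \<le> dim (displ \<tau>)" using less.hyps bt by blast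
      have "swap x (\<pi> x) \<circ> \<tau> = \<pi>"
        by (simp add: \<tau>_def flip: comp_assoc)
      then have "perm_act \<pi> = reflection (rt x (\<pi> x)) \<circ> perm_act \<tau>"
        using x bt by (simp add: reflection_rt flip: perm_act_comp)
      moreover have "rt x (\<pi> x) \<in> roots_A" using x[symmetric] unfolding roots_A_eq by blast
      ultimately show ?thesis using rs lt
        by (intro exI[of _ "rt x (\<pi> x) # rs"]) auto
    qed (auto intro!: exI[of _ "[]"])
  qed
  then show thesis using that dim_displ_le_length[OF assms] by (metis le_antisym)
qed

lemma abs_length_perm_act:
  assumes "bij (\<pi> :: 'i::finite \<Rightarrow> 'i)"
  shows "abs_length roots_A (perm_act \<pi>) = dim (displ \<pi>)"
  unfolding abs_length_def
proof (rule Least_equality)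
  show "\<exists>rs. length rs = dim (displ \<pi>) \<and> set rs \<subseteq> roots_A \<and>
      perm_act \<pi> = comp_list (map reflection rs)"
    using perm_act_as_reflections[OF assms] by metis
qed (use dim_displ_le_length[OF assms] in blast)

lemma reflection_group_roots_A: "reflection_group roots_A = perm_act ` {\<pi> :: 'i::finite \<Rightarrow> 'i. bij \<pi>}"
proof (intro equalityI subsetI)
  fix w :: "real ^ 'i \<Rightarrow> real ^ 'i" assume "w \<in> reflection_group roots_A"
  then show "w \<in> perm_act ` {\<pi>. bij \<pi>}"
    unfolding reflection_group_def by (auto elim: comp_list_reflections_perm)
next
  fix w :: "real ^ 'i \<Rightarrow> real ^ 'i" assume "w \<in> perm_act ` {\<pi>. bij \<pi>}"
  then obtain \<pi> where "bij \<pi>" "w = perm_act \<pi>" by blast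
  then show "w \<in> reflection_group roots_A"
    unfolding reflection_group_def using perm_act_as_reflections[of \<pi>] by blast
qed

lemma rt_comp_list_span:
  fixes ps :: "('i::finite \<Rightarrow> 'i) list"
  shows "rt x (comp_list ps x) \<in> span (\<Union>\<pi>\<in>set ps. displ \<pi>)"
proof (induction ps)
  case (Cons \<pi> ps)
  let ?S = "\<Union>\<pi>\<in>set (\<pi> # ps). displ \<pi>"
  have "rt x (comp_list ps x) \<in> span ?S"
    using Cons span_mono[of "\<Union>\<pi>\<in>set ps. displ \<pi>" ?S] by auto
  moreover have "rt (comp_list ps x) (\<pi> (comp_list ps x)) \<in> span ?S"
    by (intro span_base) (auto simp: displ_def)
  ultimately show ?case by (auto intro: rt_span_trans)
qed simp

text \<open>For the converse, write each factor with as few reflections as possible. This gives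
  \<open>CARD('i) - 1\<close> roots in total that span all differences, so by dimension they are
  distinct and independent, and \<open>orbit_comp_list_reflections\<close> applies to the
  product.\<close>

lemma comp_list_full_cycle_iff:
  fixes ps :: "('i::finite \<Rightarrow> 'i) list"
  assumes bij: "\<And>\<pi>. \<pi> \<in> set ps \<Longrightarrow> bij \<pi>"
    and rank: "(\<Sum>\<pi>\<leftarrow>ps. dim (displ \<pi>)) = CARD('i) - 1"
  shows "(\<forall>a b. b \<in> orbit (comp_list ps) a) \<longleftrightarrow>
    (\<forall>a b. rt a b \<in> span (\<Union>\<pi>\<in>set ps. displ \<pi>))"
proof (intro iffI allI)
  let ?S = "\<Union>\<pi>\<in>set ps. displ \<pi>"
  fix a b assume "\<forall>a b. b \<in> orbit (comp_list ps) a"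
  then have "rt a b \<in> span (displ (comp_list ps))"
    using rt_span_displ[OF bij_comp_list[OF bij]] by blast
  moreover have "displ (comp_list ps) \<subseteq> span ?S"
    using rt_comp_list_span by (auto simp: displ_def)
  ultimately show "rt a b \<in> span ?S" by (metis span_mono span_span subsetD)
next
  let ?S = "\<Union>\<pi>\<in>set ps. displ \<pi>"
  fix a b assume conn: "\<forall>a b. rt a b \<in> span ?S"
  obtain F where F: "\<And>\<pi>. \<pi> \<in> set ps \<Longrightarrow> set (F \<pi>) \<subseteq> roots_A \<and>
      perm_act \<pi> = comp_list (map reflection (F \<pi>)) \<and> length (F \<pi>) = dim (displ \<pi>)"
    using bij perm_act_as_reflections by metis
  let ?rs = "concat (map F ps)"
  have prod: "perm_act (comp_list ps) = comp_list (map reflection ?rs)"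
    using F bij
  proof (induction ps)
    case (Cons \<pi> ps)
    then have "perm_act (\<pi> \<circ> comp_list ps) = perm_act \<pi> \<circ> perm_act (comp_list ps)"
      by (intro perm_act_comp bij_comp_list) auto
    also have "\<dots> = comp_list (map reflection (F \<pi>)) \<circ> comp_list (map reflection (concat (map F ps)))"
      using Cons by simp
    finally show ?case by (simp only: comp_list_append comp_list_Cons list.map concat.simps map_append)
  qed simp
  have len: "length ?rs = CARD('i) - 1"
    using F rank by (simp add: length_concat comp_def cong: map_cong)
  have "displ \<pi> \<subseteq> span (set ?rs)" if "\<pi> \<in> set ps" for \<pi>
  proof -
    have "displ \<pi> \<subseteq> span (set (F \<pi>))"
      using F[OF that] bij[OF that] by (intro displ_subset_span) auto
    also have "\<dots> \<subseteq> span (set ?rs)" using that by (intro span_mono) auto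
    finally show ?thesis .
  qed
  then have "?S \<subseteq> span (set ?rs)" by blast
  then have "span ?S \<subseteq> span (set ?rs)" by (metis span_mono span_span)
  with conn have conn': "rt a b \<in> span (set ?rs)" for a b by blast
  then have "CARD('i) - 1 \<le> dim (set ?rs)" by (rule dim_connected_ge)
  moreover have "dim (set ?rs) \<le> card (set ?rs)" by (rule dim_le_card[OF span_superset]) simp
  moreover have "card (set ?rs) \<le> length ?rs" by (rule card_length)
  ultimately have "card (set ?rs) = length ?rs" "card (set ?rs) \<le> dim (set ?rs)"
    using len by linarith+
  then have "distinct ?rs" "independent (set ?rs)"
    by (simp only: card_distinct,
        intro card_le_dim_spanning[OF order_refl span_superset] finite_set)
  then show "b \<in> orbit (comp_list ps) a"
    using orbit_comp_list_reflections[OF bij_comp_list[OF bij] prod] conn' by blast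
qed

section \<open>Cycle types as types of parabolic subgroups\<close>

definition root_block :: "'i::finite set \<Rightarrow> (real ^ 'i) set" where
  "root_block B = {rt a b | a b. a \<in> B \<and> b \<in> B \<and> a \<noteq> b}"

text \<open>A cycle on k + 1 points is a Coxeter element of type \<open>A_k\<close>; fixed points
  would be of type \<open>A_0\<close> and are dropped.\<close>

definition cycle_type :: "('i::finite \<Rightarrow> 'i) \<Rightarrow> nat multiset" where
  "cycle_type \<pi> = image_mset (\<lambda>B. card B - 1) (mset_set {B \<in> orbits \<pi>. 2 \<le> card B})"

lemma root_blockI: "a \<in> B \<Longrightarrow> b \<in> B \<Longrightarrow> a \<noteq> b \<Longrightarrow> rt a b \<in> root_block B"
  unfolding root_block_def by blast

lemma rt_in_root_block_iff: "a \<noteq> b \<Longrightarrow> rt a b \<in> root_block B \<longleftrightarrow> a \<in> B \<and> b \<in> B"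
  unfolding root_block_def by (auto simp: rt_eq_iff)

lemma rt_in_roots_A_iff: "rt a b \<in> roots_A \<longleftrightarrow> a \<noteq> b"
  unfolding roots_A_eq by (auto simp: rt_eq_iff)

lemma span_root_block: "span (root_block B) = span (diffset B)"
proof -
  have "insert 0 (root_block B) = insert 0 (diffset B)"
    unfolding root_block_def diffset_def by (auto simp: rt_eq_0_iff) (metis rt_self)
  then show ?thesis by (metis span_insert_0)
qed

text \<open>For the lower bound, \<open>B\<close> is completed by a second block consisting of
  \<open>b\<close> and all points outside \<open>B\<close>, which accounts for at most
  \<open>CARD('i) - card B\<close> dimensions.\<close>

lemma dim_diffset:
  fixes B :: "'i::finite set"
  assumes "B \<noteq> {}"
  shows "dim (diffset B) = card B - 1"
proof (rule antisym[OF dim_diffset_le[OF assms]])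
  from assms obtain b where b: "b \<in> B" by blast
  let ?B' = "insert b (- B)"
  let ?S = "diffset B \<union> diffset ?B'"
  have "rt x b \<in> span ?S" for x
    using b by (cases "x \<in> B") (auto intro!: span_base diffsetI)
  then have "rt x y \<in> span ?S" for x y by (blast intro: rt_span_trans rt_span_sym)
  then have "CARD('i) - 1 \<le> dim ?S" by (rule dim_connected_ge)
  also have "\<dots> \<le> dim (diffset B) + dim (diffset ?B')" by (rule dim_Un_le)
  also have "dim (diffset ?B') \<le> card ?B' - 1" by (rule dim_diffset_le) simp
  also have "card ?B' - 1 = CARD('i) - card B" using b by (simp add: Compl_eq_Diff_UNIV card_Diff_subset)
  finally have "CARD('i) - 1 \<le> dim (diffset B) + (CARD('i) - card B)" by simp
  moreover have "card B \<le> CARD('i)" "1 \<le> card B"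
    using assms by (auto simp: card_mono Suc_le_eq card_gt_0_iff)
  ultimately show "card B - 1 \<le> dim (diffset B)" by linarith
qed

lemma dim_root_block: "B \<noteq> {} \<Longrightarrow> dim (root_block B) = card B - 1"
  by (metis dim_diffset dim_span span_root_block)

lemma inner_rt_disjoint: "a \<noteq> c \<Longrightarrow> a \<noteq> d \<Longrightarrow> b \<noteq> c \<Longrightarrow> b \<noteq> d \<Longrightarrow> rt a b \<bullet> rt c d = 0"
  by (auto simp: inner_rt rt_nth)

lemma reflection_rt_commute: "a \<noteq> b \<Longrightarrow> reflection (rt a b) = reflection (rt b a)"
  by (simp add: reflection_rt transpose_commute)

lemma reflection_group_comp:
  assumes "u \<in> reflection_group R" "w \<in> reflection_group R"
  shows "u \<circ> w \<in> reflection_group R"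
proof -
  obtain rs us where "set rs \<subseteq> R" "u = comp_list (map reflection rs)"
    "set us \<subseteq> R" "w = comp_list (map reflection us)"
    using assms by (auto simp: reflection_group_def)
  then have "set (rs @ us) \<subseteq> R" "u \<circ> w = comp_list (map reflection (rs @ us))"
    by (auto simp: comp_list_append)
  then show ?thesis unfolding reflection_group_def by blast
qed

lemma reflection_in_group: "\<alpha> \<in> R \<Longrightarrow> reflection \<alpha> \<in> reflection_group R"
  unfolding reflection_group_def by (auto intro!: exI[of _ "[\<alpha>]"])

text \<open>That the reflection in \<open>rt x y\<close> belongs to the group is, up to equality of
  points, an equivalence relation, transitive by conjugating transpositions. No root of the group
  leaves one of its classes, so neither does a difference in their span.\<close>

lemma rt_span_roots_of:
  fixes R :: "(real ^ 'i::finite) set"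
  defines "\<Psi> \<equiv> roots_of roots_A (reflection_group R)"
  assumes ab: "rt a b \<in> span \<Psi>" "a \<noteq> b"
  shows "rt a b \<in> \<Psi>"
proof -
  let ?P = "reflection_group R"
  define rel where "rel x y \<longleftrightarrow> x = y \<or> reflection (rt x y) \<in> ?P" for x y
  have sym: "rel y x" if "rel x y" for x y
    using that by (cases "x = y") (auto simp: rel_def reflection_rt_commute)
  have trans: "rel x z" if "rel x y" "rel y z" for x y z
  proof (cases "x = y \<or> y = z \<or> x = z")
    case False
    then have P: "reflection (rt x y) \<in> ?P" "reflection (rt y z) \<in> ?P" using that by (auto simp: rel_def)
    have "swap x y \<circ> (swap y z \<circ> swap x y) =
        swap x z"
      using False by (auto simp: fun_eq_iff Transposition.transpose_def)
    then have "perm_act (swap x z) = perm_act (swap x y) \<circ>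
        (perm_act (swap y z) \<circ> perm_act (swap x y))"
      by (metis bij_comp bij_transpose perm_act_comp)
    then have "reflection (rt x z) = reflection (rt x y) \<circ> (reflection (rt y z) \<circ> reflection (rt x y))"
      using False by (simp add: reflection_rt)
    then show ?thesis using P by (simp add: rel_def reflection_group_comp)
  qed (use that in \<open>auto simp: rel_def\<close>)
  have "a \<in> {x. rel a x} \<longleftrightarrow> b \<in> {x. rel a x}"
  proof (rule rt_span_class[OF _ ab(1)])
    fix v assume v: "v \<in> \<Psi>"
    then obtain x y where xy: "v = rt x y" "x \<noteq> y" by (auto simp: \<Psi>_def roots_of_def roots_A_eq)
    with v have "rel x y" by (simp add: \<Psi>_def roots_of_def rel_def)
    with xy show "\<exists>x y. v = rt x y \<and> (x \<in> {x. rel a x} \<longleftrightarrow> y \<in> {x. rel a x})"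
      using sym trans by blast
  qed
  then have "rel a b" by (simp add: rel_def)
  then show ?thesis using ab(2) by (simp add: rel_def \<Psi>_def roots_of_def rt_in_roots_A_iff)
qed

text \<open>This will be the root system of every parabolic subgroup in which
  \<open>perm_act \<pi>\<close> is a Coxeter element.\<close>

definition orbit_roots :: "('i::finite \<Rightarrow> 'i) \<Rightarrow> (real ^ 'i) set" where
  "orbit_roots \<pi> = {rt a b | a b. a \<noteq> b \<and> b \<in> orbit \<pi> a}"

lemma rt_in_orbit_roots_iff: "a \<noteq> b \<Longrightarrow> rt a b \<in> orbit_roots \<pi> \<longleftrightarrow> b \<in> orbit \<pi> a"
  unfolding orbit_roots_def by (auto simp: rt_eq_iff)

lemma simple_system_span:
  assumes "simple_system \<Psi> \<Delta>"
  shows "\<Psi> \<subseteq> span \<Delta>"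
proof
  fix \<beta> assume "\<beta> \<in> \<Psi>"
  then obtain k where "\<beta> = (\<Sum>\<alpha>\<in>\<Delta>. k \<alpha> *\<^sub>R \<alpha>)" using assms unfolding simple_system_def by blast
  then show "\<beta> \<in> span \<Delta>" by (auto intro: span_sum span_scale span_base)
qed

text \<open>The simple roots are independent, so the cycles of \<pi> are the classes of their span;
  and the group has every root lying in that span. Hence the choice of the parabolic subgroup in
  \<open>element_has_type\<close> leaves no freedom for the roots.\<close>

lemma roots_of_coxeter_element:
  fixes \<pi> :: "'i::finite \<Rightarrow> 'i"
  assumes "bij \<pi>" and \<Psi>: "\<Psi> = roots_of roots_A (reflection_group R)"
    and "coxeter_element \<Psi> (perm_act \<pi>)"
  shows "\<Psi> = orbit_roots \<pi>"
proof -
  obtain rs where rs: "distinct rs" "simple_system \<Psi> (set rs)"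
    "perm_act \<pi> = comp_list (map reflection rs)"
    using assms(3) by (auto simp: coxeter_element_def)
  have sub: "set rs \<subseteq> \<Psi>" "independent (set rs)" using rs(2) by (auto simp: simple_system_def)
  with simple_system_span[OF rs(2)] sub(1) have span: "span (set rs) = span \<Psi>"
    by (metis span_mono span_span subset_antisym)
  have "rt a b \<in> \<Psi> \<longleftrightarrow> b \<in> orbit \<pi> a" if "a \<noteq> b" for a b
  proof -
    have "b \<in> orbit \<pi> a \<longleftrightarrow> rt a b \<in> span \<Psi>"
      using orbit_comp_list_reflections[OF assms(1) rs(3,1) sub(2), of b a] span by simp
    moreover have "rt a b \<in> span \<Psi> \<longleftrightarrow> rt a b \<in> \<Psi>"
      using rt_span_roots_of[of a b R] that span_base[of "rt a b" \<Psi>] \<Psi> by metis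
    ultimately show ?thesis by simp
  qed
  note iff = this
  show ?thesis
  proof (intro equalityI subsetI)
    fix \<beta> assume \<beta>: "\<beta> \<in> \<Psi>"
    then obtain a b where "\<beta> = rt a b" "a \<noteq> b" by (auto simp: \<Psi> roots_of_def roots_A_eq)
    with \<beta> iff show "\<beta> \<in> orbit_roots \<pi>" by (simp add: rt_in_orbit_roots_iff)
  next
    fix \<beta> assume "\<beta> \<in> orbit_roots \<pi>"
    then obtain a b where "\<beta> = rt a b" "a \<noteq> b" "b \<in> orbit \<pi> a" by (auto simp: orbit_roots_def)
    with iff show "\<beta> \<in> \<Psi>" by simp
  qed
qed

text \<open>Blocks with fewer than two points all have an empty \<open>root_block\<close>, hence the
  restriction.\<close>

lemma inj_on_root_block: "inj_on root_block {B :: 'i::finite set. 2 \<le> card B}"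
proof (rule inj_onI)
  fix B B' :: "'i set" assume h: "B \<in> {B. 2 \<le> card B}" "B' \<in> {B. 2 \<le> card B}" "root_block B = root_block B'"
  have sub: "B1 \<subseteq> B2" if "2 \<le> card B1" "root_block B1 = root_block B2" for B1 B2 :: "'i set"
  proof
    fix x assume x: "x \<in> B1"
    have "B1 \<noteq> {x}" using that by auto
    then obtain y where y: "y \<in> B1" "y \<noteq> x" using x by blast
    then have "rt x y \<in> root_block B2" using x that(2) root_blockI[of x B1 y] by simp
    then show "x \<in> B2" using y by (simp add: rt_in_root_block_iff)
  qed
  show "B = B'" using sub[of B B'] sub[of B' B] h by auto
qed

text \<open>Non-orthogonal roots must share a component, and the roots of one cycle are linked by
  common points, so they lie in one component. Conversely, the Dynkin path of a component keeps its
  simple roots, hence all its roots, in one cycle. The rank is then the dimension of the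
  block.\<close>

lemma cycle_type_unique:
  fixes \<pi> :: "'i::finite \<Rightarrow> 'i"
  assumes bij: "bij \<pi>" and "root_system_has_type (orbit_roots \<pi>) T"
  shows "T = cycle_type \<pi>"
proof -
  let ?NB = "{B \<in> orbits \<pi>. 2 \<le> card B}"
  obtain \<C> r where \<C>: "finite \<C>" "orbit_roots \<pi> = \<Union>\<C>"
    and orth: "\<And>C D \<alpha> \<beta>. C \<in> \<C> \<Longrightarrow> D \<in> \<C> \<Longrightarrow> C \<noteq> D \<Longrightarrow> \<alpha> \<in> C \<Longrightarrow> \<beta> \<in> D \<Longrightarrow> \<alpha> \<bullet> \<beta> = 0"
    and irr: "\<And>C. C \<in> \<C> \<Longrightarrow> irreducible_type_A (r C) C"
    and T: "T = image_mset r (mset_set \<C>)"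
    using assms(2) unfolding root_system_has_type_def by (elim exE conjE) (rule that, auto)
  have roots: "\<exists>a b. \<beta> = rt a b \<and> a \<noteq> b \<and> b \<in> orbit \<pi> a" if "C \<in> \<C>" "\<beta> \<in> C" for C \<beta>
  proof -
    have "\<beta> \<in> orbit_roots \<pi>" using that \<C>(2) by blast
    then show ?thesis unfolding orbit_roots_def mem_Collect_eq .
  qed
  have same_comp: "\<beta> \<in> C" if "C \<in> \<C>" "\<alpha> \<in> C" "\<beta> \<in> orbit_roots \<pi>" "\<alpha> \<bullet> \<beta> \<noteq> 0" for \<alpha> \<beta> C
    using that orth \<C>(2) by (metis UnionE)
  have main: "\<exists>B\<in>?NB. C = root_block B \<and> r C = card B - 1" if C: "C \<in> \<C>" for C
  proof -
    obtain rs where rs: "1 \<le> r C" "length rs = r C" "distinct rs" "simple_system C (set rs)"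
      and cartan: "\<And>p q. p < r C \<Longrightarrow> q < r C \<Longrightarrow> 2 * (rs ! p \<bullet> rs ! q) / (rs ! q \<bullet> rs ! q) =
           (if p = q then 2 else if p = Suc q \<or> q = Suc p then -1 else 0)"
      using irr[OF C] unfolding irreducible_type_A_def by blast
    have sub: "set rs \<subseteq> C" "independent (set rs)" using rs(4) by (auto simp: simple_system_def)
    have in_C: "rs ! p \<in> C" if "p < r C" for p using that rs(2) sub by auto
    obtain a b where ab: "rs ! 0 = rt a b" "a \<noteq> b" "b \<in> orbit \<pi> a"
      using roots[OF C in_C[of 0]] rs(1) by auto
    let ?B = "orbit \<pi> a"
    have aB: "a \<in> ?B" using self_in_orbit[OF bij] .
    \<comment> \<open>\<beta> must share a point with \<alpha>, and both points of \<beta> lie in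
      the same cycle.\<close>
    have blockI: "\<beta> \<in> root_block ?B" if "\<beta> \<in> C" "\<alpha> \<in> root_block ?B" "\<beta> \<bullet> \<alpha> \<noteq> 0" for \<alpha> \<beta>
    proof -
      obtain c d where cd: "\<beta> = rt c d" "c \<noteq> d" "d \<in> orbit \<pi> c" using roots[OF C \<open>\<beta> \<in> C\<close>] by blast
      obtain x y where xy: "\<alpha> = rt x y" "x \<in> ?B" "y \<in> ?B"
        using \<open>\<alpha> \<in> root_block ?B\<close> by (auto simp: root_block_def)
      have "c \<in> ?B \<or> d \<in> ?B" using inner_rt_disjoint[of c x y d] that cd xy by auto
      then have "c \<in> ?B \<and> d \<in> ?B" using cd(3) orbit_eq[OF bij] self_in_orbit[OF bij] by metis
      then show ?thesis using cd by (simp add: root_blockI)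
    qed
    \<comment> \<open>Walk along the Dynkin path: the Cartan entry -1 says that consecutive simple
      roots are not orthogonal.\<close>
    have "rs ! p \<in> root_block ?B" if "p < r C" for p
      using that
    proof (induction p)
      case 0
      then show ?case using ab aB by (simp add: root_blockI)
    next
      case (Suc p)
      have "2 * (rs ! Suc p \<bullet> rs ! p) / (rs ! p \<bullet> rs ! p) = -1" using cartan[of "Suc p" p] Suc by simp
      then have "rs ! Suc p \<bullet> rs ! p \<noteq> 0" by auto
      then show ?case 
        using blockI[OF in_C[OF Suc.prems]] Suc.IH Suc.prems by simp
    qed
    then have \<alpha>B: "set rs \<subseteq> root_block ?B" using rs(2) by (auto simp: in_set_conv_nth)
    have C_span: "C \<subseteq> span (set rs)" by (rule simple_system_span[OF rs(4)])
    have "C \<subseteq> root_block ?B"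
    proof
      fix \<beta> assume \<beta>: "\<beta> \<in> C"
      then obtain c d where cd: "\<beta> = rt c d" "c \<noteq> d" "d \<in> orbit \<pi> c" using roots[OF C] by blast
      have "rt c d \<in> span (root_block ?B)" using \<beta> C_span span_mono[OF \<alpha>B] cd by auto
      have "c \<in> ?B"
      proof (rule ccontr)
        assume c: "c \<notin> ?B"
        have "c \<in> {c} \<longleftrightarrow> d \<in> {c}"
        proof (rule rt_span_class[OF _ \<open>rt c d \<in> span (root_block ?B)\<close>])
          fix v assume "v \<in> root_block ?B"
          then obtain x y where "v = rt x y" "x \<in> ?B" "y \<in> ?B" by (auto simp: root_block_def)
          then show "\<exists>x y. v = rt x y \<and> (x \<in> {c} \<longleftrightarrow> y \<in> {c})" using c by blast
        qed
        with cd(2) show False by simp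
      qed
      then show "\<beta> \<in> root_block ?B" using cd orbit_eq[OF bij] by (auto intro!: root_blockI)
    qed
    moreover have "root_block ?B \<subseteq> C"
    proof
      fix \<beta> assume "\<beta> \<in> root_block ?B"
      then obtain x y where xy: "\<beta> = rt x y" "x \<in> ?B" "y \<in> ?B" "x \<noteq> y" by (auto simp: root_block_def)
      have \<Psi>: "rt u w \<in> orbit_roots \<pi>" if "u \<in> ?B" "w \<in> ?B" "u \<noteq> w" for u w
        using that orbit_eq[OF bij, of u a] by (simp add: rt_in_orbit_roots_iff)
      \<comment> \<open>From the first simple root every root of the block is reached in at most two
        steps, by way of \<open>rt a x\<close>, between non-orthogonal roots.\<close>
      have "rt a b \<in> C" using in_C[of 0] rs(1) ab by simp
      show "\<beta> \<in> C"
      proof (cases "x = a")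
        case True
        have "rt a b \<bullet> rt a y \<noteq> 0" using True xy ab by (auto simp: inner_rt rt_nth)
        then show ?thesis using same_comp[OF C \<open>rt a b \<in> C\<close>, of \<beta>] \<Psi>[of a y] True xy by simp
      next
        case False
        have "rt a b \<bullet> rt a x \<noteq> 0" using False ab by (auto simp: inner_rt rt_nth)
        then have "rt a x \<in> C" using same_comp[OF C \<open>rt a b \<in> C\<close>] \<Psi>[of a x] False xy aB by simp
        moreover have "rt a x \<bullet> rt x y \<noteq> 0" using False xy by (auto simp: inner_rt rt_nth)
        ultimately show ?thesis using same_comp[OF C] \<Psi>[of x y] xy by simp
      qed
    qed
    ultimately have CB: "C = root_block ?B" by blast
    have "card (set rs) = dim (root_block ?B)"
      using \<alpha>B C_span CB sub(2) by (intro basis_card_eq_dim) auto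
    then have "r C = card ?B - 1"
      using rs(2,3) aB dim_root_block[of ?B] by (auto simp: distinct_card)
    moreover have "?B \<in> ?NB"
      using ab aB card_mono[of ?B "{a, b}"] by (auto simp: orbits_def)
    ultimately show ?thesis using CB by blast
  qed
  have "\<C> = root_block ` ?NB"
  proof (intro equalityI subsetI)
    fix C assume "C \<in> root_block ` ?NB"
    then obtain B where B: "B \<in> orbits \<pi>" "2 \<le> card B" "C = root_block B" by blast
    then obtain a where a: "a \<in> B" using orbits_nonempty by blast
    have "B \<noteq> {a}" using B(2) by auto
    then obtain b where b: "b \<in> B" "a \<noteq> b" using a by blast
    have "B = orbit \<pi> a" using orbits_eqI[OF bij B(1) a] .
    then have "rt a b \<in> orbit_roots \<pi>" using b by (simp add: rt_in_orbit_roots_iff)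
    then obtain D where D: "D \<in> \<C>" "rt a b \<in> D" using \<C>(2) by blast
    then obtain B' where B': "B' \<in> orbits \<pi>" "D = root_block B'" using main[OF D(1)] by (elim bexE conjE) (rule that, auto)
    then have "a \<in> B'" using D b by (simp add: rt_in_root_block_iff)
    then have "B' = B" using orbits_eqI[OF bij] B' B a by metis
    then show "C \<in> \<C>" using D B' B by simp
  qed (use main in blast)
  moreover have inj: "inj_on root_block ?NB" by (rule inj_on_subset[OF inj_on_root_block]) auto
  ultimately have "T = image_mset r (image_mset root_block (mset_set ?NB))"
    using T by (simp add: image_mset_mset_set)
  also have "\<dots> = image_mset (\<lambda>B. card B - 1) (mset_set ?NB)"
    unfolding multiset.map_comp
  proof (rule image_mset_cong)
    fix B assume "B \<in># mset_set ?NB"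
    then have B: "B \<in> ?NB" by simp
    then have "root_block B \<in> \<C>" using \<open>\<C> = _\<close> by blast
    obtain B' where "B' \<in> ?NB" "root_block B = root_block B'" "r (root_block B) = card B' - 1"
      using main[OF \<open>root_block B \<in> \<C>\<close>] by (elim bexE conjE) (rule that)
    moreover from this have "B = B'" using inj_onD[OF inj] B by blast
    ultimately show "(r \<circ> root_block) B = card B - 1" by simp
  qed
  finally show ?thesis by (simp add: cycle_type_def)
qed

section \<open>Simple systems of type A from ordered lists of points\<close>

fun chain :: "'i::finite list \<Rightarrow> (real ^ 'i) list" where
  "chain (x # y # xs) = rt x y # chain (y # xs)"
| "chain _ = []"

lemma length_chain: "length (chain xs) = length xs - 1"
  by (induction xs rule: chain.induct) auto

lemma nth_chain: "Suc p < length xs \<Longrightarrow> chain xs ! p = rt (xs ! p) (xs ! Suc p)"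
proof (induction xs arbitrary: p rule: chain.induct)
  case (1 x y xs)
  then show ?case by (cases p) auto
qed auto

lemma set_chain: "set (chain xs) = {rt (xs ! p) (xs ! Suc p) | p. Suc p < length xs}"
proof -
  have "set (chain xs) = {chain xs ! p | p. p < length xs - 1}"
    by (auto simp: set_conv_nth length_chain)
  also have "\<dots> = {rt (xs ! p) (xs ! Suc p) | p. Suc p < length xs}"
    by (auto simp: nth_chain less_diff_conv) (metis nth_chain)+
  finally show ?thesis .
qed

lemma set_chain_subset: "distinct xs \<Longrightarrow> set (chain xs) \<subseteq> root_block (set xs)"
  by (auto simp: set_chain nth_eq_iff_index_eq intro!: root_blockI)

text \<open>Between two nonempty lists the concatenation has one more root, joining the end of
  \<open>xs\<close> to the start of \<open>ys\<close>. Multisets are compared so that distinctness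
  passes down as well.\<close>

lemma mset_chain_append: "mset (chain xs) + mset (chain ys) \<subseteq># mset (chain (xs @ ys))"
proof (induction xs rule: chain.induct)
  case ("2_2" x)
  then show ?case by (cases ys) auto
qed auto

lemma mset_chain_concat: "mset (concat (map chain css)) \<subseteq># mset (chain (concat css))"
proof (induction css)
  case (Cons cs css)
  then have "mset (chain cs) + mset (concat (map chain css)) \<subseteq># mset (chain cs) + mset (chain (concat css))"
    by simp
  also have "\<dots> \<subseteq># mset (chain (cs @ concat css))" by (rule mset_chain_append)
  finally show ?case by simp
qed simp

text \<open>\<open>cycle_of_list\<close> unfolds into transpositions of consecutive entries, which
  are the reflections in the simple roots of \<open>chain\<close>, in the same order.\<close>

lemma perm_act_cycle_of_list:
  "distinct xs \<Longrightarrow> perm_act (cycle_of_list xs) = comp_list (map reflection (chain xs))"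
proof (induction xs rule: chain.induct)
  case (1 x y xs)
  have "bij (cycle_of_list (y # xs))"
    using permutation_of_cycle permutation_bijective by blast
  then have "perm_act (swap x y \<circ> cycle_of_list (y # xs)) =
      perm_act (swap x y) \<circ> perm_act (cycle_of_list (y # xs))"
    by (intro perm_act_comp) auto
  with 1 show ?case by (simp only: cycle_of_list.simps chain.simps list.map comp_list_Cons) (simp add: reflection_rt)
qed auto

text \<open>A cone in place of the coefficient functions of \<open>simple_system\<close>: the sign
  condition becomes membership of \<beta> or of its negative.\<close>

definition pos_combs :: "'a::real_vector set \<Rightarrow> 'a set" where
  "pos_combs S = {\<Sum>\<alpha>\<in>S. k \<alpha> *\<^sub>R \<alpha> | k. \<forall>\<alpha>\<in>S. 0 \<le> k \<alpha>}"

lemma pos_combsI: "(\<And>\<alpha>. \<alpha> \<in> S \<Longrightarrow> 0 \<le> k \<alpha>) \<Longrightarrow> (\<Sum>\<alpha>\<in>S. k \<alpha> *\<^sub>R \<alpha>) \<in> pos_combs S"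
  unfolding pos_combs_def by blast

lemma pos_combs_base:
  assumes "finite S" "\<alpha> \<in> S"
  shows "\<alpha> \<in> pos_combs S"
proof -
  have "(\<Sum>\<beta>\<in>S. of_bool (\<beta> = \<alpha>) *\<^sub>R \<beta>) = \<alpha>"
    using assms by (simp add: of_bool_def if_distrib[of "\<lambda>c. c *\<^sub>R _"] cong: if_cong)
  then show ?thesis unfolding pos_combs_def by (auto intro!: exI[of _ "\<lambda>\<beta>. of_bool (\<beta> = \<alpha>)"])
qed

lemma pos_combs_add:
  assumes "u \<in> pos_combs S" "v \<in> pos_combs S"
  shows "u + v \<in> pos_combs S"
proof -
  obtain k l where "u = (\<Sum>\<alpha>\<in>S. k \<alpha> *\<^sub>R \<alpha>)" "v = (\<Sum>\<alpha>\<in>S. l \<alpha> *\<^sub>R \<alpha>)"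
    "\<forall>\<alpha>\<in>S. 0 \<le> k \<alpha>" "\<forall>\<alpha>\<in>S. 0 \<le> l \<alpha>"
    using assms by (auto simp: pos_combs_def)
  then have "u + v = (\<Sum>\<alpha>\<in>S. (k \<alpha> + l \<alpha>) *\<^sub>R \<alpha>)" "\<forall>\<alpha>\<in>S. 0 \<le> k \<alpha> + l \<alpha>"
    by (auto simp: scaleR_left_distrib sum.distrib)
  then show ?thesis using pos_combsI[of S "\<lambda>\<alpha>. k \<alpha> + l \<alpha>"] by simp
qed

lemma pos_combs_mono:
  assumes "S \<subseteq> S'" "finite S'"
  shows "pos_combs S \<subseteq> pos_combs S'"
proof
  fix v assume "v \<in> pos_combs S"
  then obtain k where k: "v = (\<Sum>\<alpha>\<in>S. k \<alpha> *\<^sub>R \<alpha>)" "\<forall>\<alpha>\<in>S. 0 \<le> k \<alpha>" by (auto simp: pos_combs_def)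
  let ?k = "\<lambda>\<alpha>. if \<alpha> \<in> S then k \<alpha> else 0"
  have "(\<Sum>\<alpha>\<in>S'. ?k \<alpha> *\<^sub>R \<alpha>) = (\<Sum>\<alpha>\<in>S. ?k \<alpha> *\<^sub>R \<alpha>)"
    using assms by (intro sum.mono_neutral_right) auto
  then have "v = (\<Sum>\<alpha>\<in>S'. ?k \<alpha> *\<^sub>R \<alpha>)" using k(1) by simp
  then show "v \<in> pos_combs S'" using pos_combsI[of S' ?k] k(2) by simp
qed

lemma pos_combs_subset_span: "pos_combs S \<subseteq> span S"
  unfolding pos_combs_def by (auto intro: span_sum span_scale span_base)

lemma simple_systemI:
  assumes "\<Delta> \<subseteq> \<Phi>" "finite \<Delta>" "independent \<Delta>" "\<And>\<beta>. \<beta> \<in> \<Phi> \<Longrightarrow> \<beta> \<in> pos_combs \<Delta> \<or> - \<beta> \<in> pos_combs \<Delta>"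
  shows "simple_system \<Phi> \<Delta>"
proof -
  have "\<exists>k. \<beta> = (\<Sum>\<alpha>\<in>\<Delta>. k \<alpha> *\<^sub>R \<alpha>) \<and> ((\<forall>\<alpha>\<in>\<Delta>. 0 \<le> k \<alpha>) \<or> (\<forall>\<alpha>\<in>\<Delta>. k \<alpha> \<le> 0))"
    if "\<beta> \<in> \<Phi>" for \<beta>
    using assms(4)[OF that]
  proof
    assume "\<beta> \<in> pos_combs \<Delta>"
    then show ?thesis unfolding pos_combs_def by blast
  next
    assume "- \<beta> \<in> pos_combs \<Delta>"
    then obtain k where k: "- \<beta> = (\<Sum>\<alpha>\<in>\<Delta>. k \<alpha> *\<^sub>R \<alpha>)" "\<forall>\<alpha>\<in>\<Delta>. 0 \<le> k \<alpha>" by (auto simp: pos_combs_def)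
    then have "\<beta> = (\<Sum>\<alpha>\<in>\<Delta>. (- k \<alpha>) *\<^sub>R \<alpha>)" by (simp add: sum_negf flip: k(1))
    with k(2) show ?thesis by (intro exI[of _ "\<lambda>\<alpha>. - k \<alpha>"]) auto
  qed
  with assms show ?thesis unfolding simple_system_def by blast
qed

lemma rt_nth_in_pos_combs_chain:
  assumes "p < q" "q < length xs"
  shows "rt (xs ! p) (xs ! q) \<in> pos_combs (set (chain xs))"
  using assms
proof (induction q)
  case (Suc q)
  have step: "rt (xs ! q) (xs ! Suc q) \<in> pos_combs (set (chain xs))"
    using Suc.prems by (intro pos_combs_base finite_set) (auto simp: set_chain)
  show ?case
  proof (cases "p = q")
    case False
    then have "rt (xs ! p) (xs ! q) \<in> pos_combs (set (chain xs))" using Suc by simp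
    from pos_combs_add[OF this step] show ?thesis by (simp add: rt_def)
  qed (use step in simp)
qed simp

lemma root_block_pos_combs_chain:
  assumes "\<beta> \<in> root_block (set xs)"
  shows "\<beta> \<in> pos_combs (set (chain xs)) \<or> - \<beta> \<in> pos_combs (set (chain xs))"
proof -
  obtain a b where ab: "\<beta> = rt a b" "a \<in> set xs" "b \<in> set xs" "a \<noteq> b"
    using assms by (auto simp: root_block_def)
  then obtain p q where pq: "p < length xs" "q < length xs" "a = xs ! p" "b = xs ! q"
    by (auto simp: in_set_conv_nth)
  then have "p \<noteq> q" using ab by auto
  moreover have "- \<beta> = rt b a" using ab by (simp add: rt_def)
  ultimately show ?thesis
    using rt_nth_in_pos_combs_chain[of p q xs] rt_nth_in_pos_combs_chain[of q p xs] ab pq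
    by (metis linorder_neqE_nat)
qed

lemma root_block_subset_span_chain: "root_block (set xs) \<subseteq> span (set (chain xs))"
proof
  fix \<beta> assume "\<beta> \<in> root_block (set xs)"
  then show "\<beta> \<in> span (set (chain xs))"
    using root_block_pos_combs_chain pos_combs_subset_span span_neg by (metis minus_minus subsetD)
qed

text \<open>A list of \<open>length xs - 1\<close> roots spans a space of just this dimension, so no
  entry is repeated or dependent on the others.\<close>

lemma chain_distinct_independent:
  assumes "distinct xs"
  shows "distinct (chain xs)" "independent (set (chain xs))"
proof -
  have *: "distinct (chain xs) \<and> independent (set (chain xs))"
  proof (cases "xs = []")
    case False
    have "dim (root_block (set xs)) = length xs - 1"
      using False assms by (simp add: dim_root_block distinct_card)
    moreover have "dim (root_block (set xs)) \<le> card (set (chain xs))"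
      by (rule dim_le_card[OF root_block_subset_span_chain]) simp
    moreover have "card (set (chain xs)) \<le> length xs - 1"
      using card_length[of "chain xs"] by (simp add: length_chain)
    ultimately have "card (set (chain xs)) = length (chain xs)"
      "card (set (chain xs)) \<le> dim (root_block (set xs))" by (simp_all add: length_chain)
    then show ?thesis
      using card_le_dim_spanning[OF set_chain_subset[OF assms] root_block_subset_span_chain]
        card_distinct by blast
  qed (simp add: independent_empty)
  then show "distinct (chain xs)" "independent (set (chain xs))" by auto
qed

lemma simple_system_chain:
  assumes "distinct xs"
  shows "simple_system (root_block (set xs)) (set (chain xs))"
  using assms root_block_pos_combs_chain
  by (intro simple_systemI set_chain_subset chain_distinct_independent) auto

lemma roots_A_eq_root_block: "roots_A = root_block UNIV"
  by (auto simp: roots_A_eq root_block_def)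

lemma irreducible_type_A_root_block:
  assumes "distinct xs" "2 \<le> length xs"
  shows "irreducible_type_A (length xs - 1) (root_block (set xs))"
  unfolding irreducible_type_A_def
proof (intro conjI exI[of _ "chain xs"] allI impI)
  show "1 \<le> length xs - 1" using assms by simp
  show "length (chain xs) = length xs - 1" by (rule length_chain)
  show "distinct (chain xs)" by (rule chain_distinct_independent[OF assms(1)])
  show "simple_system (root_block (set xs)) (set (chain xs))" by (rule simple_system_chain[OF assms(1)])
  fix p q assume "p < length xs - 1" "q < length xs - 1"
  then have pq: "Suc p < length xs" "Suc q < length xs" by auto
  show "2 * (chain xs ! p \<bullet> chain xs ! q) / (chain xs ! q \<bullet> chain xs ! q) =
      (if p = q then 2 else if p = Suc q \<or> q = Suc p then - 1 else 0)"
    using pq assms(1) by (auto simp: nth_chain inner_rt rt_nth nth_eq_iff_index_eq)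
qed

text \<open>Since the lists cover \<open>UNIV\<close>, fixed points occur as one-element
  lists.\<close>

lemma cycle_list_decomposition:
  assumes "bij (\<pi> :: 'i::finite \<Rightarrow> 'i)"
  obtains css where "distinct (concat css)" "set (concat css) = UNIV"
    "\<pi> = comp_list (map cycle_of_list css)"
proof -
  have "\<exists>css. distinct (concat css) \<and> set (concat css) = S \<and> p = comp_list (map cycle_of_list css)"
    if "cycle_decomp S p" for S and p :: "'i \<Rightarrow> 'i"
    using that
  proof induction
    case (comp I p cs)
    then obtain css where "distinct (concat css)" "set (concat css) = I"
      "p = comp_list (map cycle_of_list css)" by blast
    with comp show ?case by (intro exI[of _ "cs # css"]) auto
  qed (auto intro!: exI[of _ "[]"])
  moreover have "cycle_decomp UNIV \<pi>"
    using assms by (intro cycle_decomposition bij_imp_permutes) auto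
  ultimately show thesis using that by blast
qed

text \<open>Writing all cycles one after the other orders the points, and the chain of this order is
  a simple system of the whole root system. Omitting the roots between consecutive cycles leaves the
  simple roots of a parabolic subgroup with Coxeter element \<open>perm_act \<pi>\<close>.\<close>

lemma element_has_cycle_type:
  fixes \<pi> :: "'i::finite \<Rightarrow> 'i"
  assumes bij: "bij \<pi>"
  shows "element_has_type roots_A (perm_act \<pi>) (cycle_type \<pi>)"
proof -
  obtain css where css: "distinct (concat css)" "set (concat css) = UNIV"
    and \<pi>: "\<pi> = comp_list (map cycle_of_list css)"
    using cycle_list_decomposition[OF bij] .
  let ?\<Delta> = "set (chain (concat css))"
  define rs where "rs = concat (map chain css)"
  let ?P = "reflection_group (set rs)"
  have dcs: "distinct cs" if "cs \<in> set css" for cs using css that by (simp add: distinct_concat_iff)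
  have disj: "cs = cs'" if "cs \<in> set css" "cs' \<in> set css" "x \<in> set cs" "x \<in> set cs'" for cs cs' x
  proof (rule ccontr)
    assume "cs \<noteq> cs'"
    then have "set cs \<inter> set cs' = {}"
      using css(1) that by (auto simp: distinct_concat_iff removeAll_filter_not_eq)
    with that show False by blast
  qed
  have \<Delta>: "simple_system roots_A ?\<Delta>"
    using simple_system_chain[OF css(1)] css(2) by (simp add: roots_A_eq_root_block)
  have sub: "set rs \<subseteq> ?\<Delta>"
    using mset_chain_concat[of css] unfolding rs_def by (metis set_mset_mono set_mset_mset)
  have ind: "independent (set rs)"
    using chain_distinct_independent(2)[OF css(1)] sub by (rule independent_mono)
  have dist: "distinct rs"
    unfolding distinct_count_atmost_1
  proof
    fix a
    have "count (mset rs) a \<le> count (mset (chain (concat css))) a"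
      using mset_chain_concat[of css] unfolding rs_def by (rule mset_subset_eq_count)
    also have "\<dots> \<le> 1"
      using chain_distinct_independent(1)[OF css(1)] by (simp add: distinct_count_atmost_1)
    finally show "count (mset rs) a = (if a \<in> set rs then 1 else 0)"
      by (auto simp: count_mset_0_iff le_Suc_eq)
  qed
  have prod: "perm_act \<pi> = comp_list (map reflection rs)"
  proof -
    have "perm_act (comp_list (map cycle_of_list ds)) = comp_list (map reflection (concat (map chain ds)))"
      if "set ds \<subseteq> set css" for ds
      using that
    proof (induction ds)
      case (Cons d ds)
      have "bij (cycle_of_list d')" for d' :: "'i list"
        using permutation_of_cycle permutation_bijective by blast
      then have "perm_act (cycle_of_list d \<circ> comp_list (map cycle_of_list ds)) =
          perm_act (cycle_of_list d) \<circ> perm_act (comp_list (map cycle_of_list ds))"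
        by (intro perm_act_comp bij_comp_list) auto
      also have "\<dots> = comp_list (map reflection (chain d)) \<circ> comp_list (map reflection (concat (map chain ds)))"
        using Cons dcs[of d] by (simp add: perm_act_cycle_of_list)
      finally show ?case by (simp only: comp_list_append comp_list_Cons list.map concat.simps map_append)
    qed simp
    from this[of css] show ?thesis by (simp add: \<pi> rs_def)
  qed
  have same_list: "rt a b \<in> span (set rs) \<longleftrightarrow> (\<exists>cs\<in>set css. a \<in> set cs \<and> b \<in> set cs)" for a b
  proof
    assume ab: "rt a b \<in> span (set rs)"
    have "a \<in> set (concat css)" using css by simp
    then obtain cs where cs: "cs \<in> set css" "a \<in> set cs" by auto
    have "a \<in> set cs \<longleftrightarrow> b \<in> set cs"
    proof (rule rt_span_class[OF _ ab])
      fix v assume "v \<in> set rs"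
      then obtain cs' where cs': "cs' \<in> set css" "v \<in> set (chain cs')" by (auto simp: rs_def)
      then have "v \<in> root_block (set cs')" using set_chain_subset[OF dcs] by blast
      then obtain x y where "v = rt x y" "x \<in> set cs'" "y \<in> set cs'" by (auto simp: root_block_def)
      then show "\<exists>x y. v = rt x y \<and> (x \<in> set cs \<longleftrightarrow> y \<in> set cs)" using disj cs cs' by blast
    qed
    with cs show "\<exists>cs\<in>set css. a \<in> set cs \<and> b \<in> set cs" by blast
  next
    assume "\<exists>cs\<in>set css. a \<in> set cs \<and> b \<in> set cs"
    then obtain cs where cs: "cs \<in> set css" "a \<in> set cs" "b \<in> set cs" by blast
    show "rt a b \<in> span (set rs)"
    proof (cases "a = b")
      case False
      then have "rt a b \<in> span (set (chain cs))"
        using root_block_subset_span_chain[of cs] root_blockI[OF cs(2,3)] by blast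
      moreover have "set (chain cs) \<subseteq> set rs" using cs by (auto simp: rs_def)
      ultimately show ?thesis using span_mono by blast
    qed (simp add: span_zero)
  qed
  have orb: "b \<in> orbit \<pi> a \<longleftrightarrow> (\<exists>cs\<in>set css. a \<in> set cs \<and> b \<in> set cs)" for a b
    using orbit_comp_list_reflections[OF bij prod dist ind] same_list by simp
  have orbit_css: "orbit \<pi> a = set cs" if "cs \<in> set css" "a \<in> set cs" for a cs
    using orb disj that by blast
  let ?\<Psi> = "roots_of roots_A ?P"
  have \<alpha>\<Psi>: "set rs \<subseteq> ?\<Psi>"
    using sub \<Delta> reflection_in_group by (auto simp: roots_of_def simple_system_def)
  have \<Psi>: "?\<Psi> = orbit_roots \<pi>"
  proof (intro equalityI subsetI)
    fix \<beta> assume "\<beta> \<in> ?\<Psi>"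
    then obtain a b where ab: "\<beta> = rt a b" "a \<noteq> b" and "reflection (rt a b) \<in> ?P"
      by (auto simp: roots_of_def roots_A_eq)
    then obtain us where us: "set us \<subseteq> set rs" "reflection (rt a b) = comp_list (map reflection us)"
      by (auto simp: reflection_group_def)
    \<comment> \<open>A product of reflections displaces a vector within the span of its roots;
      hence no reflection of the group joins two different cycles.\<close>
    have "comp_list (map reflection us) (axis a 1) = axis b 1"
      using ab(2) by (simp add: us(2)[symmetric] reflection_rt perm_act_axis)
    then have "rt a b \<in> span (set us)"
      using comp_list_reflections_diff[of "axis a 1" us] by (simp add: rt_def)
    then have "rt a b \<in> span (set rs)" using span_mono[OF us(1)] by blast
    then show "\<beta> \<in> orbit_roots \<pi>"
      using ab same_list orb by (simp add: rt_in_orbit_roots_iff)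
  next
    fix \<beta> assume "\<beta> \<in> orbit_roots \<pi>"
    then obtain a b where ab: "\<beta> = rt a b" "a \<noteq> b" "b \<in> orbit \<pi> a" by (auto simp: orbit_roots_def)
    then have "rt a b \<in> span (set rs)" using orb same_list by simp
    then have "rt a b \<in> span ?\<Psi>" using span_mono[OF \<alpha>\<Psi>] by blast
    then show "\<beta> \<in> ?\<Psi>" using rt_span_roots_of ab by blast
  qed
  have "simple_system (orbit_roots \<pi>) (set rs)"
  proof (rule simple_systemI)
    show "set rs \<subseteq> orbit_roots \<pi>" using \<alpha>\<Psi> \<Psi> by simp
    fix \<beta> assume "\<beta> \<in> orbit_roots \<pi>"
    then obtain a b where ab: "\<beta> = rt a b" "a \<noteq> b" "b \<in> orbit \<pi> a" by (auto simp: orbit_roots_def)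
    then obtain cs where cs: "cs \<in> set css" "a \<in> set cs" "b \<in> set cs" using orb by blast
    then have "set (chain cs) \<subseteq> set rs" by (auto simp: rs_def)
    then have "pos_combs (set (chain cs)) \<subseteq> pos_combs (set rs)" by (rule pos_combs_mono) simp
    moreover have "\<beta> \<in> root_block (set cs)" using ab cs by (simp add: root_blockI)
    ultimately show "\<beta> \<in> pos_combs (set rs) \<or> - \<beta> \<in> pos_combs (set rs)"
      using root_block_pos_combs_chain by blast
  qed (use ind in auto)
  then have cox: "coxeter_element ?\<Psi> (perm_act \<pi>)"
    unfolding coxeter_element_def \<Psi> using prod dist by blast
  let ?NB = "{B \<in> orbits \<pi>. 2 \<le> card B}"
  have "root_system_has_type (orbit_roots \<pi>) (cycle_type \<pi>)"
    unfolding root_system_has_type_def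
  \<comment> \<open>The rank of a component is its dimension, so \<open>dim\<close> can serve as the
    rank function.\<close>
  proof (intro exI[of _ "root_block ` ?NB"] exI[of _ dim] conjI ballI impI)
    show "finite (root_block ` ?NB)" by simp
    show "orbit_roots \<pi> = \<Union> (root_block ` ?NB)"
    proof (intro equalityI subsetI)
      fix \<beta> assume "\<beta> \<in> orbit_roots \<pi>"
      then obtain a b where ab: "\<beta> = rt a b" "a \<noteq> b" "b \<in> orbit \<pi> a" by (auto simp: orbit_roots_def)
      have a: "a \<in> orbit \<pi> a" by (rule self_in_orbit[OF bij])
      have "orbit \<pi> a \<in> ?NB" using ab a card_mono[of "orbit \<pi> a" "{a, b}"] by (auto simp: orbits_def)
      moreover have "\<beta> \<in> root_block (orbit \<pi> a)" using ab a by (simp add: root_blockI)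
      ultimately show "\<beta> \<in> \<Union> (root_block ` ?NB)" by blast
    next
      fix \<beta> assume "\<beta> \<in> \<Union> (root_block ` ?NB)"
      then obtain B where B: "B \<in> orbits \<pi>" "\<beta> \<in> root_block B" by blast
      then obtain a b where ab: "\<beta> = rt a b" "a \<noteq> b" "a \<in> B" "b \<in> B" by (auto simp: root_block_def)
      then show "\<beta> \<in> orbit_roots \<pi>"
        using orbits_eqI[OF bij B(1) ab(3)] by (simp add: rt_in_orbit_roots_iff)
    qed
    fix C assume C: "C \<in> root_block ` ?NB"
    then obtain B where B: "B \<in> orbits \<pi>" "2 \<le> card B" "C = root_block B" by blast
    then obtain a where a: "a \<in> B" using orbits_nonempty by blast
    have "a \<in> set (concat css)" using css by simp
    then obtain cs where cs: "cs \<in> set css" "a \<in> set cs" by auto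
    then have Bcs: "B = set cs" using orbit_css orbits_eqI[OF bij B(1) a] by simp
    have "2 \<le> length cs" using B(2) Bcs dcs[OF cs(1)] by (simp add: distinct_card)
    then have "irreducible_type_A (length cs - 1) (root_block (set cs))"
      by (intro irreducible_type_A_root_block dcs[OF cs(1)])
    moreover have "dim C = length cs - 1"
      using B Bcs dcs[OF cs(1)] a by (subst B(3), subst dim_root_block) (auto simp: distinct_card)
    ultimately show "irreducible_type_A (dim C) C" using B Bcs by simp
    fix D \<alpha> \<beta> assume D: "D \<in> root_block ` ?NB" "C \<noteq> D" "\<alpha> \<in> C" "\<beta> \<in> D"
    then obtain B' where B': "B' \<in> orbits \<pi>" "D = root_block B'" by blast
    have "B \<inter> B' = {}" using orbits_disjoint[OF bij B(1) B'(1)] B B' D by blast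
    moreover obtain x y where xy: "\<alpha> = rt x y" "x \<in> B" "y \<in> B"
      using D B by (auto simp: root_block_def)
    moreover obtain z w where zw: "\<beta> = rt z w" "z \<in> B'" "w \<in> B'"
      using D B' by (auto simp: root_block_def)
    ultimately show "\<alpha> \<bullet> \<beta> = 0" using inner_rt_disjoint[of x z w y] by blast
  next
    have inj: "inj_on root_block ?NB" by (rule inj_on_subset[OF inj_on_root_block]) auto
    have "image_mset dim (mset_set (root_block ` ?NB)) = image_mset (dim \<circ> root_block) (mset_set ?NB)"
      using inj by (simp flip: image_mset_mset_set add: multiset.map_comp)
    also have "\<dots> = cycle_type \<pi>" unfolding cycle_type_def
      by (rule image_mset_cong) (auto simp: dim_root_block orbits_nonempty)
    finally show "cycle_type \<pi> = image_mset dim (mset_set (root_block ` ?NB))" by simp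
  qed
  moreover have "parabolic_subgroup roots_A ?P"
    unfolding parabolic_subgroup_def using \<Delta> sub by blast
  ultimately show ?thesis
    unfolding element_has_type_def using cox \<Psi> by metis
qed

lemma element_has_type_iff:
  fixes \<pi> :: "'i::finite \<Rightarrow> 'i"
  assumes "bij \<pi>"
  shows "element_has_type roots_A (perm_act \<pi>) T \<longleftrightarrow> T = cycle_type \<pi>"
proof
  assume "element_has_type roots_A (perm_act \<pi>) T"
  then obtain R where "coxeter_element (roots_of roots_A (reflection_group R)) (perm_act \<pi>)"
    "root_system_has_type (roots_of roots_A (reflection_group R)) T"
    unfolding element_has_type_def parabolic_subgroup_def by blast
  then show "T = cycle_type \<pi>"
    using roots_of_coxeter_element[OF assms refl] cycle_type_unique[OF assms] by metis
qed (use element_has_cycle_type[OF assms] in simp)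

text \<open>The simple roots are independent and span all roots, so the cycle of any point contains
  all points.\<close>

lemma coxeter_element_full_cycle:
  assumes "coxeter_element (roots_A :: (real ^ 'i::finite) set) c"
  obtains \<gamma> where "bij \<gamma>" "c = perm_act \<gamma>" "\<And>a b. b \<in> orbit \<gamma> a"
proof -
  obtain rs :: "(real ^ 'i) list" where rs: "distinct rs" "simple_system roots_A (set rs)"
    "c = comp_list (map reflection rs)"
    using assms by (auto simp: coxeter_element_def)
  have sub: "set rs \<subseteq> roots_A" "independent (set rs)" using rs(2) by (auto simp: simple_system_def)
  obtain \<gamma> where \<gamma>: "bij \<gamma>" "comp_list (map reflection rs) = perm_act \<gamma>"
    using comp_list_reflections_perm[OF sub(1)] .
  have "rt a b \<in> span (set rs)" for a b
    using simple_system_span[OF rs(2)] rt_in_roots_A_iff[of a b] by (cases "a = b") (auto simp: span_zero)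
  then have "b \<in> orbit \<gamma> a" for a b
    using orbit_comp_list_reflections[OF \<gamma>(1) \<gamma>(2)[symmetric] rs(1) sub(2)] by simp
  with \<gamma> rs that show thesis by simp
qed

section \<open>Permutations with prescribed cycles\<close>

definition cyclic_perms :: "'i set \<Rightarrow> ('i \<Rightarrow> 'i) set" where
  "cyclic_perms B = {\<tau>. \<tau> permutes B \<and> cyclic_on \<tau> B}"

lemma funpow_cycle_of_list:
  assumes "distinct cs" "n < length cs"
  shows "(cycle_of_list cs ^^ n) (hd cs) = cs ! n"
proof -
  have "cs \<noteq> []" using assms by auto
  then have "(cycle_of_list cs ^^ n) (hd cs) = map (cycle_of_list cs ^^ n) cs ! 0"
    by (simp add: hd_conv_nth)
  also have "\<dots> = rotate n cs ! 0" using cyclic_rotation[OF assms(1)] by simp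
  also have "\<dots> = cs ! n" using \<open>cs \<noteq> []\<close> assms by (subst nth_rotate) auto
  finally show ?thesis .
qed

lemma cyclic_on_cycle_of_list:
  assumes "distinct cs" "cs \<noteq> []"
  shows "cyclic_on (cycle_of_list cs) (set cs)"
proof (rule cyclic_on_singleI)
  show hd: "hd cs \<in> set cs" using assms by simp
  show "set cs = orbit (cycle_of_list cs) (hd cs)"
  proof
    show "orbit (cycle_of_list cs) (hd cs) \<subseteq> set cs"
      using cycle_permutes hd by (rule permutes_orbit_subset)
    show "set cs \<subseteq> orbit (cycle_of_list cs) (hd cs)"
    proof
      fix x assume "x \<in> set cs"
      then obtain n where "n < length cs" "x = cs ! n" by (auto simp: in_set_conv_nth)
      then have "x = (cycle_of_list cs ^^ n) (hd cs)" using funpow_cycle_of_list assms(1) by metis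
      then show "x \<in> orbit (cycle_of_list cs) (hd cs)"
        unfolding orbit_altdef_permutation[OF permutation_of_cycle] by blast
    qed
  qed
qed

lemma cyclic_perm_as_list:
  assumes "\<tau> \<in> cyclic_perms B" "finite B" "x \<in> B"
  obtains xs where "distinct (x # xs)" "set (x # xs) = B" "\<tau> = cycle_of_list (x # xs)"
proof -
  have perm: "permutation \<tau>" using assms by (auto simp: cyclic_perms_def permutation_permutes)
  let ?cs = "support \<tau> x"
  have dist: "distinct ?cs" using cycle_of_permutation[OF perm] .
  have pos: "least_power \<tau> x > 0" using least_power_of_permutation[OF perm] by blast
  then have cs: "?cs = x # tl ?cs" by (simp add: upt_conv_Cons)
  have "set ?cs = orbit \<tau> x"
    unfolding support_set[OF perm] orbit_altdef_permutation[OF perm] by auto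
  also have "\<dots> = B" using assms by (intro orbit_cyclic_eq3) (auto simp: cyclic_perms_def)
  finally have set: "set ?cs = B" .
  have "\<tau> = cycle_of_list ?cs"
  proof
    fix y
    show "\<tau> y = cycle_of_list ?cs y"
    proof (cases "y \<in> B")
      case True
      then show ?thesis using cycle_restrict[OF perm, of y x] set by simp
    next
      case False
      then have "\<tau> y = y" using assms(1) by (auto simp: cyclic_perms_def permutes_def)
      then show ?thesis using id_outside_supp[of y ?cs] False set by simp
    qed
  qed
  with that[of "tl ?cs"] cs dist set show thesis by metis
qed

text \<open>Reading a cycle from a fixed starting point \<open>x\<close> makes its list unique, so
  the cycles correspond to the arrangements of \<open>B - {x}\<close>.\<close>

lemma card_cyclic_perms:
  assumes "finite B" "B \<noteq> {}"
  shows "card (cyclic_perms B) = fact (card B - 1)"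
proof -
  from assms obtain x where x: "x \<in> B" by blast
  have "bij_betw (\<lambda>xs. cycle_of_list (x # xs)) (permutations_of_set (B - {x})) (cyclic_perms B)"
    unfolding bij_betw_def
  proof (intro conjI equalityI subsetI)
    show "inj_on (\<lambda>xs. cycle_of_list (x # xs)) (permutations_of_set (B - {x}))"
    proof (rule inj_onI)
      fix xs ys assume "xs \<in> permutations_of_set (B - {x})" "ys \<in> permutations_of_set (B - {x})"
        and eq: "cycle_of_list (x # xs) = cycle_of_list (x # ys)"
      then have dist: "distinct (x # xs)" "distinct (x # ys)" and set: "set xs = set ys"
        by (auto dest: permutations_of_setD)
      then have len: "length (x # xs) = length (x # ys)" by (metis distinct_card set length_Cons list.simps(15) distinct.simps(2))
      have "x # xs = x # ys"
      proof (rule nth_equalityI[OF len])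
        fix n assume "n < length (x # xs)"
        then show "(x # xs) ! n = (x # ys) ! n"
          using funpow_cycle_of_list[OF dist(1), of n] funpow_cycle_of_list[OF dist(2), of n] eq len by simp
      qed
      then show "xs = ys" by simp
    qed
    fix \<tau>
    {
      assume "\<tau> \<in> (\<lambda>xs. cycle_of_list (x # xs)) ` permutations_of_set (B - {x})"
      then obtain xs where xs: "\<tau> = cycle_of_list (x # xs)" "distinct (x # xs)" "set (x # xs) = B"
        using x by (auto dest: permutations_of_setD)
      then show "\<tau> \<in> cyclic_perms B"
        using cycle_permutes[of "x # xs"] cyclic_on_cycle_of_list[of "x # xs"]
        unfolding cyclic_perms_def mem_Collect_eq by (metis list.distinct(1))
    }
    assume "\<tau> \<in> cyclic_perms B"
    then obtain xs where xs: "distinct (x # xs)" "set (x # xs) = B" "\<tau> = cycle_of_list (x # xs)"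
      using cyclic_perm_as_list assms(1) x by metis
    then have "xs \<in> permutations_of_set (B - {x})" by (intro permutations_of_setI) auto
    with xs show "\<tau> \<in> (\<lambda>xs. cycle_of_list (x # xs)) ` permutations_of_set (B - {x})" by blast
  qed
  then have "card (cyclic_perms B) = card (permutations_of_set (B - {x}))"
    by (simp add: bij_betw_same_card)
  then show ?thesis using x assms by simp
qed

text \<open>Match the lists of the two cycles entry by entry. This will show that all full cycles
  have equally many factorisations.\<close>

lemma cyclic_perms_conjugate:
  fixes \<gamma> \<gamma>' :: "'i::finite \<Rightarrow> 'i"
  assumes "\<gamma> \<in> cyclic_perms UNIV" "\<gamma>' \<in> cyclic_perms UNIV"
  obtains g where "bij g" "\<gamma>' = g \<circ> \<gamma> \<circ> inv g"
proof -
  fix x :: 'i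
  obtain xs where xs: "distinct (x # xs)" "set (x # xs) = UNIV" "\<gamma> = cycle_of_list (x # xs)"
    using cyclic_perm_as_list[OF assms(1), of x] by auto
  obtain ys where ys: "distinct (x # ys)" "set (x # ys) = UNIV" "\<gamma>' = cycle_of_list (x # ys)"
    using cyclic_perm_as_list[OF assms(2), of x] by auto
  let ?X = "x # xs" and ?Y = "x # ys"
  have len: "length ?X = length ?Y" using distinct_card[OF xs(1)] distinct_card[OF ys(1)] xs(2) ys(2) by simp
  define g where "g = the \<circ> map_of (zip ?X ?Y)"
  have map: "map g ?X = ?Y"
  proof (rule nth_equalityI)
    fix n assume n: "n < length (map g ?X)"
    then have "map_of (zip ?X ?Y) (?X ! n) = Some (?Y ! n)"
      using len by (intro map_of_zip_nth xs(1)) auto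
    then show "map g ?X ! n = ?Y ! n" using n by (simp only: nth_map length_map g_def comp_apply option.sel)
  qed (use len in simp)
  have "surj g"
  proof -
    have "g ` set ?X = set ?Y" using map by (metis list.set_map)
    then show ?thesis unfolding xs(2) ys(2) .
  qed
  then have "bij g" by (simp add: bij_def finite_UNIV_surj_inj)
  moreover have "\<gamma>' = g \<circ> \<gamma> \<circ> inv g"
    using conjugation_of_cycle[OF xs(1) \<open>bij g\<close>] map ys(3) xs(3) by simp
  ultimately show thesis using that by blast
qed

lemma bij_cyclic_UNIV_iff:
  "\<gamma> \<in> cyclic_perms (UNIV :: 'i::finite set) \<longleftrightarrow> bij \<gamma> \<and> (\<forall>a b. b \<in> orbit \<gamma> a)"
proof -
  have "\<gamma> permutes UNIV \<longleftrightarrow> bij \<gamma>"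
    using bij_imp_permutes[of \<gamma> UNIV] permutes_bij by blast
  moreover have "cyclic_on \<gamma> UNIV \<longleftrightarrow> (\<forall>a b. b \<in> orbit \<gamma> a)"
    unfolding cyclic_on_alldef by auto
  ultimately show ?thesis by (simp add: cyclic_perms_def)
qed

lemma cyclic_on_orbits: "bij (\<pi> :: 'i::finite \<Rightarrow> 'i) \<Longrightarrow> B \<in> orbits \<pi> \<Longrightarrow> cyclic_on \<pi> B"
  unfolding orbits_def using cyclic_on_orbit'[OF bij_permutation] by auto

text \<open>A permutation with prescribed cycle sets is glued from cyclic permutations chosen
  independently on the blocks.\<close>

lemma card_perms_with_orbits:
  fixes \<P> :: "'i::finite set set"
  assumes ne: "\<And>B. B \<in> \<P> \<Longrightarrow> B \<noteq> {}"
    and disj: "\<And>B B'. B \<in> \<P> \<Longrightarrow> B' \<in> \<P> \<Longrightarrow> B \<noteq> B' \<Longrightarrow> B \<inter> B' = {}"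
    and cover: "\<Union>\<P> = UNIV"
  shows "card {\<pi>. bij \<pi> \<and> orbits \<pi> = \<P>} = (\<Prod>B\<in>\<P>. fact (card B - 1))"
proof -
  define cell where "cell x = (THE B. B \<in> \<P> \<and> x \<in> B)" for x
  have cell_eq: "cell x = B" if "B \<in> \<P>" "x \<in> B" for x B
    unfolding cell_def
  proof (rule the_equality)
    show "B' = B" if "B' \<in> \<P> \<and> x \<in> B'" for B'
      using disj[of B' B] that \<open>B \<in> \<P>\<close> \<open>x \<in> B\<close> by blast
  qed (use that in simp)
  have cell: "cell x \<in> \<P>" "x \<in> cell x" for x
  proof -
    have "x \<in> \<Union>\<P>" unfolding cover by simp
    then obtain B where "B \<in> \<P>" "x \<in> B" by blast
    then show "cell x \<in> \<P>" "x \<in> cell x" using cell_eq by auto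
  qed
  let ?S = "{\<pi>. bij \<pi> \<and> orbits \<pi> = \<P>}"
  let ?f = "\<lambda>\<pi>. restrict (\<lambda>B. perm_restrict \<pi> B) \<P>"
  let ?g = "\<lambda>\<tau> x. \<tau> (cell x) x"
  have "bij_betw ?f ?S (PiE \<P> cyclic_perms)"
  proof (rule bij_betw_byWitness[where f' = ?g])
    show "\<forall>\<pi>\<in>?S. ?g (?f \<pi>) = \<pi>"
    proof
      fix \<pi> assume "\<pi> \<in> ?S"
      show "?g (?f \<pi>) = \<pi>"
      proof
        fix x
        show "?g (?f \<pi>) x = \<pi> x" using cell[of x] by (simp add: perm_restrict_def)
      qed
    qed
    show "\<forall>\<tau>\<in>PiE \<P> cyclic_perms. ?f (?g \<tau>) = \<tau>"
    proof
      fix \<tau> assume \<tau>: "\<tau> \<in> PiE \<P> cyclic_perms"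
      show "?f (?g \<tau>) = \<tau>"
      proof (rule extensionalityI[of _ \<P>])
        show "\<tau> \<in> extensional \<P>" using \<tau> by (simp add: PiE_def)
        fix B assume B: "B \<in> \<P>"
        have "\<tau> B permutes B" using PiE_mem[OF \<tau> B] by (simp add: cyclic_perms_def)
        then have "perm_restrict (?g \<tau>) B = \<tau> B"
          using cell_eq[OF B] by (auto simp: fun_eq_iff perm_restrict_def permutes_def)
        then show "?f (?g \<tau>) B = \<tau> B" using B by simp
      qed simp
    qed
    show "?f ` ?S \<subseteq> PiE \<P> cyclic_perms"
    proof
      fix \<tau> assume "\<tau> \<in> ?f ` ?S"
      then obtain \<pi> where \<pi>: "bij \<pi>" "orbits \<pi> = \<P>" "\<tau> = ?f \<pi>" by blast
      have "perm_restrict \<pi> B \<in> cyclic_perms B" if "B \<in> \<P>" for B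
      proof -
        have cyc: "cyclic_on \<pi> B" using cyclic_on_orbits \<pi> that by blast
        have "\<pi> ` B \<subseteq> B" using cyclic_on_inI[OF cyc] by blast
        then have "\<pi> ` B = B"
          using inj_on_subset[OF bij_is_inj[OF \<pi>(1)]] by (intro card_subset_eq) (auto simp: card_image)
        then have "bij_betw \<pi> B B" using \<pi>(1) by (auto simp: bij_betw_def bij_is_inj intro: inj_on_subset)
        then have "bij_betw (perm_restrict \<pi> B) B B"
          by (rule bij_betw_cong[THEN iffD1, rotated]) (simp add: perm_restrict_def)
        then have "perm_restrict \<pi> B permutes B"
          by (rule bij_imp_permutes) (simp add: perm_restrict_def)
        then show ?thesis using cyc by (simp add: cyclic_perms_def cyclic_on_perm_restrict)
      qed
      then show "\<tau> \<in> PiE \<P> cyclic_perms" using \<pi>(3) by auto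
    qed
    show "?g ` PiE \<P> cyclic_perms \<subseteq> ?S"
    proof
      fix \<pi> assume "\<pi> \<in> ?g ` PiE \<P> cyclic_perms"
      then obtain \<tau> where \<tau>: "\<tau> \<in> PiE \<P> cyclic_perms" and \<pi>: "\<pi> = ?g \<tau>" by blast
      have \<tau>B: "\<tau> B permutes B" "cyclic_on (\<tau> B) B" if "B \<in> \<P>" for B
        using PiE_mem[OF \<tau> that] by (auto simp: cyclic_perms_def)
      have \<pi>B: "\<pi> x = \<tau> B x" if "B \<in> \<P>" "x \<in> B" for x B using cell_eq[OF that] \<pi> by simp
      have "surj \<pi>"
        unfolding surj_def
      proof
        fix y
        have "y \<in> \<tau> (cell y) ` cell y" using permutes_image[OF \<tau>B(1)] cell by simp
        then show "\<exists>x. y = \<pi> x" using \<pi>B[OF cell(1)] by force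
      qed
      then have bij: "bij \<pi>" by (simp add: bij_def finite_UNIV_surj_inj)
      have cyc: "cyclic_on \<pi> B" if "B \<in> \<P>" for B
        using \<tau>B(2)[OF that] cyclic_cong[of B \<pi> "\<tau> B"] \<pi>B[OF that] by simp
      have orb: "orbit \<pi> x = cell x" for x using orbit_cyclic_eq3[OF cyc] cell by metis
      have "orbits \<pi> = \<P>"
      proof (intro equalityI subsetI)
        fix B assume "B \<in> orbits \<pi>"
        then show "B \<in> \<P>" using orb cell by (auto simp: orbits_def)
      next
        fix B assume B: "B \<in> \<P>"
        then obtain x where "x \<in> B" using ne by blast
        then have "B = orbit \<pi> x" using orb cell_eq B by simp
        then show "B \<in> orbits \<pi>" by (simp add: orbits_def)
      qed
      with bij show "\<pi> \<in> ?S" by simp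
    qed
  qed
  then have "card ?S = (\<Prod>B\<in>\<P>. card (cyclic_perms B))"
    by (simp add: bij_betw_same_card card_PiE)
  also have "\<dots> = (\<Prod>B\<in>\<P>. fact (card B - 1))"
    using ne by (intro prod.cong refl card_cyclic_perms) auto
  finally show ?thesis .
qed

section \<open>Factorisations of a full cycle\<close>

text \<open>The full cycle type of a bijection, fixed points included, hence a partition of
  \<open>CARD('i)\<close>; \<open>cycle_type\<close> is its reduced form.\<close>

definition orbit_sizes :: "('i::finite \<Rightarrow> 'i) \<Rightarrow> nat multiset" where
  "orbit_sizes \<pi> = image_mset card (mset_set (orbits \<pi>))"

lemma size_orbit_sizes: "size (orbit_sizes \<pi>) = card (orbits \<pi>)"
  by (simp add: orbit_sizes_def)

lemma orbit_conjugate: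
  fixes \<pi> :: "'i::finite \<Rightarrow> 'i"
  assumes "bij \<pi>" "bij g"
  shows "orbit (g \<circ> \<pi> \<circ> inv g) (g x) = g ` orbit \<pi> x"
  using assms by (intro orbit_inverse[symmetric] self_in_orbit) (simp_all add: bij_is_inj)

lemma orbits_conjugate:
  fixes \<pi> :: "'i::finite \<Rightarrow> 'i"
  assumes "bij \<pi>" "bij g"
  shows "orbits (g \<circ> \<pi> \<circ> inv g) = (`) g ` orbits \<pi>"
proof -
  have "orbits (g \<circ> \<pi> \<circ> inv g) = orbit (g \<circ> \<pi> \<circ> inv g) ` range g"
    using assms by (simp add: orbits_def bij_is_surj)
  also have "\<dots> = range (\<lambda>x. g ` orbit \<pi> x)"
    by (simp only: image_image orbit_conjugate[OF assms])
  finally show ?thesis by (simp add: orbits_def image_image)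
qed

lemma orbit_sizes_conjugate:
  fixes \<pi> :: "'i::finite \<Rightarrow> 'i"
  assumes "bij \<pi>" "bij g"
  shows "orbit_sizes (g \<circ> \<pi> \<circ> inv g) = orbit_sizes \<pi>"
proof -
  have inj: "inj g" using assms by (simp add: bij_is_inj)
  then have "inj_on ((`) g) (orbits \<pi>)" by (auto simp: inj_on_def inj_image_eq_iff)
  then have "orbit_sizes (g \<circ> \<pi> \<circ> inv g) = image_mset (card \<circ> (`) g) (mset_set (orbits \<pi>))"
    unfolding orbit_sizes_def orbits_conjugate[OF assms]
    by (simp add: multiset.map_comp flip: image_mset_mset_set)
  also have "card \<circ> (`) g = card"
    using inj by (auto simp: fun_eq_iff card_image inj_on_subset)
  finally show ?thesis unfolding orbit_sizes_def .
qed

lemma comp_list_conjugate: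
  assumes "bij g"
  shows "comp_list (map (\<lambda>f. g \<circ> f \<circ> inv g) fs) = g \<circ> comp_list fs \<circ> inv g"
proof (induction fs)
  case Nil
  then show ?case using assms by (simp add: fun_eq_iff bij_is_surj surj_f_inv_f)
next
  case (Cons f fs)
  then show ?case using assms by (simp add: fun_eq_iff bij_is_inj)
qed

lemma card_curried:
  assumes F: "\<And>i. i < d \<Longrightarrow> F i \<subseteq> {..<l i} \<rightarrow>\<^sub>E UNIV"
  shows "card {e \<in> cells d l \<rightarrow>\<^sub>E UNIV. \<forall>i<d. restrict (\<lambda>p. e (i, p)) {..<l i} \<in> F i} = (\<Prod>i<d. card (F i))"
proof -
  let ?S = "{e \<in> cells d l \<rightarrow>\<^sub>E UNIV. \<forall>i<d. restrict (\<lambda>p. e (i, p)) {..<l i} \<in> F i}"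
  let ?f = "\<lambda>e. restrict (\<lambda>i. restrict (\<lambda>p. e (i, p)) {..<l i}) {..<d}"
  let ?g = "\<lambda>h. restrict (\<lambda>(i, p). h i p) (cells d l)"
  have unc: "restrict (\<lambda>p. ?g h (i, p)) {..<l i} = h i" if "h \<in> PiE {..<d} F" "i < d" for h i
  proof (rule extensionalityI[of _ "{..<l i}"])
    have "h i \<in> F i" using that by auto
    then show "h i \<in> extensional {..<l i}" using F[OF that(2)] by (auto simp: PiE_def)
  qed (use that in \<open>auto simp: cells_def\<close>)
  have "bij_betw ?f ?S (PiE {..<d} F)"
  proof (rule bij_betw_byWitness[where f' = ?g])
    show "\<forall>e\<in>?S. ?g (?f e) = e"
    proof
      fix e assume e: "e \<in> ?S"
      show "?g (?f e) = e"
      proof (rule extensionalityI[of _ "cells d l"])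
        show "e \<in> extensional (cells d l)" using e by (auto simp: PiE_def)
      qed (auto simp: cells_def)
    qed
    show "\<forall>h\<in>PiE {..<d} F. ?f (?g h) = h"
    proof
      fix h assume h: "h \<in> PiE {..<d} F"
      show "?f (?g h) = h"
      proof (rule extensionalityI[of _ "{..<d}"])
        show "h \<in> extensional {..<d}" using h by (auto simp: PiE_def)
        fix i assume "i \<in> {..<d}"
        then show "?f (?g h) i = h i" using unc[OF h, of i] by simp
      qed simp
    qed
    show "?f ` ?S \<subseteq> PiE {..<d} F" by auto
    show "?g ` PiE {..<d} F \<subseteq> ?S"
    proof
      fix e assume "e \<in> ?g ` PiE {..<d} F"
      then obtain h where h: "h \<in> PiE {..<d} F" "e = ?g h" by blast
      have "restrict (\<lambda>p. e (i, p)) {..<l i} \<in> F i" if "i < d" for i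
        using unc[OF h(1) that] PiE_mem[OF h(1), of i] that h(2) by simp
      moreover have "e \<in> cells d l \<rightarrow>\<^sub>E UNIV" using h(2) by (simp add: PiE_def)
      ultimately show "e \<in> ?S" by blast
    qed
  qed
  then show ?thesis by (simp add: bij_betw_same_card card_PiE)
qed

lemma span_UN_cong:
  assumes "\<And>i. i \<in> I \<Longrightarrow> span (S i) = span (T i)"
  shows "span (\<Union>i\<in>I. S i) = span (\<Union>i\<in>I. T i)"
proof -
  have "span (\<Union>i\<in>I. S i) \<subseteq> span (\<Union>i\<in>I. T i)" if *: "\<And>i. i \<in> I \<Longrightarrow> span (S i) = span (T i)" for S T
  proof -
    have "S i \<subseteq> span (\<Union>i\<in>I. T i)" if "i \<in> I" for i
      using span_superset[of "S i"] *[OF that] span_mono[of "T i" "\<Union>i\<in>I. T i"] that by blast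
    then have "(\<Union>i\<in>I. S i) \<subseteq> span (\<Union>i\<in>I. T i)" by blast
    then show ?thesis by (metis span_mono span_span)
  qed
  from this[of S T] this[of T S] assms show ?thesis by auto
qed

text \<open>A list in \<open>Q i\<close> gives the cycle lengths of the i-th factor in the order of
  their labels; closure under rearrangement says that only the multiset of lengths is prescribed.
  This covers the factors of fixed type as well as the last one, whose type is free: there
  \<open>Q\<close> consists of all compositions with a given number of parts.\<close>

locale orbit_data =
  fixes d :: nat and l :: "nat \<Rightarrow> nat" and Q :: "nat \<Rightarrow> nat list set"
    and point :: "'i::finite itself"
  assumes d: "1 \<le> d"
    and l: "\<And>i. i < d \<Longrightarrow> 1 \<le> l i"
    and rank: "(\<Sum>i<d. CARD('i) - l i) = CARD('i) - 1"
    and finite_Q: "\<And>i. i < d \<Longrightarrow> finite (Q i)"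
    and length_Q: "\<And>i q. i < d \<Longrightarrow> q \<in> Q i \<Longrightarrow> length q = l i"
    and sum_Q: "\<And>i q. i < d \<Longrightarrow> q \<in> Q i \<Longrightarrow> sum_list q = CARD('i)"
    and pos_Q: "\<And>i q x. i < d \<Longrightarrow> q \<in> Q i \<Longrightarrow> x \<in> set q \<Longrightarrow> 1 \<le> x"
    and mset_Q: "\<And>i q q'. i < d \<Longrightarrow> q \<in> Q i \<Longrightarrow> mset q' = mset q \<Longrightarrow> q' \<in> Q i"
begin

definition perms :: "nat \<Rightarrow> ('i \<Rightarrow> 'i) set" where
  "perms i = {\<pi>. bij \<pi> \<and> orbit_sizes \<pi> \<in> mset ` Q i}"

definition linked_tuples :: "(nat \<Rightarrow> 'i \<Rightarrow> 'i) set" where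
  "linked_tuples = {\<pi> \<in> PiE {..<d} perms. \<forall>a b. rt a b \<in> span (\<Union>i<d. displ (\<pi> i))}"

text \<open>Numbering the cycles distinguishes those of equal length, so that the count involves no
  symmetry factors.\<close>

definition labels :: "(nat \<Rightarrow> 'i \<Rightarrow> 'i) \<Rightarrow> (nat \<times> nat \<Rightarrow> 'i set) \<Rightarrow> bool" where
  "labels \<pi> e \<longleftrightarrow> (\<forall>i<d. bij_betw (\<lambda>p. e (i, p)) {..<l i} (orbits (\<pi> i)))"

definition labelled_trees :: "(nat \<Rightarrow> nat list) \<Rightarrow> (nat \<times> nat \<Rightarrow> 'i set) set" where
  "labelled_trees q = trees (cells d l) (coloured d l) (\<lambda>(i, p). q i ! p)"

lemma perms_bij: "\<pi> \<in> perms i \<Longrightarrow> bij \<pi>"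
  by (simp add: perms_def)

lemma card_orbits_perms: "i < d \<Longrightarrow> \<pi> \<in> perms i \<Longrightarrow> card (orbits \<pi>) = l i"
  using length_Q size_orbit_sizes[of \<pi>] by (auto simp: perms_def)

lemma linked_labels_iff:
  assumes "\<And>i. i < d \<Longrightarrow> bij (\<pi> i)" "labels \<pi> e"
  shows "linked (cells d l) e \<longleftrightarrow> (\<forall>a b. rt a b \<in> span (\<Union>i<d. displ (\<pi> i)))"
proof -
  have row: "(\<Union>p<l i. diffset (e (i, p))) = (\<Union>B\<in>orbits (\<pi> i). diffset B)" if "i < d" for i
  proof -
    have "orbits (\<pi> i) = (\<lambda>p. e (i, p)) ` {..<l i}"
      using assms(2) that by (simp add: labels_def bij_betw_def)
    then show ?thesis by simp
  qed
  have "(\<Union>j\<in>cells d l. diffset (e j)) = (\<Union>i<d. \<Union>p<l i. diffset (e (i, p)))"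
    by (auto simp: cells_def)
  also have "span \<dots> = span (\<Union>i<d. displ (\<pi> i))"
    by (intro span_UN_cong) (simp add: row span_displ assms(1))
  finally show ?thesis by (simp add: linked_def)
qed

lemma labels_coloured:
  assumes "\<And>i. i < d \<Longrightarrow> bij (\<pi> i)" "labels \<pi> e"
  shows "coloured d l e"
  unfolding coloured_def
proof (intro allI impI)
  fix i p q assume h: "i < d" "p < l i" "q < l i" "p \<noteq> q"
  have b: "bij_betw (\<lambda>p. e (i, p)) {..<l i} (orbits (\<pi> i))" using assms(2) h by (simp add: labels_def)
  have "e (i, p) \<in> orbits (\<pi> i)" "e (i, q) \<in> orbits (\<pi> i)" "e (i, p) \<noteq> e (i, q)"
    using bij_betwE[OF b] bij_betw_imp_inj_on[OF b] h by (auto simp: inj_on_def)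
  then show "e (i, p) \<inter> e (i, q) = {}" using orbits_disjoint assms(1) h by blast
qed

lemma labels_sizes:
  assumes "labels \<pi> e" "i < d"
  shows "mset (map (\<lambda>p. card (e (i, p))) [0..<l i]) = orbit_sizes (\<pi> i)"
proof -
  have b: "bij_betw (\<lambda>p. e (i, p)) {..<l i} (orbits (\<pi> i))" using assms by (simp add: labels_def)
  have "mset (map (\<lambda>p. card (e (i, p))) [0..<l i]) = image_mset card (image_mset (\<lambda>p. e (i, p)) (mset_set {..<l i}))"
    by (simp add: multiset.map_comp comp_def mset_upt lessThan_atLeast0)
  also have "image_mset (\<lambda>p. e (i, p)) (mset_set {..<l i}) = mset_set (orbits (\<pi> i))"
    using b by (simp add: image_mset_mset_set bij_betw_def)
  finally show ?thesis by (simp add: orbit_sizes_def)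
qed

text \<open>The cycles of each factor can be numbered in (\<open>l i\<close>)! ways, and by the
  closure of \<open>Q i\<close> every numbering yields an admissible list of sizes.\<close>

lemma card_labels:
  assumes \<pi>: "\<pi> \<in> linked_tuples"
  shows "card {e \<in> (\<Union>q\<in>PiE {..<d} Q. labelled_trees q). labels \<pi> e} = (\<Prod>i<d. fact (l i))"
proof -
  have perm: "\<pi> i \<in> perms i" if "i < d" for i using \<pi> that by (auto simp: linked_tuples_def)
  then have bij: "bij (\<pi> i)" if "i < d" for i using that perms_bij by blast
  let ?F = "\<lambda>i. {f \<in> {..<l i} \<rightarrow>\<^sub>E orbits (\<pi> i). inj_on f {..<l i}}"
  let ?L = "{e \<in> cells d l \<rightarrow>\<^sub>E UNIV. \<forall>i<d. restrict (\<lambda>p. e (i, p)) {..<l i} \<in> ?F i}"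
  have "{e \<in> (\<Union>q\<in>PiE {..<d} Q. labelled_trees q). labels \<pi> e} = ?L"
  proof (intro equalityI subsetI)
    fix e assume e: "e \<in> {e \<in> (\<Union>q\<in>PiE {..<d} Q. labelled_trees q). labels \<pi> e}"
    then have "e \<in> cells d l \<rightarrow>\<^sub>E UNIV" by (auto simp: labelled_trees_def trees_def)
    moreover have "restrict (\<lambda>p. e (i, p)) {..<l i} \<in> ?F i" if "i < d" for i
      using e that by (auto simp: labels_def bij_betw_def)
    ultimately show "e \<in> ?L" by blast
  next
    fix e assume e: "e \<in> ?L"
    have lab: "labels \<pi> e"
      unfolding labels_def
    proof (intro allI impI)
      fix i assume i: "i < d"
      have "restrict (\<lambda>p. e (i, p)) {..<l i} \<in> ?F i" using e i by blast
      then have "inj_on (\<lambda>p. e (i, p)) {..<l i}" and sub: "(\<lambda>p. e (i, p)) ` {..<l i} \<subseteq> orbits (\<pi> i)"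
        by (auto simp: inj_on_def PiE_iff)
      moreover from this(1) have "card ((\<lambda>p. e (i, p)) ` {..<l i}) = card (orbits (\<pi> i))"
        using card_orbits_perms[OF i perm[OF i]] by (simp add: card_image)
      ultimately show "bij_betw (\<lambda>p. e (i, p)) {..<l i} (orbits (\<pi> i))"
        by (simp add: bij_betw_def card_subset_eq)
    qed
    define q where "q = restrict (\<lambda>i. map (\<lambda>p. card (e (i, p))) [0..<l i]) {..<d}"
    have "q i \<in> Q i" if "i < d" for i
    proof -
      obtain q' where "q' \<in> Q i" "orbit_sizes (\<pi> i) = mset q'" using perm[OF \<open>i < d\<close>] by (auto simp: perms_def)
      then show ?thesis using mset_Q[OF that] labels_sizes[OF lab that] that by (simp add: q_def)
    qed
    then have "q \<in> PiE {..<d} Q" by (auto simp: q_def)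
    moreover have "e \<in> labelled_trees q"
      unfolding labelled_trees_def trees_def
      using e labels_coloured[OF bij lab] linked_labels_iff[OF bij lab] \<pi>
      by (auto simp: cells_def q_def linked_tuples_def)
    ultimately show "e \<in> {e \<in> (\<Union>q\<in>PiE {..<d} Q. labelled_trees q). labels \<pi> e}" using lab by blast
  qed
  moreover have "card ?L = (\<Prod>i<d. card (?F i))" by (rule card_curried) auto
  moreover have "card (?F i) = fact (l i)" if "i < d" for i
    using card_inj_fill[of "{..<l i}" "orbits (\<pi> i)"] card_orbits_perms[OF that perm[OF that]] by simp
  ultimately show ?thesis by simp
qed

text \<open>Each row of \<open>e\<close> is disjoint of total size \<open>CARD('i)\<close>, hence a
  partition. The permutations with these cycle sets are counted by \<open>weight\<close>, and their
  tuple is linked because \<open>e\<close> is.\<close>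

lemma card_perms_labelled:
  assumes q: "q \<in> PiE {..<d} Q" and e: "e \<in> labelled_trees q"
  shows "card {\<pi> \<in> linked_tuples. labels \<pi> e} = weight (cells d l) (\<lambda>(i, p). q i ! p)"
proof -
  let ?R = "\<lambda>i. (\<lambda>p. e (i, p)) ` {..<l i}"
  let ?O = "\<lambda>i. {\<rho>. bij \<rho> \<and> orbits \<rho> = ?R i}"
  have qQ: "q i \<in> Q i" if "i < d" for i using q that by auto
  have card_e: "card (e (i, p)) = q i ! p" if "i < d" "p < l i" for i p
    using e that by (auto simp: labelled_trees_def trees_def cells_def)
  have col: "coloured d l e" and conn: "linked (cells d l) e" and ext: "e \<in> cells d l \<rightarrow>\<^sub>E UNIV"
    using e by (auto simp: labelled_trees_def trees_def)
  have ne: "e (i, p) \<noteq> {}" if "i < d" "p < l i" for i p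
  proof -
    have "1 \<le> card (e (i, p))"
      using card_e[OF that] pos_Q[OF that(1) qQ[OF that(1)], of "q i ! p"]
        length_Q[OF that(1) qQ[OF that(1)]] that by simp
    then show ?thesis by auto
  qed
  have disj: "e (i, p) \<inter> e (i, p') = {}" if "i < d" "p < l i" "p' < l i" "p \<noteq> p'" for i p p'
    using col that unfolding coloured_def by blast
  have inj: "inj_on (\<lambda>p. e (i, p)) {..<l i}" if "i < d" for i
  proof (rule inj_onI)
    fix p p' assume "p \<in> {..<l i}" "p' \<in> {..<l i}" "e (i, p) = e (i, p')"
    then show "p = p'" using disj[OF that, of p p'] ne[OF that, of p] by auto
  qed
  have cover: "\<Union>(?R i) = UNIV" if "i < d" for i
  proof (rule card_subset_eq)
    have "card (\<Union>p<l i. e (i, p)) = (\<Sum>p<l i. card (e (i, p)))"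
      using disj[OF that] by (intro card_UN_disjoint) auto
    also have "\<dots> = (\<Sum>p<l i. q i ! p)" using card_e[OF that] by simp
    also have "\<dots> = CARD('i)"
      using sum_Q[OF that qQ[OF that]] length_Q[OF that qQ[OF that]] by (simp add: sum_list_sum_nth lessThan_atLeast0)
    finally show "card (\<Union>(?R i)) = card (UNIV :: 'i set)" by simp
  qed auto
  have card_O: "card (?O i) = (\<Prod>p<l i. fact (q i ! p - 1))" if "i < d" for i
  proof -
    have "card (?O i) = (\<Prod>B\<in>?R i. fact (card B - 1))"
    proof (rule card_perms_with_orbits)
      show "B \<noteq> {}" if "B \<in> ?R i" for B using that ne[OF \<open>i < d\<close>] by blast
      show "B \<inter> B' = {}" if "B \<in> ?R i" "B' \<in> ?R i" "B \<noteq> B'" for B B'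
        using that disj[OF \<open>i < d\<close>] by blast
    qed (rule cover[OF that])
    also have "\<dots> = (\<Prod>p<l i. fact (card (e (i, p)) - 1))"
      by (subst prod.reindex[OF inj[OF that]]) simp
    finally show ?thesis using card_e[OF that] by simp
  qed
  have "{\<pi> \<in> linked_tuples. labels \<pi> e} = PiE {..<d} ?O"
  proof (intro equalityI subsetI)
    fix \<pi> assume \<pi>: "\<pi> \<in> {\<pi> \<in> linked_tuples. labels \<pi> e}"
    then have P: "\<pi> \<in> PiE {..<d} perms" by (simp add: linked_tuples_def)
    have "\<pi> i \<in> ?O i" if "i < d" for i
      using \<pi> that perms_bij[of "\<pi> i" i] PiE_mem[OF P, of i] by (auto simp: labels_def bij_betw_def)
    with P show "\<pi> \<in> PiE {..<d} ?O" by (simp add: PiE_def Pi_def)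
  next
    fix \<pi> assume \<pi>: "\<pi> \<in> PiE {..<d} ?O"
    have bij: "bij (\<pi> i)" and orb: "orbits (\<pi> i) = ?R i" if "i < d" for i
      using PiE_mem[OF \<pi>, of i] that by auto
    have lab: "labels \<pi> e" using inj orb by (simp add: labels_def bij_betw_def)
    have "\<pi> i \<in> perms i" if "i < d" for i
    proof -
      have "map (\<lambda>p. card (e (i, p))) [0..<l i] = q i"
        using length_Q[OF that qQ[OF that]] card_e[OF that] by (intro nth_equalityI) auto
      then have "orbit_sizes (\<pi> i) = mset (q i)" using labels_sizes[OF lab that] by simp
      then show ?thesis using bij[OF that] qQ[OF that] by (auto simp: perms_def)
    qed
    with \<pi> have "\<pi> \<in> PiE {..<d} perms" by (simp add: PiE_def Pi_def)
    then show "\<pi> \<in> {\<pi> \<in> linked_tuples. labels \<pi> e}"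
      using lab linked_labels_iff[OF bij lab] conn by (simp add: linked_tuples_def)
  qed
  then have "card {\<pi> \<in> linked_tuples. labels \<pi> e} = (\<Prod>i<d. card (?O i))" by (simp add: card_PiE)
  also have "\<dots> = (\<Prod>i<d. \<Prod>p<l i. fact (q i ! p - 1))" using card_O by simp
  also have "\<dots> = weight (cells d l) (\<lambda>(i, p). q i ! p)"
    unfolding weight_def cells_def by (simp add: prod.Sigma case_prod_beta)
  finally show ?thesis .
qed

text \<open>Pairs of a tuple and a numbering are counted by tuples and by labelled hypertrees. By
  \<open>card_trees_coloured\<close> every choice \<open>q\<close> of size lists contributes the
  same amount, so only the number of choices enters.\<close>

lemma card_linked_tuples:
  "card linked_tuples * (\<Prod>i<d. fact (l i)) =
     (\<Prod>i<d. card (Q i)) * (CARD('i) ^ (d - 1) * fact (CARD('i) - 1) * (\<Prod>i<d. fact (l i - 1)))"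
proof -
  let ?G = "CARD('i) ^ (d - 1) * fact (CARD('i) - 1) * (\<Prod>i<d. fact (l i - 1)) :: nat"
  let ?Qs = "PiE {..<d} Q"
  let ?E = "\<Union>q\<in>?Qs. labelled_trees q"
  let ?w = "\<lambda>e. weight (cells d l) (\<lambda>(i, p). card (e (i, p) :: 'i set))"
  have finQ: "finite ?Qs" using finite_Q by (intro finite_PiE) auto
  have fin_trees: "finite (labelled_trees q)" for q by (simp add: labelled_trees_def finite_trees)
  have fin_L: "finite linked_tuples"
    by (rule finite_subset[of _ "PiE {..<d} perms"]) (auto simp: linked_tuples_def intro: finite_PiE)
  have w_eq: "?w e = weight (cells d l) (\<lambda>(i, p). q i ! p)" if "e \<in> labelled_trees q" for e q
    unfolding weight_def using that by (intro prod.cong) (auto simp: labelled_trees_def trees_def)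
  have card_q: "card (labelled_trees q) * weight (cells d l) (\<lambda>(i, p). q i ! p) = ?G" if q: "q \<in> ?Qs" for q
  proof -
    have qQ: "q i \<in> Q i" if "i < d" for i using q that by auto
    have "1 \<le> q i ! p" if "i < d" "p < l i" for i p
      using pos_Q[OF that(1) qQ[OF that(1)]] length_Q[OF that(1) qQ[OF that(1)]] that by simp
    moreover have "(\<Sum>p<l i. q i ! p) = CARD('i)" if "i < d" for i
      using sum_Q[OF that qQ[OF that]] length_Q[OF that qQ[OF that]] by (simp add: sum_list_sum_nth lessThan_atLeast0)
    ultimately show ?thesis
      unfolding labelled_trees_def using d l rank by (intro card_trees_coloured) auto
  qed
  \<comment> \<open>The block sizes of a hypertree determine \<open>q\<close>.\<close>
  have disjoint: "labelled_trees q \<inter> labelled_trees q' = {}" if qq: "q \<in> ?Qs" "q' \<in> ?Qs" "q \<noteq> q'" for q q'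
  proof (rule ccontr)
    assume "labelled_trees q \<inter> labelled_trees q' \<noteq> {}"
    then obtain e where e: "e \<in> labelled_trees q" "e \<in> labelled_trees q'" by blast
    have "q = q'"
    proof (rule PiE_ext[OF qq(1,2)])
      fix i assume "i \<in> {..<d}"
      then have i: "i < d" by simp
      have "length (q i) = l i" "length (q' i) = l i" using length_Q[OF i] qq i by auto
      moreover have "q i ! p = q' i ! p" if "p < l i" for p
      proof -
        have "(i, p) \<in> cells d l" using i that by (simp add: cells_def)
        then have "card (e (i, p)) = q i ! p" "card (e (i, p)) = q' i ! p"
          using e by (auto simp: labelled_trees_def trees_def)
        then show ?thesis by simp
      qed
      ultimately show "q i = q' i" by (intro nth_equalityI) auto
    qed
    with qq show False by simp
  qed
  have "card linked_tuples * (\<Prod>i<d. fact (l i)) = (\<Sum>\<pi>\<in>linked_tuples. card {e \<in> ?E. labels \<pi> e})"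
    using card_labels by simp
  also have "\<dots> = (\<Sum>e\<in>?E. ?w e)"
  proof (rule sum_multicount_gen)
    show "\<forall>e\<in>?E. card {\<pi> \<in> linked_tuples. labels \<pi> e} = ?w e"
    proof
      fix e assume "e \<in> ?E"
      then obtain q where q: "q \<in> ?Qs" "e \<in> labelled_trees q" by blast
      show "card {\<pi> \<in> linked_tuples. labels \<pi> e} = ?w e"
        using card_perms_labelled[OF q] w_eq[OF q(2)] by simp
    qed
  qed (use fin_L finQ fin_trees in auto)
  also have "\<dots> = (\<Sum>q\<in>?Qs. \<Sum>e\<in>labelled_trees q. ?w e)"
    using finQ fin_trees disjoint by (intro sum.UNION_disjoint) auto
  also have "\<dots> = (\<Sum>q\<in>?Qs. ?G)"
  proof (rule sum.cong[OF refl])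
    fix q assume q: "q \<in> ?Qs"
    have "(\<Sum>e\<in>labelled_trees q. ?w e) = (\<Sum>e\<in>labelled_trees q. weight (cells d l) (\<lambda>(i, p). q i ! p))"
      using w_eq by (intro sum.cong) auto
    then show "(\<Sum>e\<in>labelled_trees q. ?w e) = ?G" using card_q[OF q] by simp
  qed
  also have "\<dots> = (\<Prod>i<d. card (Q i)) * ?G" by (simp add: card_PiE)
  finally show ?thesis .
qed

definition factorisations :: "('i \<Rightarrow> 'i) \<Rightarrow> (nat \<Rightarrow> 'i \<Rightarrow> 'i) set" where
  "factorisations \<gamma> = {\<pi> \<in> PiE {..<d} perms. comp_list (map \<pi> [0..<d]) = \<gamma>}"

lemma finite_factorisations: "finite (factorisations \<gamma>)"
  by (rule finite_subset[of _ "PiE {..<d} perms"]) (auto simp: factorisations_def intro: finite_PiE)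

lemma linked_tuples_eq: "linked_tuples = (\<Union>\<gamma>\<in>cyclic_perms UNIV. factorisations \<gamma>)"
proof -
  have "(\<forall>a b. rt a b \<in> span (\<Union>i<d. displ (\<pi> i))) \<longleftrightarrow>
      comp_list (map \<pi> [0..<d]) \<in> cyclic_perms UNIV" if \<pi>: "\<pi> \<in> PiE {..<d} perms" for \<pi>
  proof -
    have perm: "\<pi> i \<in> perms i" if "i < d" for i using \<pi> that by auto
    have "bij (\<pi> i)" if "i < d" for i by (rule perms_bij[OF perm[OF that]])
    then have bij: "\<rho> \<in> set (map \<pi> [0..<d]) \<Longrightarrow> bij \<rho>" for \<rho> by auto
    have "dim (displ (\<pi> i)) = CARD('i) - l i" if "i < d" for i
      using dim_displ[OF perms_bij[OF perm[OF that]]] card_orbits_perms[OF that perm[OF that]] by simp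
    then have "(\<Sum>\<rho>\<leftarrow>map \<pi> [0..<d]. dim (displ \<rho>)) = (\<Sum>i<d. CARD('i) - l i)"
      by (simp add: comp_def interv_sum_list_conv_sum_set_nat lessThan_atLeast0)
    then have "(\<forall>a b. b \<in> orbit (comp_list (map \<pi> [0..<d])) a) \<longleftrightarrow>
        (\<forall>a b. rt a b \<in> span (\<Union>\<rho>\<in>set (map \<pi> [0..<d]). displ \<rho>))"
      using rank by (intro comp_list_full_cycle_iff bij) auto
    moreover have "(\<Union>\<rho>\<in>set (map \<pi> [0..<d]). displ \<rho>) = (\<Union>i<d. displ (\<pi> i))"
      by (simp add: lessThan_atLeast0)
    moreover have "bij (comp_list (map \<pi> [0..<d]))" by (rule bij_comp_list[OF bij])
    ultimately show ?thesis by (simp add: bij_cyclic_UNIV_iff)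
  qed
  then show ?thesis unfolding linked_tuples_def factorisations_def by blast
qed

text \<open>All factors are conjugated simultaneously. An inequality suffices, since any two full
  cycles are conjugate in both directions.\<close>

lemma card_factorisations_conjugate_le:
  assumes "bij g"
  shows "card (factorisations \<gamma>) \<le> card (factorisations (g \<circ> \<gamma> \<circ> inv g))"
proof (rule card_inj_on_le)
  let ?f = "\<lambda>\<pi>. restrict (\<lambda>i. g \<circ> \<pi> i \<circ> inv g) {..<d}"
  have bi: "bij (inv g)" using assms by (rule bij_imp_bij_inv)
  show "inj_on ?f (factorisations \<gamma>)"
  proof (rule inj_onI)
    fix \<pi> \<tau> assume h: "\<pi> \<in> factorisations \<gamma>" "\<tau> \<in> factorisations \<gamma>" "?f \<pi> = ?f \<tau>"
    then have P: "\<pi> \<in> PiE {..<d} perms" "\<tau> \<in> PiE {..<d} perms" by (auto simp: factorisations_def)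
    show "\<pi> = \<tau>"
    proof (rule PiE_ext[OF P])
      fix i assume i: "i \<in> {..<d}"
      have eq: "g \<circ> \<pi> i \<circ> inv g = g \<circ> \<tau> i \<circ> inv g" using fun_cong[OF h(3), of i] i by simp
      show "\<pi> i = \<tau> i"
      proof
        fix x
        have "g (\<pi> i x) = g (\<tau> i x)" using fun_cong[OF eq, of "g x"] assms by (simp add: bij_is_inj)
        then show "\<pi> i x = \<tau> i x" using assms by (simp add: bij_is_inj inj_eq)
      qed
    qed
  qed
  show "?f ` factorisations \<gamma> \<subseteq> factorisations (g \<circ> \<gamma> \<circ> inv g)"
  proof
    fix \<tau> assume "\<tau> \<in> ?f ` factorisations \<gamma>"
    then obtain \<pi> where \<pi>: "\<pi> \<in> PiE {..<d} perms" "comp_list (map \<pi> [0..<d]) = \<gamma>" and \<tau>: "\<tau> = ?f \<pi>"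
      by (auto simp: factorisations_def)
    have "g \<circ> \<pi> i \<circ> inv g \<in> perms i" if "i < d" for i
    proof -
      have "\<pi> i \<in> perms i" using \<pi> that by auto
      then show ?thesis using orbit_sizes_conjugate[of "\<pi> i" g] assms bi
        by (auto simp: perms_def intro!: bij_comp)
    qed
    then have "\<tau> \<in> PiE {..<d} perms" using \<tau> by auto
    moreover have "map \<tau> [0..<d] = map (\<lambda>f. g \<circ> f \<circ> inv g) (map \<pi> [0..<d])" using \<tau> by simp
    then have "comp_list (map \<tau> [0..<d]) = g \<circ> \<gamma> \<circ> inv g"
      using comp_list_conjugate[OF assms] \<pi>(2) by metis
    ultimately show "\<tau> \<in> factorisations (g \<circ> \<gamma> \<circ> inv g)" by (simp add: factorisations_def)
  qed
qed (rule finite_factorisations)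

text \<open>\<open>linked_tuples\<close> comprises the factorisations of all full cycles, equally
  many for each. Cancelling their number and the factorials leaves just \<open>l i\<close> from
  (\<open>l i\<close>)! and (\<open>l i\<close> - 1)!.\<close>

lemma card_factorisations:
  assumes \<gamma>: "\<gamma> \<in> cyclic_perms UNIV"
  shows "card (factorisations \<gamma>) * (\<Prod>i<d. l i) = (\<Prod>i<d. card (Q i)) * CARD('i) ^ (d - 1)"
proof -
  have le: "card (factorisations \<gamma>1) \<le> card (factorisations \<gamma>2)"
    if "\<gamma>1 \<in> cyclic_perms UNIV" "\<gamma>2 \<in> cyclic_perms UNIV" for \<gamma>1 \<gamma>2
    using cyclic_perms_conjugate[OF that] card_factorisations_conjugate_le by metis
  have "card linked_tuples = (\<Sum>\<gamma>'\<in>cyclic_perms UNIV. card (factorisations \<gamma>'))"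
    unfolding linked_tuples_eq
    by (intro card_UN_disjoint) (simp_all add: finite_factorisations, auto simp: factorisations_def)
  also have "\<dots> = (\<Sum>\<gamma>'\<in>cyclic_perms (UNIV :: 'i set). card (factorisations \<gamma>))"
    using le \<gamma> by (intro sum.cong refl antisym) auto
  also have "\<dots> = fact (CARD('i) - 1) * card (factorisations \<gamma>)"
    by (simp add: card_cyclic_perms)
  finally have c: "card linked_tuples = fact (CARD('i) - 1) * card (factorisations \<gamma>)" .
  have "(\<Prod>i<d. fact (l i) :: nat) = (\<Prod>i<d. l i * fact (l i - 1))"
    using l by (intro prod.cong refl) (metis fact_reduce lessThan_iff less_le_trans zero_less_one of_nat_id)
  then have f: "(\<Prod>i<d. fact (l i) :: nat) = (\<Prod>i<d. l i) * (\<Prod>i<d. fact (l i - 1))" by (simp add: prod.distrib)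
  let ?F = "fact (CARD('i) - 1) * (\<Prod>i<d. fact (l i - 1)) :: nat"
  have "(card (factorisations \<gamma>) * (\<Prod>i<d. l i)) * ?F = ((\<Prod>i<d. card (Q i)) * CARD('i) ^ (d - 1)) * ?F"
    using card_linked_tuples unfolding c f by (simp only: ac_simps)
  moreover have "?F \<noteq> 0" by simp
  ultimately show ?thesis by (simp only: mult_cancel2) blast
qed

end

section \<open>Decomposition numbers\<close>

text \<open>A component of rank j is a cycle on j + 1 points, so a type occupies as many points as
  its rank plus its number of components; the others are fixed.\<close>

definition block_sizes :: "nat \<Rightarrow> nat multiset \<Rightarrow> nat multiset" where
  "block_sizes N T = image_mset Suc T + replicate_mset (N - \<Sum>\<^sub># T - size T) 1"

lemma cycle_type_orbit_sizes:
  "cycle_type \<pi> = image_mset (\<lambda>k. k - 1) (filter_mset (\<lambda>k. 2 \<le> k) (orbit_sizes \<pi>))"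
  by (simp add: cycle_type_def orbit_sizes_def filter_mset_image_mset filter_mset_mset_set
      multiset.map_comp comp_def)

lemma orbit_sizes_ge_1: "k \<in># orbit_sizes \<pi> \<Longrightarrow> 1 \<le> k"
  using orbits_nonempty[of _ \<pi>] by (auto simp: orbit_sizes_def Suc_le_eq card_gt_0_iff)

lemma sum_orbit_sizes:
  assumes "bij (\<pi> :: 'i::finite \<Rightarrow> 'i)"
  shows "\<Sum>\<^sub># (orbit_sizes \<pi>) = CARD('i)"
  using sum_card_orbits[OF assms] by (simp add: orbit_sizes_def sum_unfold_sum_mset)

lemma orbit_sizes_cycle_type:
  "orbit_sizes \<pi> = image_mset Suc (cycle_type \<pi>) + replicate_mset (count (orbit_sizes \<pi>) 1) 1"
proof -
  let ?M = "orbit_sizes \<pi>"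
  have "?M = filter_mset (\<lambda>k. 2 \<le> k) ?M + filter_mset (\<lambda>k. \<not> 2 \<le> k) ?M"
    by (rule multiset_partition)
  also have "filter_mset (\<lambda>k. \<not> 2 \<le> k) ?M = filter_mset (\<lambda>k. k = 1) ?M"
    using orbit_sizes_ge_1[of _ \<pi>] by (intro filter_mset_cong) force+
  also have "\<dots> = replicate_mset (count ?M 1) 1" by (simp add: filter_eq_replicate_mset)
  also have "filter_mset (\<lambda>k. 2 \<le> k) ?M = image_mset Suc (cycle_type \<pi>)"
    unfolding cycle_type_orbit_sizes multiset.map_comp
    by (rule sym, rule trans[OF image_mset_cong[of _ _ id]]) auto
  finally show ?thesis .
qed

lemma sum_image_mset_Suc: "\<Sum>\<^sub># (image_mset Suc T) = \<Sum>\<^sub># T + size T"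
  by (induction T) auto

lemma
  assumes "bij (\<pi> :: 'i::finite \<Rightarrow> 'i)"
  shows rk_cycle_type: "\<Sum>\<^sub># (cycle_type \<pi>) = dim (displ \<pi>)"
    and size_cycle_type: "\<Sum>\<^sub># (cycle_type \<pi>) + size (cycle_type \<pi>) \<le> CARD('i)"
    and orbit_sizes_eq: "orbit_sizes \<pi> = block_sizes CARD('i) (cycle_type \<pi>)"
proof -
  let ?k = "count (orbit_sizes \<pi>) 1"
  have "\<Sum>\<^sub># (orbit_sizes \<pi>) = \<Sum>\<^sub># (image_mset Suc (cycle_type \<pi>)) + ?k"
    by (subst orbit_sizes_cycle_type) simp
  then have 1: "CARD('i) = \<Sum>\<^sub># (cycle_type \<pi>) + size (cycle_type \<pi>) + ?k"
    by (simp add: sum_orbit_sizes[OF assms] sum_image_mset_Suc)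
  have "card (orbits \<pi>) = size (image_mset Suc (cycle_type \<pi>)) + ?k"
    unfolding size_orbit_sizes[symmetric] by (subst orbit_sizes_cycle_type) simp
  then have 2: "card (orbits \<pi>) = size (cycle_type \<pi>) + ?k" by simp
  show "\<Sum>\<^sub># (cycle_type \<pi>) = dim (displ \<pi>)"
    using dim_displ[OF assms] 1 2 by simp
  show "\<Sum>\<^sub># (cycle_type \<pi>) + size (cycle_type \<pi>) \<le> CARD('i)" using 1 by simp
  have "CARD('i) - \<Sum>\<^sub># (cycle_type \<pi>) - size (cycle_type \<pi>) = ?k" using 1 by simp
  then show "orbit_sizes \<pi> = block_sizes CARD('i) (cycle_type \<pi>)"
    unfolding block_sizes_def using orbit_sizes_cycle_type by metis
qed

text \<open>An entry 0 in \<open>T\<close> would become a cycle of length 1 and be lost among the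
  fixed points, hence the condition on \<open>T\<close>.\<close>

lemma cycle_type_eq_iff:
  fixes \<pi> :: "'i::finite \<Rightarrow> 'i"
  assumes "bij \<pi>" "0 \<notin># T"
  shows "cycle_type \<pi> = T \<longleftrightarrow> orbit_sizes \<pi> = block_sizes CARD('i) T"
proof
  assume *: "orbit_sizes \<pi> = block_sizes CARD('i) T"
  have "2 \<le> k" if "k \<in># image_mset Suc T" for k
    using that assms(2) by (auto simp: Suc_le_eq intro: gr0I)
  then have "filter_mset (\<lambda>k. 2 \<le> k) (image_mset Suc T) = filter_mset (\<lambda>_. True) (image_mset Suc T)"
    by (intro filter_mset_cong) auto
  then have "filter_mset (\<lambda>k. 2 \<le> k) (image_mset Suc T) = image_mset Suc T" by simp
  moreover have "filter_mset (\<lambda>k. 2 \<le> k) (replicate_mset r (1 :: nat)) = {#}" for r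
    by (induction r) auto
  ultimately show "cycle_type \<pi> = T"
    unfolding cycle_type_orbit_sizes * block_sizes_def by (simp add: multiset.map_comp comp_def)
qed (use orbit_sizes_eq[OF assms(1)] in simp)

lemma dim_displ_comp_le:
  assumes "bij (\<pi> :: 'i::finite \<Rightarrow> 'i)" "bij \<tau>"
  shows "dim (displ (\<pi> \<circ> \<tau>)) \<le> dim (displ \<pi>) + dim (displ \<tau>)"
proof -
  let ?S = "displ \<pi> \<union> displ \<tau>"
  have "rt x (\<tau> x) \<in> span ?S" "rt (\<tau> x) (\<pi> (\<tau> x)) \<in> span ?S" for x
    by (auto simp: displ_def intro!: span_base)
  then have "displ (\<pi> \<circ> \<tau>) \<subseteq> span ?S"
    unfolding displ_def comp_apply by (blast intro: rt_span_trans)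
  then have "dim (displ (\<pi> \<circ> \<tau>)) \<le> dim ?S" by (metis dim_span dim_subset)
  also have "\<dots> \<le> dim (displ \<pi>) + dim (displ \<tau>)" by (rule dim_Un_le)
  finally show ?thesis .
qed

lemma dim_displ_comp_list_le:
  fixes ps :: "('i::finite \<Rightarrow> 'i) list"
  assumes "\<And>\<pi>. \<pi> \<in> set ps \<Longrightarrow> bij \<pi>"
  shows "dim (displ (comp_list ps)) \<le> (\<Sum>\<pi>\<leftarrow>ps. dim (displ \<pi>))"
  using assms
proof (induction ps)
  case Nil
  have "displ (comp_list ([] :: ('i \<Rightarrow> 'i) list)) \<subseteq> span {}"
    by (auto simp: displ_def)
  then have "dim (displ (comp_list ([] :: ('i \<Rightarrow> 'i) list))) \<le> card ({} :: (real ^ 'i) set)"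
    by (rule dim_le_card) simp
  then show ?case by (simp only: list.map sum_list.Nil card.empty)
next
  case (Cons \<pi> ps)
  have *: "dim (displ (\<pi> \<circ> comp_list ps)) \<le> dim (displ \<pi>) + dim (displ (comp_list ps))"
    using Cons.prems by (intro dim_displ_comp_le bij_comp_list) auto
  have "dim (displ (comp_list ps)) \<le> (\<Sum>\<pi>\<leftarrow>ps. dim (displ \<pi>))"
    using Cons by simp
  with * show ?case unfolding comp_list_Cons list.map sum_list.Cons by linarith
qed

text \<open>Subtracting 1 from every part reduces the count to lists of arbitrary natural
  numbers.\<close>

lemma card_compositions:
  assumes "1 \<le> k" "k \<le> N"
  shows "card {q :: nat list. length q = k \<and> sum_list q = N \<and> (\<forall>x\<in>set q. 1 \<le> x)} = (N - 1) choose (k - 1)"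
proof -
  let ?C = "{q :: nat list. length q = k \<and> sum_list q = N \<and> (\<forall>x\<in>set q. 1 \<le> x)}"
  let ?D = "{q :: nat list. length q = k \<and> sum_list q = N - k}"
  have sum_Suc: "sum_list (map Suc q) = sum_list q + length q" for q by (induction q) auto
  have "bij_betw (map Suc) ?D ?C"
  proof (rule bij_betw_byWitness[where f' = "map (\<lambda>x. x - 1)"])
    have pred: "map Suc (map (\<lambda>x. x - 1) q) = q" if "\<forall>x\<in>set q. 1 \<le> x" for q
      using that by (induction q) auto
    then show "\<forall>q\<in>?C. map Suc (map (\<lambda>x. x - 1) q) = q" by blast
    show "map (\<lambda>x. x - 1) ` ?C \<subseteq> ?D"
    proof
      fix q' assume "q' \<in> map (\<lambda>x. x - 1) ` ?C"
      then obtain q where q: "q \<in> ?C" "q' = map (\<lambda>x. x - 1) q" by blast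
      then show "q' \<in> ?D" using sum_Suc[of q'] pred[of q] by auto
    qed
  qed (use assms in \<open>auto simp: sum_Suc comp_def\<close>)
  then have "card ?C = card ?D" by (simp add: bij_betw_same_card)
  also have "\<dots> = (N - 1) choose (N - k)" using card_length_sum_list[of k "N - k"] assms by simp
  also have "\<dots> = (N - 1) choose (k - 1)" using assms by (subst binomial_symmetric) auto
  finally show ?thesis .
qed

text \<open>The length j + 1 occurs \<open>m j\<close> times, and the length 1 accounts for the
  leftover term of the multinomial coefficient, whose upper entry is the number of cycles, N minus
  the rank.\<close>

lemma card_permutations_block_sizes:
  assumes T: "T = (\<Sum>j=1..n. replicate_mset (m j) j)" and le: "\<Sum>\<^sub># T + size T \<le> N"
  shows "real (card (permutations_of_multiset (block_sizes N T))) = multinomial (N - \<Sum>\<^sub># T) n m"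
proof -
  let ?M = "block_sizes N T"
  have size_T: "size T = (\<Sum>j=1..n. m j)" unfolding T by (simp add: size_multiset_sum)
  have count_T: "count T j = (if j \<in> {1..n} then m j else 0)" for j
    unfolding T by (simp add: count_sum if_distrib cong: if_cong)
  have count_Suc: "count (image_mset Suc T) (Suc j) = count T j" for j
    by (induction T) auto
  have cM: "count ?M (Suc j) = m j" if "j \<in> {1..n}" for j
    using that by (simp add: block_sizes_def count_Suc count_T)
  have cM1: "count ?M 1 = N - \<Sum>\<^sub># T - size T"
    using count_Suc[of 0] by (simp add: block_sizes_def count_T)
  have sub: "set_mset ?M \<subseteq> {1..n + 1}"
  proof
    fix x assume "x \<in># ?M"
    then have "x = 1 \<or> (\<exists>j\<in>#T. x = Suc j)" by (auto simp: block_sizes_def split: if_splits)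
    moreover have "j \<in> {1..n}" if "j \<in># T" for j using that count_T[of j] by (auto simp: count_eq_zero_iff split: if_splits)
    ultimately show "x \<in> {1..n + 1}" by auto
  qed
  have "(\<Prod>x\<in>set_mset ?M. fact (count ?M x) :: nat) = (\<Prod>x\<in>{1..n + 1}. fact (count ?M x))"
    using sub by (intro prod.mono_neutral_left) (auto simp: not_in_iff)
  also have "{1..n + 1} = insert 1 (Suc ` {1..n})" by (auto simp: image_Suc_atLeastAtMost)
  also have "(\<Prod>x\<in>\<dots>. fact (count ?M x) :: nat) = fact (count ?M 1) * (\<Prod>j=1..n. fact (count ?M (Suc j)))"
    by (subst prod.insert) (auto simp del: image_Suc_atLeastAtMost simp: prod.reindex)
  also have "(\<Prod>j=1..n. fact (count ?M (Suc j)) :: nat) = (\<Prod>j=1..n. fact (m j))"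
    using cM by (intro prod.cong) auto
  finally have P: "(\<Prod>x\<in>set_mset ?M. fact (count ?M x) :: nat) =
      fact (N - \<Sum>\<^sub># T - size T) * (\<Prod>j=1..n. fact (m j))" using cM1 by simp
  have size_M: "size ?M = N - \<Sum>\<^sub># T" using le by (simp add: block_sizes_def)
  have "card (permutations_of_multiset ?M) * (fact (N - \<Sum>\<^sub># T - size T) * (\<Prod>j=1..n. fact (m j))) = fact (N - \<Sum>\<^sub># T)"
    using card_permutations_of_multiset_aux[of ?M] unfolding P size_M .
  from arg_cong[OF this, of real]
  have "real (card (permutations_of_multiset ?M)) *
      (fact (N - \<Sum>\<^sub># T - size T) * (\<Prod>j=1..n. fact (m j))) = fact (N - \<Sum>\<^sub># T)"
    by (simp only: of_nat_mult of_nat_prod of_nat_fact)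
  moreover have "(\<Prod>j=1..n. fact (m j) :: real) \<noteq> 0" by simp
  ultimately have "real (card (permutations_of_multiset ?M)) =
      fact (N - \<Sum>\<^sub># T) / ((\<Prod>j=1..n. fact (m j)) * fact (N - \<Sum>\<^sub># T - size T))"
    by (simp only: eq_divide_eq) (simp add: mult.commute)
  then show ?thesis
    using le unfolding multinomial_def size_T[symmetric] by simp
qed

text \<open>Index \<open>d\<close> holds the complement of the product in \<gamma>, of free type.
  The single rank equation replaces both length conditions of
  \<open>decomposition_number\<close>.\<close>

definition min_factors ::
    "nat \<Rightarrow> (nat \<Rightarrow> nat multiset) \<Rightarrow> ('i::finite \<Rightarrow> 'i) \<Rightarrow> (nat \<Rightarrow> 'i \<Rightarrow> 'i) set" where
  "min_factors d T \<gamma> =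
     {\<pi> \<in> PiE {..<Suc d} (\<lambda>_. {\<rho>. bij \<rho>}).
        (\<forall>i<d. cycle_type (\<pi> i) = T i) \<and>
        (\<Sum>i<d. \<Sum>\<^sub># (T i)) + dim (displ (\<pi> d)) = CARD('i) - 1 \<and>
        comp_list (map \<pi> [0..<d]) \<circ> \<pi> d = \<gamma>}"

lemma orbits_cyclic_perm: "\<gamma> \<in> cyclic_perms (UNIV :: 'i::finite set) \<Longrightarrow> orbits \<gamma> = {UNIV}"
  by (auto simp: bij_cyclic_UNIV_iff orbits_def)

text \<open>Ranks are subadditive under composition. Therefore the lengths of the factors add up and
  the product lies below \<gamma> iff the ranks, including that of the complement, add up to the
  rank of \<gamma>. Nonempty types exclude the identity, whose type is empty.\<close>

lemma decomposition_number_eq_card: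
  fixes \<gamma> :: "'i::finite \<Rightarrow> 'i"
  assumes \<gamma>: "\<gamma> \<in> cyclic_perms UNIV" and T: "\<And>i. i < d \<Longrightarrow> T i \<noteq> {#}"
  shows "decomposition_number roots_A (perm_act \<gamma>) (map T [0..<d]) = card (min_factors d T \<gamma>)"
proof -
  let ?Y = "min_factors d T \<gamma>"
  let ?Ts = "map T [0..<d]"
  let ?X = "{cs. length cs = length ?Ts \<and> set cs \<subseteq> reflection_group roots_A - {id} \<and>
               abs_le roots_A (comp_list cs) (perm_act \<gamma>) \<and>
               sum_list (map (abs_length roots_A) cs) = abs_length roots_A (comp_list cs) \<and>
               (\<forall>i<length ?Ts. element_has_type roots_A (cs ! i) (?Ts ! i))}"
  let ?f = "\<lambda>\<pi>. map (\<lambda>i. perm_act (\<pi> i)) [0..<d]"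
  let ?s = "\<Sum>i<d. \<Sum>\<^sub># (T i)"
  have bij\<gamma>: "bij \<gamma>" using \<gamma> by (simp add: bij_cyclic_UNIV_iff)
  have dim\<gamma>: "dim (displ \<gamma>) = CARD('i) - 1"
    using dim_displ[OF bij\<gamma>] orbits_cyclic_perm[OF \<gamma>] by simp
  have id_type: "cycle_type (id :: 'i \<Rightarrow> 'i) = {#}"
  proof -
    have "orbit (id :: 'i \<Rightarrow> 'i) x = {x}" for x by (simp add: orbit_eq_singleton_iff)
    then have *: "{B \<in> orbits (id :: 'i \<Rightarrow> 'i). 2 \<le> card B} = {}" by (auto simp: orbits_def)
    show ?thesis unfolding cycle_type_def * by simp
  qed
  have quotient: "inv (perm_act w) \<circ> perm_act \<gamma> = perm_act (inv w \<circ> \<gamma>)" if "bij w" for w :: "'i \<Rightarrow> 'i"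
    using that bij\<gamma> by (simp add: inv_perm_act perm_act_comp bij_imp_bij_inv)
  have prod: "comp_list (?f \<pi>) = perm_act (comp_list (map \<pi> [0..<d]))" if "\<And>i. i < d \<Longrightarrow> bij (\<pi> i)"
    for \<pi> :: "nat \<Rightarrow> 'i \<Rightarrow> 'i"
  proof -
    have "bij f" if "f \<in> set (map \<pi> [0..<d])" for f
      using that \<open>\<And>i. i < d \<Longrightarrow> bij (\<pi> i)\<close> by auto
    from comp_list_perm_act[of "map \<pi> [0..<d]", OF this] show ?thesis by (simp add: comp_def)
  qed
  have lengths: "sum_list (map (abs_length roots_A) (?f \<pi>)) = ?s"
    if "\<And>i. i < d \<Longrightarrow> bij (\<pi> i)" "\<And>i. i < d \<Longrightarrow> cycle_type (\<pi> i) = T i" for \<pi> :: "nat \<Rightarrow> 'i \<Rightarrow> 'i"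
  proof -
    have "abs_length roots_A (perm_act (\<pi> i)) = \<Sum>\<^sub># (T i)" if "i < d" for i
      using abs_length_perm_act rk_cycle_type \<open>\<And>i. i < d \<Longrightarrow> bij (\<pi> i)\<close>[OF that]
        \<open>\<And>i. i < d \<Longrightarrow> cycle_type (\<pi> i) = T i\<close>[OF that] by metis
    then show ?thesis by (simp add: comp_def interv_sum_list_conv_sum_set_nat lessThan_atLeast0)
  qed
  have image: "?f ` ?Y = ?X"
  proof (intro equalityI subsetI)
    fix cs assume "cs \<in> ?f ` ?Y"
    then obtain \<pi> where \<pi>: "\<pi> \<in> ?Y" and cs: "cs = ?f \<pi>" by blast
    have bij: "bij (\<pi> i)" if "i \<le> d" for i
      using \<pi> that PiE_mem[of \<pi> "{..<Suc d}" "\<lambda>_. {\<rho>. bij \<rho>}" i] by (auto simp: min_factors_def)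
    have type: "cycle_type (\<pi> i) = T i" if "i < d" for i using \<pi> that by (simp add: min_factors_def)
    have rest: "?s + dim (displ (\<pi> d)) = CARD('i) - 1" using \<pi> by (simp add: min_factors_def)
    define w where "w = comp_list (map \<pi> [0..<d])"
    have bw: "bij w" unfolding w_def using bij by (intro bij_comp_list) auto
    have w\<gamma>: "w \<circ> \<pi> d = \<gamma>" using \<pi> by (simp add: min_factors_def w_def)
    have "inv w \<circ> \<gamma> = \<pi> d" unfolding w\<gamma>[symmetric] using bw by (simp add: comp_assoc[symmetric] bij_is_inj)
    have prod_w: "comp_list cs = perm_act w" unfolding cs w_def by (rule prod) (simp add: bij)
    have "dim (displ (\<pi> i)) = \<Sum>\<^sub># (T i)" if "i < d" for i
      using rk_cycle_type[OF bij[of i]] type[OF that] that by simp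
    then have "(\<Sum>\<rho>\<leftarrow>map \<pi> [0..<d]. dim (displ \<rho>)) = ?s"
      by (simp add: comp_def interv_sum_list_conv_sum_set_nat lessThan_atLeast0)
    moreover have "bij \<rho>" if "\<rho> \<in> set (map \<pi> [0..<d])" for \<rho> using that bij by auto
    ultimately have "dim (displ w) \<le> ?s"
      unfolding w_def by (metis dim_displ_comp_list_le)
    moreover have "dim (displ \<gamma>) \<le> dim (displ w) + dim (displ (\<pi> d))"
      unfolding w\<gamma>[symmetric] using bw bij by (intro dim_displ_comp_le) auto
    \<comment> \<open>The rank of \<open>w\<close> is at most \<open>?s\<close>, and at least
      \<open>?s\<close> because \<open>w\<close> and the complement together must produce the rank
      of \<gamma>.\<close>
    ultimately have dimw: "dim (displ w) = ?s" using rest dim\<gamma> by linarith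
    have "abs_le roots_A (comp_list cs) (perm_act \<gamma>)"
      unfolding abs_le_def prod_w quotient[OF bw] \<open>inv w \<circ> \<gamma> = \<pi> d\<close>
      using dimw rest dim\<gamma> by (simp add: abs_length_perm_act bw bij\<gamma> bij)
    moreover have "sum_list (map (abs_length roots_A) cs) = abs_length roots_A (comp_list cs)"
      unfolding prod_w abs_length_perm_act[OF bw] dimw unfolding cs by (rule lengths) (simp_all add: bij type)
    moreover have "perm_act (\<pi> i) \<in> reflection_group roots_A - {id}" if "i < d" for i
    proof -
      have "\<pi> i \<noteq> id" using type[OF that] id_type T[OF that] by auto
      then have "perm_act (\<pi> i) \<noteq> perm_act id" using perm_act_inject[OF bij, of i id] that by simp
      then show ?thesis using bij[of i] that by (simp add: reflection_group_roots_A)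
    qed
    moreover have "element_has_type roots_A (perm_act (\<pi> i)) (T i)" if "i < d" for i
      using element_has_type_iff[OF bij[of i]] type[OF that] that by simp
    ultimately show "cs \<in> ?X" unfolding cs by auto
  next
    fix cs assume "cs \<in> ?X"
    then have len: "length cs = d" and grp: "set cs \<subseteq> reflection_group roots_A"
      and le: "abs_le roots_A (comp_list cs) (perm_act \<gamma>)"
      and add: "sum_list (map (abs_length roots_A) cs) = abs_length roots_A (comp_list cs)"
      and type: "\<And>i. i < d \<Longrightarrow> element_has_type roots_A (cs ! i) (T i)" by auto
    have "\<exists>\<rho>. bij \<rho> \<and> cs ! i = perm_act \<rho>" if "i < d" for i
      using grp len that unfolding reflection_group_roots_A by (force simp: set_conv_nth)
    then obtain r where r: "\<And>i. i < d \<Longrightarrow> bij (r i) \<and> cs ! i = perm_act (r i)" by metis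
    define w where "w = comp_list (map r [0..<d])"
    \<comment> \<open>The complement is determined by the other factors; \<open>undefined\<close>
      makes \<pi> extensional.\<close>
    define \<pi> where "\<pi> = (\<lambda>i. if i < d then r i else if i = d then inv w \<circ> \<gamma> else undefined)"
    have bw: "bij w" unfolding w_def using r by (intro bij_comp_list) auto
    have cs: "cs = ?f \<pi>" using len r by (intro nth_equalityI) (auto simp: \<pi>_def)
    have map_eq: "map \<pi> [0..<d] = map r [0..<d]" by (simp add: \<pi>_def)
    have bd: "bij (inv w \<circ> \<gamma>)" using bij\<gamma> bw by (simp add: bij_comp bij_imp_bij_inv)
    have bij: "bij (\<pi> i)" if "i \<le> d" for i
    proof (cases "i < d")
      case True
      then show ?thesis using r by (simp add: \<pi>_def)
    next
      case False
      then have "\<pi> i = inv w \<circ> \<gamma>" using that by (simp add: \<pi>_def)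
      then show ?thesis using bd by simp
    qed
    have ctype: "cycle_type (\<pi> i) = T i" if "i < d" for i
      using type[OF that] r[OF that] that element_has_type_iff[of "r i" "T i"] by (simp add: \<pi>_def)
    have prod_w: "comp_list cs = perm_act w"
      unfolding cs w_def map_eq[symmetric] by (rule prod) (simp add: bij)
    have \<pi>d: "\<pi> d = inv w \<circ> \<gamma>" by (simp add: \<pi>_def)
    have "?s = dim (displ w)"
      using add lengths[of \<pi>] bij ctype unfolding prod_w abs_length_perm_act[OF bw] cs[symmetric] by simp
    moreover have "dim (displ \<gamma>) = dim (displ w) + dim (displ (\<pi> d))"
      using le unfolding abs_le_def prod_w quotient[OF bw] \<pi>d
      by (simp only: abs_length_perm_act bw bij\<gamma> bd)
    ultimately have "?s + dim (displ (\<pi> d)) = CARD('i) - 1" using dim\<gamma> by simp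
    moreover have "comp_list (map \<pi> [0..<d]) \<circ> \<pi> d = \<gamma>"
    proof -
      have "w \<circ> inv w = id" using bw by (simp add: bij_is_surj flip: surj_iff)
      then show ?thesis unfolding map_eq w_def[symmetric] \<pi>d by (simp add: comp_assoc[symmetric])
    qed
    moreover have "\<pi> \<in> PiE {..<Suc d} (\<lambda>_. {\<rho>. bij \<rho>})"
      using bij by (auto simp: PiE_def extensional_def \<pi>_def less_Suc_eq_le)
    ultimately have "\<pi> \<in> ?Y" using ctype by (simp add: min_factors_def)
    then show "cs \<in> ?f ` ?Y" using cs by blast
  qed
  have "inj_on ?f ?Y"
  proof (rule inj_onI)
    fix \<pi> \<tau> assume h: "\<pi> \<in> ?Y" "\<tau> \<in> ?Y" "?f \<pi> = ?f \<tau>"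
    then have P: "\<pi> \<in> PiE {..<Suc d} (\<lambda>_. {\<rho>. bij \<rho>})" "\<tau> \<in> PiE {..<Suc d} (\<lambda>_. {\<rho>. bij \<rho>})"
      by (auto simp: min_factors_def)
    have bij: "bij (\<pi> i)" "bij (\<tau> i)" if "i \<le> d" for i using PiE_mem[OF P(1), of i] PiE_mem[OF P(2), of i] that by auto
    have eq: "\<pi> i = \<tau> i" if "i < d" for i
    proof -
      have "perm_act (\<pi> i) = perm_act (\<tau> i)" using arg_cong[OF h(3), of "\<lambda>xs. xs ! i"] that by simp
      then show ?thesis using perm_act_inject bij that by (metis less_imp_le)
    qed
    then have m: "map \<pi> [0..<d] = map \<tau> [0..<d]" by simp
    let ?w = "comp_list (map \<pi> [0..<d])"
    have "inj ?w" using bij by (intro bij_is_inj bij_comp_list) auto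
    have "?w \<circ> \<pi> d = \<gamma>" "comp_list (map \<tau> [0..<d]) \<circ> \<tau> d = \<gamma>"
      using h(1,2) unfolding min_factors_def by blast+
    then have w_eq: "?w \<circ> \<pi> d = ?w \<circ> \<tau> d" unfolding m by (rule trans[OF _ sym])
    have "\<pi> d = \<tau> d"
    proof
      fix x
      show "\<pi> d x = \<tau> d x" using fun_cong[OF w_eq, of x] \<open>inj ?w\<close> by (simp add: inj_eq)
    qed
    show "\<pi> = \<tau>"
    proof (rule PiE_ext[OF P])
      fix i assume "i \<in> {..<Suc d}"
      then show "\<pi> i = \<tau> i" using eq \<open>\<pi> d = \<tau> d\<close> by (cases "i = d") auto
    qed
  qed
  then have "card ?X = card ?Y" unfolding image[symmetric] by (rule card_image)
  then show ?thesis by (simp only: decomposition_number_def)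
qed

text \<open>An instance of \<open>orbit_data\<close> with d + 1 factors, whence the exponent d = (d
  + 1) - 1. The ranks of the first d sum to s, so the last has rank N - 1 - s and thus s + 1
  cycles.\<close>

lemma card_min_factors:
  fixes \<gamma> :: "'i::finite \<Rightarrow> 'i"
  defines "N \<equiv> CARD('i)"
  assumes \<gamma>: "\<gamma> \<in> cyclic_perms UNIV" and T: "\<And>i. i < d \<Longrightarrow> T i \<noteq> {#}" "\<And>i. i < d \<Longrightarrow> 0 \<notin># T i"
    and le: "\<And>i. i < d \<Longrightarrow> \<Sum>\<^sub># (T i) + size (T i) \<le> N"
    and s: "(\<Sum>i<d. \<Sum>\<^sub># (T i)) + 1 \<le> N"
  shows "card (min_factors d T \<gamma>) * ((\<Prod>i<d. N - \<Sum>\<^sub># (T i)) * ((\<Sum>i<d. \<Sum>\<^sub># (T i)) + 1)) =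
     (\<Prod>i<d. card (permutations_of_multiset (block_sizes N (T i)))) *
     ((N - 1) choose (\<Sum>i<d. \<Sum>\<^sub># (T i))) * N ^ d"
proof -
  let ?s = "\<Sum>i<d. \<Sum>\<^sub># (T i)"
  let ?C = "{q :: nat list. length q = ?s + 1 \<and> sum_list q = N \<and> (\<forall>x\<in>set q. 1 \<le> x)}"
  define l where "l = (\<lambda>i. if i < d then N - \<Sum>\<^sub># (T i) else ?s + 1)"
  define Q where "Q = (\<lambda>i. if i < d then permutations_of_multiset (block_sizes N (T i)) else ?C)"
  have size_pos: "1 \<le> size (T i)" if "i < d" for i using T(1)[OF that] by (simp add: Suc_le_eq nonempty_has_size)
  have finite_C: "finite ?C"
  proof (rule finite_subset)
    show "?C \<subseteq> {q. set q \<subseteq> {..N} \<and> length q = ?s + 1}" using member_le_sum_list by fastforce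
  qed (simp add: finite_lists_length_eq)
  have card_C: "card ?C = (N - 1) choose ?s" using card_compositions[of "?s + 1" N] s by simp
  interpret orbit_data "Suc d" l Q "TYPE('i)"
  proof
    fix i assume i: "i < Suc d"
    show "1 \<le> l i"
    proof (cases "i < d")
      case True
      then show ?thesis using le[OF True] size_pos[OF True] by (simp add: l_def)
    qed (simp add: l_def)
    show "finite (Q i)" using finite_C by (simp add: Q_def)
    fix q assume q: "q \<in> Q i"
    have mq: "mset q = block_sizes N (T i)" if "i < d" using q that by (simp add: Q_def permutations_of_multiset_def)
    have "length q = l i \<and> sum_list q = N \<and> (\<forall>x\<in>set q. 1 \<le> x)"
    proof (cases "i < d")
      case True
      have "length q = l i"
        using arg_cong[OF mq[OF True], of size] le[OF True] True by (simp add: block_sizes_def l_def)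
      moreover have "sum_list q = N"
        using arg_cong[OF mq[OF True], of sum_mset] le[OF True]
        by (simp add: block_sizes_def sum_image_mset_Suc sum_mset_sum_list)
      moreover have "\<forall>x\<in>set q. 1 \<le> x"
      proof
        fix x assume "x \<in> set q"
        then have "x \<in># block_sizes N (T i)" using mq[OF True] by (metis set_mset_mset)
        then show "1 \<le> x" by (auto simp: block_sizes_def split: if_splits)
      qed
      ultimately show ?thesis by blast
    next
      case False
      then show ?thesis using q by (simp add: Q_def l_def)
    qed
    then show "length q = l i" "sum_list q = CARD('i)" "\<And>x. x \<in> set q \<Longrightarrow> 1 \<le> x" by (auto simp: N_def)
    fix q' assume m: "mset q' = mset q"
    show "q' \<in> Q i"
    proof (cases "i < d")
      case True
      then show ?thesis using q m by (simp add: Q_def permutations_of_multiset_def)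
    next
      case False
      have "length q' = length q" "sum_list q' = sum_list q" "set q' = set q"
        using m by (metis size_mset, metis sum_mset_sum_list, metis set_mset_mset)
      then show ?thesis using q False by (simp add: Q_def)
    qed
  next
    have "N - l i = \<Sum>\<^sub># (T i)" if "i < d" for i using le[OF that] that by (simp add: l_def)
    then have "(\<Sum>i<Suc d. N - l i) = ?s + (N - (?s + 1))" by (simp add: l_def)
    then show "(\<Sum>i<Suc d. CARD('i) - l i) = CARD('i) - 1" using s by (simp add: N_def)
  qed simp
  have perms_lt: "perms i = {\<pi>. bij \<pi> \<and> cycle_type \<pi> = T i}" if "i < d" for i
  proof -
    have "block_sizes N (T i) \<in> mset ` permutations_of_multiset (block_sizes N (T i))"
      by (metis ex_mset imageI permutations_of_multisetI)
    then have "orbit_sizes \<pi> \<in> mset ` Q i \<longleftrightarrow> orbit_sizes \<pi> = block_sizes N (T i)" for \<pi> :: "'i \<Rightarrow> 'i"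
      using that by (auto simp: Q_def permutations_of_multiset_def)
    then show ?thesis
      using cycle_type_eq_iff[OF _ T(2)[OF that]] by (auto simp: perms_def N_def)
  qed
  have perms_d: "perms d = {\<pi>. bij \<pi> \<and> ?s + dim (displ \<pi>) = N - 1}"
  proof -
    have "orbit_sizes \<pi> \<in> mset ` Q d \<longleftrightarrow> ?s + dim (displ \<pi>) = N - 1" if b: "bij \<pi>" for \<pi> :: "'i \<Rightarrow> 'i"
    proof -
      have "?s + dim (displ \<pi>) = N - 1 \<longleftrightarrow> size (orbit_sizes \<pi>) = ?s + 1"
        using dim_displ[OF b] s by (auto simp: N_def size_orbit_sizes)
      also have "\<dots> \<longleftrightarrow> orbit_sizes \<pi> \<in> mset ` Q d"
      proof
        assume sz: "size (orbit_sizes \<pi>) = ?s + 1"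
        obtain q where q: "mset q = orbit_sizes \<pi>" using ex_mset by blast
        have "length q = ?s + 1" using q sz by (metis size_mset)
        moreover have "sum_list q = N"
          using sum_orbit_sizes[OF b] q by (metis N_def sum_mset_sum_list)
        moreover have "\<forall>x\<in>set q. 1 \<le> x" using orbit_sizes_ge_1[of _ \<pi>] q by (metis set_mset_mset)
        ultimately have "q \<in> Q d" by (simp add: Q_def)
        then show "orbit_sizes \<pi> \<in> mset ` Q d" using q by (metis imageI)
      next
        assume "orbit_sizes \<pi> \<in> mset ` Q d"
        then obtain q where "q \<in> Q d" "orbit_sizes \<pi> = mset q" by blast
        then show "size (orbit_sizes \<pi>) = ?s + 1" by (simp add: Q_def)
      qed
      finally show ?thesis by blast
    qed
    then show ?thesis by (auto simp: perms_def)
  qed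
  have "factorisations \<gamma> = min_factors d T \<gamma>"
  proof (rule set_eqI)
    fix \<pi> :: "nat \<Rightarrow> 'i \<Rightarrow> 'i"
    have "\<pi> \<in> PiE {..<Suc d} perms \<longleftrightarrow> \<pi> \<in> PiE {..<Suc d} (\<lambda>_. {\<rho>. bij \<rho>}) \<and>
        (\<forall>i<d. cycle_type (\<pi> i) = T i) \<and> ?s + dim (displ (\<pi> d)) = N - 1"
      by (auto simp: PiE_iff lessThan_Suc perms_lt perms_d)
    moreover have "comp_list (map \<pi> [0..<Suc d]) = comp_list (map \<pi> [0..<d]) \<circ> \<pi> d"
      by (simp add: comp_list_append)
    ultimately show "\<pi> \<in> factorisations \<gamma> \<longleftrightarrow> \<pi> \<in> min_factors d T \<gamma>"
      unfolding factorisations_def min_factors_def N_def by auto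
  qed
  moreover have "(\<Prod>i<Suc d. l i) = (\<Prod>i<d. N - \<Sum>\<^sub># (T i)) * (?s + 1)" by (simp add: l_def)
  moreover have "(\<Prod>i<Suc d. card (Q i)) =
      (\<Prod>i<d. card (permutations_of_multiset (block_sizes N (T i)))) * ((N - 1) choose ?s)"
    using card_C by (simp add: Q_def)
  ultimately show ?thesis using card_factorisations[OF \<gamma>] by (simp add: N_def)
qed

theorem theorem10:
  fixes n d :: nat
    and c :: "real ^ 'i \<Rightarrow> real ^ 'i"
    and m :: "nat \<Rightarrow> nat \<Rightarrow> nat"
    and T :: "nat \<Rightarrow> A_type"
  assumes "n \<ge> 1" and "d \<ge> 1"
    and "CARD('i) = n + 1"
    and "coxeter_element (roots_A :: (real ^ 'i) set) c"
    and "\<And>i. i \<in> {1..d} \<Longrightarrow> T i = (\<Sum>j=1..n. replicate_mset (m i j) j)"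
    and "\<And>i. i \<in> {1..d} \<Longrightarrow> T i \<noteq> {#}"
  shows "real (decomposition_number roots_A c (map T [1..<d + 1])) =
           real (n + 1) ^ (d - 1) *
           real ((n + 1) choose ((\<Sum>i=1..d. rk (T i)) + 1)) *
           (\<Prod>i=1..d. 1 / (real n - real (rk (T i)) + 1) *
                        multinomial (n + 1 - rk (T i)) n (m i))"
proof -
  obtain \<gamma> where \<gamma>: "\<gamma> \<in> cyclic_perms UNIV" and c: "c = perm_act \<gamma>"
    using coxeter_element_full_cycle[OF assms(4)] by (metis bij_cyclic_UNIV_iff)
  define T' where "T' = (\<lambda>i. T (Suc i))"
  have T': "T' i = (\<Sum>j=1..n. replicate_mset (m (Suc i) j) j)" "T' i \<noteq> {#}" if "i < d" for i
    using that assms(5,6)[of "Suc i"] by (auto simp: T'_def)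
  have size_T': "size (T' i) = (\<Sum>j=1..n. m (Suc i) j)" if "i < d" for i
    unfolding T'(1)[OF that] by (simp add: size_multiset_sum)
  have zero: "0 \<notin># T' i" if "i < d" for i
    unfolding T'(1)[OF that] by (auto simp: set_mset_sum split: if_splits)
  define s where "s = (\<Sum>i<d. rk (T' i))"
  have s_eq: "(\<Sum>i=1..d. rk (T i)) = s"
    unfolding s_def T'_def by (simp add: sum.atLeast1_atMost_eq)
  let ?P = "\<lambda>i. 1 / (real n - real (rk (T' i)) + 1) * multinomial (n + 1 - rk (T' i)) n (m (Suc i))"
  have prod_eq: "(\<Prod>i=1..d. 1 / (real n - real (rk (T i)) + 1) * multinomial (n + 1 - rk (T i)) n (m i)) =
      (\<Prod>i<d. ?P i)"
    unfolding T'_def by (simp add: prod.atLeast1_atMost_eq)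
  have "map T [1..<d + 1] = map T (map Suc [0..<d])" unfolding map_Suc_upt by (simp del: upt_Suc)
  then have "map T [1..<d + 1] = map T' [0..<d]" by (simp add: T'_def del: upt_Suc)
  then have card: "decomposition_number roots_A c (map T [1..<d + 1]) = card (min_factors d T' \<gamma>)"
    unfolding c using decomposition_number_eq_card[OF \<gamma>] T'(2) by simp
  show ?thesis
  \<comment> \<open>In the second case both sides vanish: a type does not fit on n + 1 points, or
    the ranks add up to more than n.\<close>
  proof (cases "(\<forall>i<d. rk (T' i) + size (T' i) \<le> n + 1) \<and> s \<le> n")
    case True
    let ?L = "\<Prod>i<d. n + 1 - rk (T' i)"
    let ?M = "\<Prod>i<d. multinomial (n + 1 - rk (T' i)) n (m (Suc i))"
    have "card (min_factors d T' \<gamma>) * (?L * (s + 1)) =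
        (\<Prod>i<d. card (permutations_of_multiset (block_sizes (n + 1) (T' i)))) * (n choose s) * (n + 1) ^ d"
      using card_min_factors[OF \<gamma> T'(2) zero] True unfolding s_def assms(3) by simp
    from arg_cong[OF this, of real]
    have eq: "real (card (min_factors d T' \<gamma>)) * (real ?L * real (s + 1)) =
        ?M * real (n choose s) * real (n + 1) ^ d"
      using card_permutations_block_sizes[OF T'(1)] True by (simp only: of_nat_mult of_nat_prod of_nat_power) simp
    have L: "real ?L = (\<Prod>i<d. real n - real (rk (T' i)) + 1)"
      unfolding of_nat_prod using True by (intro prod.cong) (auto simp: of_nat_diff)
    have pos: "real n - real (rk (T' i)) + 1 \<noteq> 0" if "i < d" for i
    proof -
      have "rk (T' i) + size (T' i) \<le> n + 1" "size (T' i) > 0"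
        using True that T'(2)[OF that] by (auto simp: nonempty_has_size)
      then show ?thesis by linarith
    qed
    then have L0: "real ?L \<noteq> 0" unfolding L by simp
    have "(\<Prod>i<d. ?P i) = ?M / real ?L" unfolding L by (simp add: prod_dividef)
    then have M: "?M = (\<Prod>i<d. ?P i) * real ?L" using L0 by simp
    have N: "real (n + 1) ^ d = real (n + 1) ^ (d - 1) * real (n + 1)"
      using assms(2) by (cases d) simp_all
    \<comment> \<open>One of the d powers of n + 1 is spent on changing binomial(n, s) / (s + 1)
      into binomial(n + 1, s + 1); d - 1 of them remain.\<close>
    have B: "real (n + 1) * real (n choose s) = real (s + 1) * real ((n + 1) choose (s + 1))"
      using Suc_times_binomial[of s n] by (simp only: of_nat_mult[symmetric] Suc_eq_plus1)
    have "?M * real (n choose s) * real (n + 1) ^ d =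
        ?M * real (n + 1) ^ (d - 1) * (real (n + 1) * real (n choose s))"
      unfolding N by (simp only: ac_simps)
    then have "real (card (min_factors d T' \<gamma>)) * (real ?L * real (s + 1)) =
        real (n + 1) ^ (d - 1) * real ((n + 1) choose (s + 1)) * (\<Prod>i<d. ?P i) * (real ?L * real (s + 1))"
      unfolding eq B M by (simp only: ac_simps)
    moreover have "real ?L * real (s + 1) \<noteq> 0" using L0 by simp
    ultimately have "real (card (min_factors d T' \<gamma>)) =
        real (n + 1) ^ (d - 1) * real ((n + 1) choose (s + 1)) * (\<Prod>i<d. ?P i)"
      using mult_right_cancel by blast
    then show ?thesis unfolding card s_eq prod_eq .
  next
    case False
    have "min_factors d T' \<gamma> = {}"
    proof (rule ccontr)
      assume "min_factors d T' \<gamma> \<noteq> {}"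
      then obtain \<pi> where \<pi>: "\<pi> \<in> min_factors d T' \<gamma>" by blast
      have "rk (T' i) + size (T' i) \<le> n + 1" if "i < d" for i
      proof -
        have "bij (\<pi> i)" "cycle_type (\<pi> i) = T' i"
          using \<pi> that PiE_mem[of \<pi> "{..<Suc d}" "\<lambda>_. {\<rho>. bij \<rho>}" i] by (auto simp: min_factors_def)
        then show ?thesis using size_cycle_type[of "\<pi> i"] assms(3) by simp
      qed
      moreover have "s \<le> n" using \<pi> assms(3) by (simp add: min_factors_def s_def)
      ultimately show False using False by blast
    qed
    \<comment> \<open>Ranks that are too large kill the binomial coefficient. A type that does not
      fit has more components than there are cycles, which kills its multinomial
      coefficient.\<close>
    moreover have "real ((n + 1) choose (s + 1)) * (\<Prod>i<d. ?P i) = 0"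
    proof (cases "s \<le> n")
      case True
      then obtain i where i: "i < d" "n + 1 < rk (T' i) + size (T' i)" using False by fastforce
      then have "\<not> (\<Sum>j=1..n. m (Suc i) j) \<le> n + 1 - rk (T' i)"
        using size_T'[OF i(1)] T'(2)[OF i(1)] nonempty_has_size[of "T' i"] by linarith
      then have "?P i = 0" by (simp add: multinomial_def)
      then have "(\<Prod>i<d. ?P i) = 0" using i(1) by (intro prod_zero) auto
      then show ?thesis by simp
    qed (simp add: binomial_eq_0)
    ultimately show ?thesis unfolding card s_eq prod_eq by simp
  qed
qed

end
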